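(* Let $M$ and $M'$ be formal generic submanifolds through $0\in\mathbb C^N$ and $0\in\mathbb C^{N'}$, respectively, such that $M$ is of finite type at $0$ and $M'$ is $\ell_0$-nondegenerate at $0$ for some integer $\ell_0$. Let $d\ge1$ denote the codimension of $M$. Then there exists an integer $k_0$, depending only on $M$, with $1<k_0\le d+1$, such that the following holds. If $H^1,H^2:(M,0)\to(M',0)$ are CR submersive formal mappings such that $$\frac{\partial^{|\alpha|}H^1}{\partial Z^\alpha}(0)=\frac{\partial^{|\alpha|}H^2}{\partial Z^\alpha}(0)\qquad\text{for all }\alpha\text{ with }|\alpha|\le k_0\ell_0,$$ then $H^1\sim H^2$.
   Context: $\sim$ is equality of formal power series; for a formal series $f$, $\bar f$ is obtained by conjugating all coefficients. Formal submanifolds. A formal real submanifold $M$ of $\mathbb C^N$ through $0$ of codimension $d$ is given by $\rho=(\rho_1,\dots,\rho_d)\in\mathbb C[[Z,\zeta]]^d$, $Z=(Z_1,\dots,Z_N)$, $\zeta=(\zeta_1,\dots,\zeta_N)$, with $\rho(0)=0$, $\rho(Z,\zeta)\sim\bar\rho(\zeta,Z)$ and $\partial\rho_1(0)\wedge\dots\wedge\partial\rho_d(0)\ne0$; two such $\rho,\tilde\rho$ define the same $M$ if $\rho\sim a\tilde\rho$ for a $d\times d$ matrix $a(Z,\zeta)$ of formal power series. $M$ is generic if $\partial_Z\rho_1(0)\wedge\dots\wedge\partial_Z\rho_d(0)\neq0$. A formal vector field $X=\sum_j(a_j\partial_{Z_j}+b_j\partial_{\zeta_j})$, $a_j,b_j\in\mathbb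 C[[Z,\zeta]]$, is tangent to $M$ if $X\rho\sim a\rho$ for some $d\times d$ matrix $a$ of formal power series; it is of type $(1,0)$ if all $b_j\sim0$ and of type $(0,1)$ if all $a_j\sim0$. $\mathcal D_M$ is the $\mathbb C[[Z,\zeta]]$-module generated by all formal $(1,0)$ and $(0,1)$ vector fields tangent to $M$, $\mathfrak g_M$ the Lie algebra generated by $\mathcal D_M$, and $\mathcal D_M(0)\subset\mathfrak g_M(0)\subset T'_0\mathbb C^{2N}$ (holomorphic tangent space) the complex vector spaces obtained by evaluating coefficients at $0$. $M$ is of finite type at $0$ if $\dim_{\mathbb C}\mathfrak g_M(0)=2N-d$. Let $L_1,\dots,L_n$ ($n=N-d$) be a basis of the formal $(0,1)$ vector fields tangent to $M$ modulo those with coefficients in the ideal generated by $\rho_1,\dots,\rho_d$, and $L^\alpha=L_1^{\alpha_1}\cdots L_n^{\alpha_n}$. $M$ is $\ell_0$-nondegenerate at $0$ if $\ell_0$ is the smallest integer $\ell\ge0$ with $\mathrm{span}\{L^\alpha(\partial\rho_j/\partial Z)(0):1\le j\le d,|\alpha|\le\ell\}=\mathbb C^N$. Formal mappings. A formal mapping $H:(\mathbb C^N,0)\to(\mathbb C^{N'},0)$ is $H\in\mathbb C[[Z]]^{N'}$ without constant term; $\mathcal H(Z,\zeta)=(H(Z),\bar H(\zeta))$, and $d\mathcal H:T'_0\mathbb C^{2N}\to T'_0\mathbb C^{2N'}$ is its tangent mapping at $0$. $H:(M,0)\to(M',0)$ means $\rho'(H(Z),\bar H(\zeta))\sim c(Z,\zeta)\rho(Z,\zeta)$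 for some matrix $c$ of formal power series, $\rho,\rho'$ being defining series of $M,M'$. Such $H$ is CR submersive if $d\mathcal H(\mathcal D_M(0))=\mathcal D_{M'}(0)$. *)

theory Defs
  imports Complex_Main "HOL-Library.Poly_Mapping" "HOL-Library.Function_Algebras"
    "HOL-Combinatorics.Permutations"
begin

section \<open>Formal power series in several variables\<close>

abbreviation keys :: "('v \<Rightarrow>\<^sub>0 nat) \<Rightarrow> 'v set" where "keys \<equiv> Poly_Mapping.keys"
abbreviation lookup :: "('v \<Rightarrow>\<^sub>0 nat) \<Rightarrow> 'v \<Rightarrow> nat" where "lookup \<equiv> Poly_Mapping.lookup"

text \<open>
  Exponents are the finitely supported functions \<open>'v \<Rightarrow>\<^sub>0 nat\<close>.  All later objects have numbers of
  variables that are natural numbers quantified inside the statement, hence the variables are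
  drawn from an infinite type and \<open>mps_in V\<close> is the ring of series in the variables \<open>V\<close>.
\<close>

typedef 'v mps = "UNIV :: (('v \<Rightarrow>\<^sub>0 nat) \<Rightarrow> complex) set"
  morphisms mcoeff Abs_mps ..

setup_lifting type_definition_mps

lemma mps_eqI: "(\<And>m. mcoeff f m = mcoeff g m) \<Longrightarrow> f = g"
  by transfer auto

lemma finite_pm_antidiagonal: "finite {(a, b). a + b = (m :: 'v \<Rightarrow>\<^sub>0 nat)}"
proof -
  let ?B = "\<Union>x\<in>keys m. {..lookup m x}"
  let ?F = "{f :: 'v \<Rightarrow> nat. \<forall>x. (x \<in> keys m \<longrightarrow> f x \<in> ?B) \<and> (x \<notin> keys m \<longrightarrow> f x = (0::nat))}"
  have fin: "finite ?F"
    by (intro finite_set_of_finite_funs) auto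
  have inj: "inj_on (\<lambda>(a, b). lookup a) {(a, b). a + b = m}"
    by (auto simp: inj_on_def lookup_inject)
  have "(\<lambda>(a, b). lookup a) ` {(a, b). a + b = m} \<subseteq> ?F"
  proof (clarify, intro conjI impI)
    fix a b :: "'v \<Rightarrow>\<^sub>0 nat" and x
    assume m: "m = a + b"
    show "lookup a x \<in> (\<Union>x\<in>keys (a + b). {..lookup (a + b) x})" if "x \<in> keys (a + b)"
      using that by (auto simp: lookup_add intro!: bexI[of _ x])
    show "lookup a x = 0" if "x \<notin> keys (a + b)"
      using that by (simp add: in_keys_iff lookup_add)
  qed
  then show ?thesis
    using fin inj by (meson finite_imageD finite_subset)
qed

instantiation mps :: (type) comm_ring_1
begin

lift_definition zero_mps :: "'v mps" is "\<lambda>_. 0" .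
lift_definition one_mps :: "'v mps" is "\<lambda>m. if m = 0 then 1 else 0" .
lift_definition plus_mps :: "'v mps \<Rightarrow> 'v mps \<Rightarrow> 'v mps" is "\<lambda>f g m. f m + g m" .
lift_definition minus_mps :: "'v mps \<Rightarrow> 'v mps \<Rightarrow> 'v mps" is "\<lambda>f g m. f m - g m" .
lift_definition uminus_mps :: "'v mps \<Rightarrow> 'v mps" is "\<lambda>f m. - f m" .
lift_definition times_mps :: "'v mps \<Rightarrow> 'v mps \<Rightarrow> 'v mps"
  is "\<lambda>f g m. \<Sum>(a, b) | a + b = m. f a * g b" .

instance
proof
  fix f g h :: "'a mps"
  show "f + g + h = f + (g + h)" by transfer (simp add: add.assoc)
  show "f + g = g + f" by transfer (simp add: add.commute)
  show "0 + f = f" by transfer simp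
  show "- f + f = 0" by transfer simp
  show "f - g = f + - g" by transfer simp
  show "(0::'a mps) \<noteq> 1" by transfer (auto dest: fun_cong[of _ _ 0])
  show "(f + g) * h = f * h + g * h"
    by transfer (auto simp: sum.distrib[symmetric] distrib_right intro!: sum.cong)
  show "f * g = g * f"
    by transfer (rule ext, rule sum.reindex_bij_witness[where i = prod.swap and j = prod.swap],
        auto simp: add.commute mult.commute)
  show "1 * f = f"
  proof (rule mps_eqI)
    fix m
    have "mcoeff (1 * f) m = (\<Sum>p | fst p + snd p = m. (if fst p = 0 then mcoeff f (snd p) else 0))"
      by (simp add: times_mps.rep_eq one_mps.rep_eq case_prod_unfold if_distrib[of "\<lambda>x. x * _"] cong: if_cong)
    also have "\<dots> = (\<Sum>p \<in> {(0 :: 'a \<Rightarrow>\<^sub>0 nat, m)}. (if fst p = 0 then mcoeff f (snd p) else 0))"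
    proof (rule sum.mono_neutral_right)
      show "finite {p. fst p + snd p = m}"
        using finite_pm_antidiagonal[of m] by (simp add: case_prod_unfold)
    qed (auto split: if_splits)
    finally show "mcoeff (1 * f) m = mcoeff f m" by simp
  qed
  show "f * g * h = f * (g * h)"
  proof (rule mps_eqI)
    fix m
    let ?D = "\<lambda>m. {p. fst p + snd p = (m :: 'a \<Rightarrow>\<^sub>0 nat)}"
    have fin: "finite (?D m)" for m
      using finite_pm_antidiagonal[of m] by (simp add: case_prod_unfold)
    have "mcoeff (f * g * h) m =
        (\<Sum>p\<in>?D m. \<Sum>q\<in>?D (fst p). mcoeff f (fst q) * mcoeff g (snd q) * mcoeff h (snd p))"
      by (simp add: times_mps.rep_eq sum_distrib_right case_prod_unfold)
    also have "\<dots> = (\<Sum>(p, q)\<in>Sigma (?D m) (\<lambda>p. ?D (fst p)).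
        mcoeff f (fst q) * mcoeff g (snd q) * mcoeff h (snd p))"
      by (rule sum.Sigma) (use fin in blast)+
    also have "\<dots> = (\<Sum>(p, q)\<in>Sigma (?D m) (\<lambda>p. ?D (snd p)).
        mcoeff f (fst p) * (mcoeff g (fst q) * mcoeff h (snd q)))"
      by (rule sum.reindex_bij_witness
          [where j = "\<lambda>((a, b), (c, d)). ((c, d + b), (d, b))"
             and i = "\<lambda>((a, b), (c, d)). ((a + c, d), (a, c))"])
        (clarsimp simp: add.assoc mult.assoc)+
    also have "\<dots> = (\<Sum>p\<in>?D m. \<Sum>q\<in>?D (snd p).
        mcoeff f (fst p) * (mcoeff g (fst q) * mcoeff h (snd q)))"
      by (rule sum.Sigma[symmetric]) (use fin in blast)+
    also have "\<dots> = mcoeff (f * (g * h)) m"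
      by (simp add: times_mps.rep_eq sum_distrib_left case_prod_unfold)
    finally show "mcoeff (f * g * h) m = mcoeff (f * (g * h)) m" .
  qed
qed

end

definition mps_in :: "'v set \<Rightarrow> 'v mps set" where
  "mps_in V = {f. \<forall>m. mcoeff f m \<noteq> 0 \<longrightarrow> keys m \<subseteq> V}"

definition mps_at0 :: "'v mps \<Rightarrow> complex" where
  "mps_at0 f = mcoeff f 0"

lift_definition mps_const :: "complex \<Rightarrow> 'v mps" is "\<lambda>c m. if m = 0 then c else 0" .

lift_definition mps_var :: "'v \<Rightarrow> 'v mps" is "\<lambda>v m. if m = Poly_Mapping.single v 1 then 1 else 0" .

lift_definition mps_cnj :: "'v mps \<Rightarrow> 'v mps" is "\<lambda>f m. cnj (f m)" .

lift_definition mps_deriv :: "'v \<Rightarrow> 'v mps \<Rightarrow> 'v mps"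
  is "\<lambda>v f m. of_nat (lookup m v + 1) * f (m + Poly_Mapping.single v 1)" .

text \<open>
  Substitution \<open>f(g)\<close> of series \<open>g v\<close> for the variables \<open>v\<close>.  It is meant for \<open>f\<close> in finitely many
  variables and \<open>g v\<close> without constant term: a monomial of degree \<open>k\<close> in \<open>f\<close> then contributes
  to coefficients of degree at least \<open>k\<close> only, so the sum below has finite support (see
  \<open>mps_subst_finite_support\<close>).
\<close>

definition mps_subst :: "'v mps \<Rightarrow> ('v \<Rightarrow> 'w mps) \<Rightarrow> 'w mps" where
  "mps_subst f g =
     Abs_mps (\<lambda>m. Sum_any (\<lambda>a. mcoeff f a * mcoeff (\<Prod>v\<in>keys a. g v ^ lookup a v) m))"

definition pm_deg :: "('v \<Rightarrow>\<^sub>0 nat) \<Rightarrow> nat" where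
  "pm_deg m = (\<Sum>v\<in>keys m. lookup m v)"

lemma pm_deg_superset: "finite A \<Longrightarrow> keys m \<subseteq> A \<Longrightarrow> pm_deg m = (\<Sum>v\<in>A. lookup m v)"
  unfolding pm_deg_def by (rule sum.mono_neutral_left) (auto simp: in_keys_iff)

lemma pm_deg_add: "pm_deg (a + b) = pm_deg a + pm_deg b"
proof -
  have "keys (a + b) \<subseteq> keys a \<union> keys b" by (rule Poly_Mapping.keys_add)
  then show ?thesis
    by (simp add: pm_deg_superset[of "keys a \<union> keys b"] lookup_add sum.distrib)
qed

lemma mcoeff_mult_eq_0:
  assumes "\<And>a. pm_deg a < k \<Longrightarrow> mcoeff f a = 0" "\<And>b. pm_deg b < l \<Longrightarrow> mcoeff g b = 0"
    and "pm_deg m < k + l"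
  shows "mcoeff (f * g) m = 0"
proof -
  have "mcoeff f a * mcoeff g b = 0" if "a + b = m" for a b
  proof -
    have "pm_deg a < k \<or> pm_deg b < l"
      using assms(3) that by (auto simp: pm_deg_add)
    with assms(1,2) show ?thesis by auto
  qed
  then have "(\<Sum>(a, b) | a + b = m. mcoeff f a * mcoeff g b) = 0"
    by (intro sum.neutral) auto
  then show ?thesis by (simp add: times_mps.rep_eq)
qed

lemma mcoeff_power_eq_0:
  assumes "mcoeff f 0 = 0" "pm_deg m < k"
  shows "mcoeff (f ^ k) m = 0"
  using assms(2)
proof (induction k arbitrary: m)
  case (Suc k)
  have "mcoeff f a = 0" if "pm_deg a < 1" for a
  proof -
    have "lookup a v = 0" for v
      using that by (cases "v \<in> keys a") (auto simp: pm_deg_def in_keys_iff)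
    then have "a = 0" by (simp add: poly_mapping_eqI)
    with assms(1) show ?thesis by simp
  qed
  then have "mcoeff (f * f ^ k) m = 0"
    using Suc by (intro mcoeff_mult_eq_0[where k = 1 and l = k]) simp_all
  then show ?case by simp
qed simp

lemma mcoeff_prod_power_eq_0:
  assumes "finite A" "\<And>v. v \<in> A \<Longrightarrow> mcoeff (g v) 0 = 0" "pm_deg m < (\<Sum>v\<in>A. e v)"
  shows "mcoeff (\<Prod>v\<in>A. g v ^ e v) m = 0"
  using assms
proof (induction A arbitrary: m rule: finite_induct)
  case (insert x F)
  show ?case
    unfolding prod.insert[OF insert.hyps]
    by (rule mcoeff_mult_eq_0[where k = "e x" and l = "\<Sum>v\<in>F. e v"])
      (use insert in \<open>simp_all add: mcoeff_power_eq_0\<close>)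
qed simp

lemma mps_subst_finite_support:
  assumes "finite V" "f \<in> mps_in V" "\<And>v. v \<in> V \<Longrightarrow> mcoeff (g v) 0 = 0"
  shows "finite {a. mcoeff f a * mcoeff (\<Prod>v\<in>keys a. g v ^ lookup a v) m \<noteq> 0}"
proof -
  let ?F = "{h. \<forall>x. (x \<in> V \<longrightarrow> h x \<in> {..pm_deg m}) \<and> (x \<notin> V \<longrightarrow> h x = (0::nat))}"
  let ?S = "{a. mcoeff f a * mcoeff (\<Prod>v\<in>keys a. g v ^ lookup a v) m \<noteq> 0}"
  have "finite ?F" using assms(1) by (intro finite_set_of_finite_funs) auto
  moreover have "lookup ` ?S \<subseteq> ?F"
  proof (clarify, intro conjI impI)
    fix a x
    assume nz: "mcoeff f a * mcoeff (\<Prod>v\<in>keys a. g v ^ lookup a v) m \<noteq> 0"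
    then have k: "keys a \<subseteq> V" using assms(2) by (auto simp: mps_in_def)
    then show "lookup a x = 0" if "x \<notin> V" using that by (auto simp: in_keys_iff)
    have "\<not> pm_deg m < pm_deg a"
      using nz mcoeff_prod_power_eq_0[of "keys a" g m "lookup a"] k assms(3)
      by (auto simp: pm_deg_def)
    moreover have "lookup a x \<le> pm_deg a"
      by (cases "x \<in> keys a") (auto simp: pm_deg_def in_keys_iff intro: member_le_sum)
    ultimately show "lookup a x \<in> {..pm_deg m}" by simp
  qed
  moreover have "inj_on lookup ?S" by (auto simp: inj_on_def lookup_inject)
  ultimately show ?thesis by (meson finite_imageD finite_subset)
qed

text \<open>\<open>D\<^sub>0\<^bsup>\<alpha> 0\<^esup> \<dots> D\<^bsub>n-1\<^esub>\<^bsup>\<alpha> (n-1)\<^esup>\<close>, composed in this order.\<close>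

definition multi_pow :: "nat \<Rightarrow> (nat \<Rightarrow> 'a \<Rightarrow> 'a) \<Rightarrow> (nat \<Rightarrow> nat) \<Rightarrow> 'a \<Rightarrow> 'a" where
  "multi_pow n D \<alpha> = foldr (\<lambda>i F. (D i ^^ \<alpha> i) \<circ> F) [0..<n] id"


section \<open>Formal submanifolds\<close>

text \<open>
  Tuples are functions on an infinite index type that vanish outside the relevant index set.
  The variables \<open>Z\<^sub>j\<close> and \<open>\<zeta>\<^sub>j\<close> (\<open>j < N\<close>) are \<open>Inl j\<close> and \<open>Inr j\<close>.
\<close>

definition tuples :: "'i set \<Rightarrow> 'a::zero set \<Rightarrow> ('i \<Rightarrow> 'a) set" where
  "tuples I A = {x. (\<forall>i\<in>I. x i \<in> A) \<and> (\<forall>i. i \<notin> I \<longrightarrow> x i = 0)}"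

definition vars :: "nat \<Rightarrow> (nat + nat) set" where
  "vars N = {..<N} <+> {..<N}"

abbreviation series :: "nat \<Rightarrow> (nat + nat) mps set" where
  "series N \<equiv> mps_in (vars N)"

text \<open>
  \<open>wedge d w I\<close> is the coefficient \<open>det (w\<^sub>j (e\<^bsub>I k\<^esub>))\<^bsub>j,k<d\<^esub>\<close> of \<open>w\<^sub>0 \<and> \<dots> \<and> w\<^bsub>d-1\<^esub>\<close>, evaluated at the
  basis vectors \<open>e\<^bsub>I 0\<^esub>, \<dots>, e\<^bsub>I (d-1)\<^esub>\<close>.
\<close>

definition wedge :: "nat \<Rightarrow> (nat \<Rightarrow> 'i \<Rightarrow> complex) \<Rightarrow> (nat \<Rightarrow> 'i) \<Rightarrow> complex" where
  "wedge d w I = (\<Sum>\<sigma> | \<sigma> permutes {..<d}. of_int (sign \<sigma>) * (\<Prod>j<d. w j (I (\<sigma> j))))"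

definition is_defining :: "nat \<Rightarrow> nat \<Rightarrow> (nat \<Rightarrow> (nat + nat) mps) \<Rightarrow> bool" where
  "is_defining N d \<rho> \<longleftrightarrow>
     \<rho> \<in> tuples {..<d} (series N) \<and>
     (\<forall>j<d. mps_at0 (\<rho> j) = 0) \<and>
     (\<forall>j<d. \<rho> j = mps_subst (mps_cnj (\<rho> j)) (case_sum (mps_var \<circ> Inr) (mps_var \<circ> Inl))) \<and>
     wedge d (\<lambda>j v. mps_at0 (mps_deriv v (\<rho> j))) \<noteq> 0"

text \<open>\<open>\<sigma> = a \<rho>\<close> for some \<open>e \<times> d\<close> matrix \<open>a\<close> of formal power series.\<close>

definition is_matrix_multiple ::
  "nat \<Rightarrow> nat \<Rightarrow> (nat \<Rightarrow> (nat + nat) mps) \<Rightarrow> nat \<Rightarrow> (nat \<Rightarrow> (nat + nat) mps) \<Rightarrow> bool" where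
  "is_matrix_multiple N e \<sigma> d \<rho> \<longleftrightarrow>
     (\<exists>a. (\<forall>i<e. \<forall>j<d. a i j \<in> series N) \<and> (\<forall>i<e. \<sigma> i = (\<Sum>j<d. a i j * \<rho> j)))"

definition same_manifold :: "nat \<Rightarrow> nat \<Rightarrow> ((nat \<Rightarrow> (nat + nat) mps) \<times> (nat \<Rightarrow> (nat + nat) mps)) set" where
  "same_manifold N d =
     {(\<rho>, \<sigma>). is_defining N d \<rho> \<and> is_defining N d \<sigma> \<and> is_matrix_multiple N d \<rho> d \<sigma>}"

text \<open>
  A formal submanifold is the class of all its defining series, so that a quantity depending on
  it does not depend on the choice of defining series.
\<close>

type_synonym manifold = "(nat \<Rightarrow> (nat + nat) mps) set"

definition formal_submanifold :: "nat \<Rightarrow> nat \<Rightarrow> manifold \<Rightarrow> bool" where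
  "formal_submanifold N d M \<longleftrightarrow> M \<in> {\<rho>. is_defining N d \<rho>} // same_manifold N d"

definition generic :: "nat \<Rightarrow> manifold \<Rightarrow> bool" where
  "generic d M \<longleftrightarrow> (\<exists>\<rho>\<in>M. wedge d (\<lambda>j k. mps_at0 (mps_deriv (Inl k) (\<rho> j))) \<noteq> 0)"


section \<open>Tangent vector fields\<close>

text \<open>The field \<open>\<Sum>\<^sub>v X\<^sub>v \<partial>/\<partial>v\<close> is represented by its coefficients \<open>X\<close>.\<close>

type_synonym vfield = "nat + nat \<Rightarrow> (nat + nat) mps"

definition vf_apply :: "nat \<Rightarrow> vfield \<Rightarrow> (nat + nat) mps \<Rightarrow> (nat + nat) mps" where
  "vf_apply N X f = (\<Sum>v\<in>vars N. X v * mps_deriv v f)"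

definition vf_bracket :: "nat \<Rightarrow> vfield \<Rightarrow> vfield \<Rightarrow> vfield" where
  "vf_bracket N X Y = (\<lambda>v. vf_apply N X (Y v) - vf_apply N Y (X v))"

definition tangent_fields :: "nat \<Rightarrow> nat \<Rightarrow> manifold \<Rightarrow> vfield set" where
  "tangent_fields N d M = {X \<in> tuples (vars N) (series N).
     \<exists>\<rho>\<in>M. is_matrix_multiple N d (\<lambda>i. vf_apply N X (\<rho> i)) d \<rho>}"

definition tangent_10 :: "nat \<Rightarrow> nat \<Rightarrow> manifold \<Rightarrow> vfield set" where
  "tangent_10 N d M = {X \<in> tangent_fields N d M. \<forall>j<N. X (Inr j) = 0}"

definition tangent_01 :: "nat \<Rightarrow> nat \<Rightarrow> manifold \<Rightarrow> vfield set" where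
  "tangent_01 N d M = {X \<in> tangent_fields N d M. \<forall>j<N. X (Inl j) = 0}"

definition CR_fields :: "nat \<Rightarrow> nat \<Rightarrow> manifold \<Rightarrow> vfield set" where
  "CR_fields N d M =
     {(\<lambda>v. \<Sum>i<k. c i * X i v) | (k::nat) c X.
        \<forall>i<k. c i \<in> series N \<and> X i \<in> tangent_10 N d M \<union> tangent_01 N d M}"

inductive_set lie_algebra_generated :: "nat \<Rightarrow> vfield set \<Rightarrow> vfield set" for N S where
  gen: "X \<in> S \<Longrightarrow> X \<in> lie_algebra_generated N S"
| zero: "0 \<in> lie_algebra_generated N S"
| add: "X \<in> lie_algebra_generated N S \<Longrightarrow> Y \<in> lie_algebra_generated N S \<Longrightarrow>
    X + Y \<in> lie_algebra_generated N S"
| scale: "X \<in> lie_algebra_generated N S \<Longrightarrow>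
    (\<lambda>v. mps_const c * X v) \<in> lie_algebra_generated N S"
| bracket: "X \<in> lie_algebra_generated N S \<Longrightarrow> Y \<in> lie_algebra_generated N S \<Longrightarrow>
    vf_bracket N X Y \<in> lie_algebra_generated N S"

definition CR_lie_algebra :: "nat \<Rightarrow> nat \<Rightarrow> manifold \<Rightarrow> vfield set" where
  "CR_lie_algebra N d M = lie_algebra_generated N (CR_fields N d M)"

definition fields_at0 :: "vfield set \<Rightarrow> (nat + nat \<Rightarrow> complex) set" where
  "fields_at0 S = (\<lambda>X v. mps_at0 (X v)) ` S"

definition cvec_scale :: "complex \<Rightarrow> ('i \<Rightarrow> complex) \<Rightarrow> 'i \<Rightarrow> complex" where
  "cvec_scale c x = (\<lambda>i. c * x i)"

global_interpretation cvec: vector_space "cvec_scale :: complex \<Rightarrow> ('i \<Rightarrow> complex) \<Rightarrow> 'i \<Rightarrow> complex"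
  by unfold_locales (auto simp: cvec_scale_def fun_eq_iff algebra_simps)

definition finite_type :: "nat \<Rightarrow> nat \<Rightarrow> manifold \<Rightarrow> bool" where
  "finite_type N d M \<longleftrightarrow> cvec.dim (fields_at0 (CR_lie_algebra N d M)) = 2 * N - d"


section \<open>Nondegeneracy\<close>

definition series_ideal :: "nat \<Rightarrow> nat \<Rightarrow> (nat \<Rightarrow> (nat + nat) mps) \<Rightarrow> (nat + nat) mps set" where
  "series_ideal N d \<rho> = {(\<Sum>j<d. a j * \<rho> j) | a. \<forall>j<d. a j \<in> series N}"

text \<open>
  \<open>L\<^sub>0, \<dots>, L\<^bsub>N-d-1\<^esub>\<close> is a basis, over \<open>\<complex>[[Z,\<zeta>]]/(\<rho>)\<close>, of the \<open>(0,1)\<close> tangent fields modulo those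
  with coefficients in the ideal \<open>(\<rho>)\<close>.
\<close>

definition is_basis_01 ::
  "nat \<Rightarrow> nat \<Rightarrow> manifold \<Rightarrow> (nat \<Rightarrow> (nat + nat) mps) \<Rightarrow> (nat \<Rightarrow> vfield) \<Rightarrow> bool" where
  "is_basis_01 N d M \<rho> L \<longleftrightarrow>
     (\<forall>i<N - d. L i \<in> tangent_01 N d M) \<and>
     (\<forall>X\<in>tangent_01 N d M. \<exists>c. (\<forall>i<N - d. c i \<in> series N) \<and>
        (\<forall>v. X v - (\<Sum>i<N - d. c i * L i v) \<in> series_ideal N d \<rho>)) \<and>
     (\<forall>c. (\<forall>i<N - d. c i \<in> series N) \<and>
        (\<forall>v. (\<Sum>i<N - d. c i * L i v) \<in> series_ideal N d \<rho>) \<longrightarrow>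
        (\<forall>i<N - d. c i \<in> series_ideal N d \<rho>))"

definition nondeg_span ::
  "nat \<Rightarrow> nat \<Rightarrow> (nat \<Rightarrow> (nat + nat) mps) \<Rightarrow> (nat \<Rightarrow> vfield) \<Rightarrow> nat \<Rightarrow> (nat \<Rightarrow> complex) set" where
  "nondeg_span N d \<rho> L l = cvec.span
     {(\<lambda>k. if k < N
           then mps_at0 (multi_pow (N - d) (\<lambda>i. vf_apply N (L i)) \<alpha> (mps_deriv (Inl k) (\<rho> j)))
           else 0) | j \<alpha>. j < d \<and> (\<Sum>i<N - d. \<alpha> i) \<le> l}"

definition nondegenerate :: "nat \<Rightarrow> nat \<Rightarrow> manifold \<Rightarrow> nat \<Rightarrow> bool" where
  "nondegenerate N d M l0 \<longleftrightarrow>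
     (\<exists>\<rho>\<in>M. \<exists>L. is_basis_01 N d M \<rho> L \<and>
        nondeg_span N d \<rho> L l0 = tuples {..<N} UNIV \<and>
        (\<forall>l<l0. nondeg_span N d \<rho> L l \<noteq> tuples {..<N} UNIV))"


section \<open>Formal mappings\<close>

definition formal_mapping :: "nat \<Rightarrow> nat \<Rightarrow> (nat \<Rightarrow> nat mps) \<Rightarrow> bool" where
  "formal_mapping N N' H \<longleftrightarrow>
     H \<in> tuples {..<N'} (mps_in {..<N}) \<and> (\<forall>k<N'. mps_at0 (H k) = 0)"

definition complexification :: "(nat \<Rightarrow> nat mps) \<Rightarrow> nat + nat \<Rightarrow> (nat + nat) mps" where
  "complexification H =
     case_sum (\<lambda>k. mps_subst (H k) (mps_var \<circ> Inl)) (\<lambda>k. mps_subst (mps_cnj (H k)) (mps_var \<circ> Inr))"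

definition maps_into ::
  "nat \<Rightarrow> nat \<Rightarrow> manifold \<Rightarrow> nat \<Rightarrow> nat \<Rightarrow> manifold \<Rightarrow> (nat \<Rightarrow> nat mps) \<Rightarrow> bool" where
  "maps_into N d M N' d' M' H \<longleftrightarrow>
     formal_mapping N N' H \<and>
     (\<exists>\<rho>\<in>M. \<exists>\<rho>'\<in>M'. is_matrix_multiple N d' (\<lambda>i. mps_subst (\<rho>' i) (complexification H)) d \<rho>)"

definition tangent_map ::
  "nat \<Rightarrow> (nat \<Rightarrow> nat mps) \<Rightarrow> (nat + nat \<Rightarrow> complex) \<Rightarrow> nat + nat \<Rightarrow> complex" where
  "tangent_map N H x = (\<lambda>w. \<Sum>v\<in>vars N. mps_at0 (mps_deriv v (complexification H w)) * x v)"

definition CR_submersive ::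
  "nat \<Rightarrow> nat \<Rightarrow> manifold \<Rightarrow> nat \<Rightarrow> nat \<Rightarrow> manifold \<Rightarrow> (nat \<Rightarrow> nat mps) \<Rightarrow> bool" where
  "CR_submersive N d M N' d' M' H \<longleftrightarrow>
     tangent_map N H ` fields_at0 (CR_fields N d M) = fields_at0 (CR_fields N' d' M')"

definition same_jet :: "nat \<Rightarrow> nat \<Rightarrow> nat \<Rightarrow> (nat \<Rightarrow> nat mps) \<Rightarrow> (nat \<Rightarrow> nat mps) \<Rightarrow> bool" where
  "same_jet N N' r H1 H2 \<longleftrightarrow>
     (\<forall>\<alpha>. (\<Sum>i<N. \<alpha> i) \<le> r \<longrightarrow>
        (\<forall>k<N'. mps_at0 (multi_pow N mps_deriv \<alpha> (H1 k)) = mps_at0 (multi_pow N mps_deriv \<alpha> (H2 k))))"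

end

(*
  Put h = H1 - H2, let J be the ideal of M, and take k0 = d + 1.  Expanding rho'(H1) - rho'(H2) to
  first order on M, and differentiating along (0,1) fields that push forward to the fields of M',
  the l0-nondegeneracy of M' shows that h(Z) lies in the ideal generated by J and the derivatives
  of order at most l0 of the conjugate series of h in zeta.  Differentiating in Z along fields
  tangent to M and conjugating, the derivatives of h of order r are controlled by those of the
  conjugate of order r + l0 and vice versa.

  Instead of iterated Segre maps we compose formal flows of (1,0) and (0,1) fields in alternating
  blocks.  A block of one type leaves Z or zeta fixed, so every block costs l0 derivatives, and
  vanishing of the (d + 1) l0 - jet at 0 makes h(Z) vanish along d + 2 blocks.  The generic rank of
  the flow is at least 2 (N - d) after two blocks and grows with each further block until all
  (1,0) and (0,1) fields are tangent to the image, which happens after at most d + 2 blocks.  Then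
  the ideal of series vanishing along the flow is stable under the Lie algebra generated by these
  fields, and finite type forces it to contain no nonzero series in Z.
*)
theory Submission
  imports Defs "Jordan_Normal_Form.Determinant"
begin

section \<open>Coefficients\<close>

text \<open>Where d + 1 comes from: the tangent directions along M number 2N - d = 2(N - d) + d, so
  the rank can grow at most d times after two blocks. The parity is arranged so that block d + 1,
  counted from 0, moves \<zeta> only. As h depends on Z alone, it does not feel that block, and only
  d + 1 of the d + 2 blocks are paid for with l0 derivatives.

  The obstacle is that the image of a formal flow is not a set of points. It is replaced by a ring
  homomorphism into series in the time variables: vanishing along the flow is lying in its kernel,
  and generic rank is linear independence of the columns of its Jacobian over an integral domain.
  The fields annihilate \<rho> exactly, so this homomorphism kills the ideal of M and \<rho> = 0 is
  never solved. Ranks are bounded below by setting times to 0, since independence after a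
  specialization implies independence before it.

  Finite type is a condition at the origin. It spreads along the flow because a square matrix of
  series that is the identity at 0 is invertible; the same principle turns submersivity and
  nondegeneracy into identities of series.\<close>

lemma mcoeff_add [simp]: "mcoeff (f + g) m = mcoeff f m + mcoeff g m"
  and mcoeff_diff [simp]: "mcoeff (f - g) m = mcoeff f m - mcoeff g m"
  and mcoeff_uminus [simp]: "mcoeff (- f) m = - mcoeff f m"
  and mcoeff_zero [simp]: "mcoeff 0 m = 0"
  and mcoeff_one: "mcoeff 1 m = (if m = 0 then 1 else 0)"
  and mcoeff_const: "mcoeff (mps_const c) m = (if m = 0 then c else 0)"
  and mcoeff_var: "mcoeff (mps_var v) m = (if m = Poly_Mapping.single v 1 then 1 else 0)"
  and mcoeff_cnj [simp]: "mcoeff (mps_cnj f) m = cnj (mcoeff f m)"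
  and mcoeff_deriv: "mcoeff (mps_deriv v f) m =
        of_nat (lookup m v + 1) * mcoeff f (m + Poly_Mapping.single v 1)"
  by (transfer; simp)+

lemma mcoeff_sum: "mcoeff (sum f A) m = (\<Sum>x\<in>A. mcoeff (f x) m)"
  by (induction A rule: infinite_finite_induct) auto

lemma mcoeff_mult:
  "mcoeff (f * g) m = (\<Sum>p | fst p + snd p = m. mcoeff f (fst p) * mcoeff g (snd p))"
  by (simp add: times_mps.rep_eq case_prod_unfold)

lemma finite_antidiagonal [simp]: "finite {p. fst p + snd p = (m :: 'v \<Rightarrow>\<^sub>0 nat)}"
  using finite_pm_antidiagonal[of m] by (simp add: case_prod_unfold)

lemma pm_eqI: "(\<And>v. lookup a v = lookup b v) \<Longrightarrow> a = b"
  by (simp add: poly_mapping_eqI)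

lemma pm_add_eq_0 [simp]: "a + b = (0 :: 'v \<Rightarrow>\<^sub>0 nat) \<longleftrightarrow> a = 0 \<and> b = 0"
proof
  assume "a + b = 0"
  then have "lookup a v + lookup b v = 0" for v by (metis lookup_add lookup_zero)
  then show "a = 0 \<and> b = 0" by (auto intro!: pm_eqI)
qed simp

lemma single_neq_0 [simp]: "Poly_Mapping.single v (Suc 0) \<noteq> (0 :: 'v \<Rightarrow>\<^sub>0 nat)"
  by (metis lookup_single_eq lookup_zero nat.simps(3))

lemma pm_deg_0 [simp]: "pm_deg 0 = 0" by (simp add: pm_deg_def)
lemma pm_deg_single [simp]: "pm_deg (Poly_Mapping.single v k) = k"
  by (simp add: pm_deg_def)
lemma pm_deg_eq_0 [simp]: "pm_deg m = 0 \<longleftrightarrow> m = 0"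
  by (auto simp: pm_deg_def in_keys_iff intro!: pm_eqI)

lemma pm_add_diff_single: "lookup m v > 0 \<Longrightarrow> Poly_Mapping.single v 1 + (m - Poly_Mapping.single v 1) = m"
  by (rule pm_eqI) (auto simp: lookup_add lookup_minus lookup_single when_def)

lemma mcoeff_mult_monom:
  assumes "\<And>x. mcoeff f x = (if x = e then c else 0)"
  shows "mcoeff (f * g) (e + m) = c * mcoeff g m"
    and "(\<And>n. k \<noteq> e + n) \<Longrightarrow> mcoeff (f * g) k = 0"
proof -
  have "mcoeff (f * g) (e + m) = (\<Sum>p\<in>{(e, m)}. mcoeff f (fst p) * mcoeff g (snd p))"
    unfolding mcoeff_mult by (rule sum.mono_neutral_right) (auto simp: assms)
  then show "mcoeff (f * g) (e + m) = c * mcoeff g m" by (simp add: assms)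
  show "mcoeff (f * g) k = 0" if "\<And>n. k \<noteq> e + n"
    unfolding mcoeff_mult by (rule sum.neutral) (use that in \<open>auto simp: assms\<close>)
qed

lemma mcoeff_const_mult [simp]: "mcoeff (mps_const c * f) m = c * mcoeff f m"
  using mcoeff_mult_monom(1)[of "mps_const c" 0 c f m] by (simp add: mcoeff_const)

lemma mcoeff_var_mult:
  "mcoeff (mps_var v * f) m = (if lookup m v = 0 then 0 else mcoeff f (m - Poly_Mapping.single v 1))"
proof (cases "lookup m v = 0")
  case True
  have "m \<noteq> Poly_Mapping.single v 1 + n" for n
    using True by (auto simp: lookup_add)
  then show ?thesis
    using True mcoeff_mult_monom(2)[of "mps_var v" "Poly_Mapping.single v 1" 1] by (simp add: mcoeff_var)
next
  case False
  then show ?thesis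
    using mcoeff_mult_monom(1)[of "mps_var v" "Poly_Mapping.single v 1" 1 f "m - Poly_Mapping.single v 1"]
      pm_add_diff_single[of m v] by (simp add: mcoeff_var)
qed

lemma mcoeff_mult_0 [simp]: "mcoeff (f * g) 0 = mcoeff f 0 * mcoeff g 0"
proof -
  have "{p. fst p + snd p = (0 :: 'a \<Rightarrow>\<^sub>0 nat)} = {(0, 0)}" by auto
  then show ?thesis by (simp add: mcoeff_mult)
qed

lemma mps_const_simps [simp]:
  "mps_const 0 = 0" "mps_const 1 = 1" "mps_const (a + b) = mps_const a + mps_const b"
  "mps_const (a - b) = mps_const a - mps_const b" "mps_const (- a) = - mps_const a"
  "mps_const (a * b) = mps_const a * mps_const b"
  by (rule mps_eqI; simp add: mcoeff_const mcoeff_one)+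

lemma mcoeff_one_0 [simp]: "mcoeff 1 0 = 1" by (simp add: mcoeff_one)
lemma mcoeff_const_0 [simp]: "mcoeff (mps_const c) 0 = c" by (simp add: mcoeff_const)
lemma mcoeff_var_0 [simp]: "mcoeff (mps_var v) 0 = 0"
  using single_neq_0[of v] by (simp add: mcoeff_var eq_commute[of 0])

lemma mps_deriv_add [simp]: "mps_deriv v (f + g) = mps_deriv v f + mps_deriv v g"
  and mps_deriv_diff [simp]: "mps_deriv v (f - g) = mps_deriv v f - mps_deriv v g"
  and mps_deriv_0 [simp]: "mps_deriv v 0 = 0"
  by (rule mps_eqI; simp add: mcoeff_deriv algebra_simps)+

lemma mps_deriv_const [simp]: "mps_deriv v (mps_const c) = 0"
  by (rule mps_eqI) (simp add: mcoeff_deriv mcoeff_const)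

lemma mps_deriv_var: "mps_deriv v (mps_var u) = (if u = v then 1 else 0)"
proof (rule mps_eqI)
  fix m
  have "m + Poly_Mapping.single v 1 = Poly_Mapping.single u (1::nat) \<longleftrightarrow> m = 0 \<and> u = v"
  proof
    assume *: "m + Poly_Mapping.single v 1 = Poly_Mapping.single u (1::nat)"
    have "pm_deg (m + Poly_Mapping.single v (1::nat)) = 1" unfolding * by simp
    then have "m = 0" by (simp add: pm_deg_add)
    moreover have "u = v" using * \<open>m = 0\<close>
      by (metis add_0 lookup_single_eq lookup_single_not_eq zero_neq_one)
    ultimately show "m = 0 \<and> u = v" by simp
  qed auto
  then show "mcoeff (mps_deriv v (mps_var u)) m = mcoeff (if u = v then 1 else 0) m"
    by (auto simp: mcoeff_deriv mcoeff_var mcoeff_one)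
qed

lemma mps_deriv_mult: "mps_deriv v (f * g) = mps_deriv v f * g + f * mps_deriv v g"
proof (rule mps_eqI)
  fix m
  let ?e = "Poly_Mapping.single v (1::nat)"
  \<comment> \<open>The weight \<open>lookup m v + 1\<close> is the exponent of v in
    \<open>m + ?e\<close> and splits between the two factors; \<open>half\<close> is the share of
    the first factor, reindexed by lowering its exponent by one.\<close>
  have half: "(\<Sum>p | fst p + snd p = m + ?e. of_nat (lookup (fst p) v) * mcoeff f (fst p) * mcoeff g (snd p))
      = mcoeff (mps_deriv v f * g) m" for f g :: "'a mps"
  proof -
    have "(\<Sum>p | fst p + snd p = m + ?e. of_nat (lookup (fst p) v) * mcoeff f (fst p) * mcoeff g (snd p))
      = (\<Sum>p | fst p + snd p = m + ?e \<and> lookup (fst p) v > 0. of_nat (lookup (fst p) v) * mcoeff f (fst p) * mcoeff g (snd p))"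
      by (rule sum.mono_neutral_right) (auto simp: finite_antidiagonal)
    also have "\<dots> = mcoeff (mps_deriv v f * g) m"
      unfolding mcoeff_mult
    proof (rule sum.reindex_bij_witness[where i = "\<lambda>p. (fst p + ?e, snd p)" and j = "\<lambda>p. (fst p - ?e, snd p)"])
      fix p assume "p \<in> {p. fst p + snd p = m + ?e \<and> 0 < lookup (fst p) v}"
      then have p: "fst p + snd p = m + ?e" "lookup (fst p) v > 0" by auto
      have q: "?e + (fst p - ?e) = fst p" using p(2) by (rule pm_add_diff_single)
      then show "(fst (fst p - ?e, snd p) + ?e, snd (fst p - ?e, snd p)) = p"
        by (simp add: add.commute)
      have "(fst p - ?e + snd p) + ?e = m + ?e" using p(1) q by (metis add.assoc add.commute)
      then show "(fst p - ?e, snd p) \<in> {p. fst p + snd p = m}" by simp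
      show "mcoeff (mps_deriv v f) (fst (fst p - ?e, snd p)) * mcoeff g (snd (fst p - ?e, snd p)) =
         of_nat (lookup (fst p) v) * mcoeff f (fst p) * mcoeff g (snd p)"
        using q p(2) by (simp add: mcoeff_deriv lookup_minus add.commute)
    next
      fix p assume "p \<in> {p. fst p + snd p = m}"
      then show "(fst p + ?e, snd p) \<in> {p. fst p + snd p = m + ?e \<and> 0 < lookup (fst p) v}"
        by (auto simp: lookup_add add_ac)
    qed simp
    finally show ?thesis .
  qed
  have swap: "(\<Sum>p | fst p + snd p = m + ?e. of_nat (lookup (snd p) v) * mcoeff f (fst p) * mcoeff g (snd p))
      = (\<Sum>p | fst p + snd p = m + ?e. of_nat (lookup (fst p) v) * mcoeff g (fst p) * mcoeff f (snd p))"
    by (rule sum.reindex_bij_witness[where i = prod.swap and j = prod.swap]) (auto simp: add_ac)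
  have "mcoeff (mps_deriv v (f * g)) m =
    (\<Sum>p | fst p + snd p = m + ?e. of_nat (lookup m v + 1) * (mcoeff f (fst p) * mcoeff g (snd p)))"
    by (simp add: mcoeff_deriv mcoeff_mult sum_distrib_left)
  also have "\<dots> = (\<Sum>p | fst p + snd p = m + ?e. of_nat (lookup (fst p) v) * mcoeff f (fst p) * mcoeff g (snd p)
       + of_nat (lookup (snd p) v) * mcoeff f (fst p) * mcoeff g (snd p))"
  proof (rule sum.cong[OF refl])
    fix p assume "p \<in> {p. fst p + snd p = m + ?e}"
    then have "lookup (fst p) v + lookup (snd p) v = lookup m v + 1"
      by (metis (mono_tags) lookup_add lookup_single_eq mem_Collect_eq)
    then show "of_nat (lookup m v + 1) * (mcoeff f (fst p) * mcoeff g (snd p)) =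
      of_nat (lookup (fst p) v) * mcoeff f (fst p) * mcoeff g (snd p)
       + of_nat (lookup (snd p) v) * mcoeff f (fst p) * mcoeff g (snd p)"
      by (metis (no_types, opaque_lifting) mult.assoc distrib_right of_nat_add)
  qed
  also have "\<dots> = mcoeff (mps_deriv v f * g + f * mps_deriv v g) m"
    unfolding sum.distrib swap half by (simp add: mult.commute[of f])
  finally show "mcoeff (mps_deriv v (f * g)) m = mcoeff (mps_deriv v f * g + f * mps_deriv v g) m" .
qed

lemma mps_deriv_commute: "mps_deriv u (mps_deriv v f) = mps_deriv v (mps_deriv u f)"
  by (rule mps_eqI, cases "u = v") (simp_all add: mcoeff_deriv lookup_add lookup_single add_ac)

lemma mps_deriv_sum: "mps_deriv v (sum f A) = (\<Sum>x\<in>A. mps_deriv v (f x))"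
  by (induction A rule: infinite_finite_induct) auto

lemma mps_cnj_simps [simp]:
  "mps_cnj 0 = 0" "mps_cnj 1 = 1" "mps_cnj (f + g) = mps_cnj f + mps_cnj g"
  "mps_cnj (f - g) = mps_cnj f - mps_cnj g" "mps_cnj (f * g) = mps_cnj f * mps_cnj g"
  "mps_cnj (mps_const c) = mps_const (cnj c)" "mps_cnj (mps_var v) = mps_var v"
  by (rule mps_eqI; simp add: mcoeff_mult mcoeff_const mcoeff_var mcoeff_one)+

lemma mps_cnj_cnj [simp]: "mps_cnj (mps_cnj f) = f" by (rule mps_eqI) simp

section \<open>Series in a set of variables\<close>

lemma mps_in_UNIV [simp]: "mps_in UNIV = UNIV" by (simp add: mps_in_def)

lemma mps_in_coeff: "f \<in> mps_in V \<Longrightarrow> \<not> keys m \<subseteq> V \<Longrightarrow> mcoeff f m = 0"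
  by (auto simp: mps_in_def)

lemma mps_in_simps [simp]:
  "0 \<in> mps_in V" "1 \<in> mps_in V" "mps_const c \<in> mps_in V"
  by (auto simp: mps_in_def mcoeff_one mcoeff_const split: if_splits)

lemma mps_in_var [simp]: "mps_var v \<in> mps_in V \<longleftrightarrow> v \<in> V"
  by (auto simp: mps_in_def mcoeff_var)

lemma mps_in_add [intro]: "f \<in> mps_in V \<Longrightarrow> g \<in> mps_in V \<Longrightarrow> f + g \<in> mps_in V"
  and mps_in_diff [intro]: "f \<in> mps_in V \<Longrightarrow> g \<in> mps_in V \<Longrightarrow> f - g \<in> mps_in V"
  and mps_in_uminus [intro]: "f \<in> mps_in V \<Longrightarrow> - f \<in> mps_in V"
  and mps_in_cnj [intro]: "f \<in> mps_in V \<Longrightarrow> mps_cnj f \<in> mps_in V"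
  unfolding mps_in_def by force+

lemma keys_add_nat: "keys (a + b) = keys a \<union> keys (b :: 'v \<Rightarrow>\<^sub>0 nat)"
  by (auto simp: in_keys_iff lookup_add)

lemma mps_in_mult [intro]:
  assumes "f \<in> mps_in V" "g \<in> mps_in V" shows "f * g \<in> mps_in V"
  unfolding mps_in_def
proof safe
  fix m x assume nz: "mcoeff (f * g) m \<noteq> 0" and "x \<in> keys m"
  then obtain p where "fst p + snd p = m" "mcoeff f (fst p) * mcoeff g (snd p) \<noteq> 0"
    unfolding mcoeff_mult by (metis (mono_tags, lifting) mem_Collect_eq sum.neutral)
  then have p: "fst p + snd p = m" "mcoeff f (fst p) \<noteq> 0" "mcoeff g (snd p) \<noteq> 0" by auto
  then have "keys (fst p) \<subseteq> V" "keys (snd p) \<subseteq> V" using assms unfolding mps_in_def by blast+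
  then have "keys m \<subseteq> V" unfolding p(1)[symmetric] keys_add_nat by blast
  then show "x \<in> V" using \<open>x \<in> keys m\<close> by blast
qed

lemma mps_in_sum [intro]: "(\<And>x. x \<in> A \<Longrightarrow> f x \<in> mps_in V) \<Longrightarrow> sum f A \<in> mps_in V"
  by (induction A rule: infinite_finite_induct) auto

lemma mps_in_power [intro]: "f \<in> mps_in V \<Longrightarrow> f ^ k \<in> mps_in V"
  by (induction k) auto

lemma mps_in_prod [intro]: "(\<And>x. x \<in> A \<Longrightarrow> f x \<in> mps_in V) \<Longrightarrow> prod f A \<in> mps_in V"
  by (induction A rule: infinite_finite_induct) auto

lemma mps_in_deriv [intro]:
  assumes "f \<in> mps_in V" shows "mps_deriv v f \<in> mps_in V"
  unfolding mps_in_def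
proof (intro CollectI allI impI)
  fix m assume "mcoeff (mps_deriv v f) m \<noteq> 0"
  then have "mcoeff f (m + Poly_Mapping.single v 1) \<noteq> 0" unfolding mcoeff_deriv by simp
  then have "keys (m + Poly_Mapping.single v 1) \<subseteq> V" using assms unfolding mps_in_def by blast
  then show "keys m \<subseteq> V" unfolding keys_add_nat by blast
qed

lemma mps_in_mono: "f \<in> mps_in U \<Longrightarrow> U \<subseteq> V \<Longrightarrow> f \<in> mps_in V"
  by (auto simp: mps_in_def)

lemma mps_deriv_outside: "f \<in> mps_in V \<Longrightarrow> v \<notin> V \<Longrightarrow> mps_deriv v f = 0"
  by (rule mps_eqI) (auto simp: mcoeff_deriv mps_in_def keys_add_nat)

text \<open>Setting all variables outside V to 0. It is a ring homomorphism and a projection onto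
  \<open>mps_in V\<close>, hence serves both as a specialization and as a reduction to finitely many
  variables.\<close>

lift_definition mps_restrict :: "'v set \<Rightarrow> 'v mps \<Rightarrow> 'v mps"
  is "\<lambda>V f m. if keys m \<subseteq> V then f m else 0" .

lemma mcoeff_restrict: "mcoeff (mps_restrict V f) m = (if keys m \<subseteq> V then mcoeff f m else 0)"
  by transfer simp

lemma mps_restrict_simps [simp]:
  "mps_restrict V 0 = 0" "mps_restrict V (f + g) = mps_restrict V f + mps_restrict V g"
  "mps_restrict V (f - g) = mps_restrict V f - mps_restrict V g"
  "mps_restrict V (mps_const c) = mps_const c"
  by (rule mps_eqI; auto simp: mcoeff_restrict mcoeff_const)+

lemma mps_restrict_mult [simp]: "mps_restrict V (f * g) = mps_restrict V f * mps_restrict V g"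
proof (rule mps_eqI)
  fix m
  show "mcoeff (mps_restrict V (f * g)) m = mcoeff (mps_restrict V f * mps_restrict V g) m"
  proof (cases "keys m \<subseteq> V")
    case True
    then show ?thesis by (auto simp: mcoeff_mult mcoeff_restrict keys_add_nat intro!: sum.cong)
  next
    case False
    then show ?thesis unfolding mcoeff_mult mcoeff_restrict
      by (subst sum.neutral) (auto simp: keys_add_nat)
  qed
qed

lemma mps_restrict_sum: "mps_restrict V (sum f A) = (\<Sum>x\<in>A. mps_restrict V (f x))"
  by (induction A rule: infinite_finite_induct) auto

lemma mps_restrict_in [simp]: "mps_restrict V f \<in> mps_in V"
  by (auto simp: mps_in_def mcoeff_restrict)

lemma mps_restrict_id: "f \<in> mps_in V \<Longrightarrow> mps_restrict V f = f"
  by (rule mps_eqI) (auto simp: mcoeff_restrict mps_in_def)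

lemma mps_restrict_restrict [simp]: "mps_restrict U (mps_restrict V f) = mps_restrict (U \<inter> V) f"
  by (rule mps_eqI) (auto simp: mcoeff_restrict)

lemma mps_restrict_deriv: "v \<in> V \<Longrightarrow> mps_restrict V (mps_deriv v f) = mps_deriv v (mps_restrict V f)"
  by (rule mps_eqI) (auto simp: mcoeff_restrict mcoeff_deriv keys_add_nat)

lemma mps_restrict_empty: "mps_restrict {} f = mps_const (mcoeff f 0)"
  by (rule mps_eqI) (auto simp: mcoeff_restrict mcoeff_const)

section \<open>Series form an integral domain\<close>

lemma finite_pm_deg: 
  assumes "finite V" shows "finite {m. keys m \<subseteq> V \<and> pm_deg m \<le> k}"
proof -
  let ?F = "{h. \<forall>x. (x \<in> V \<longrightarrow> h x \<in> {..k}) \<and> (x \<notin> V \<longrightarrow> h x = (0::nat))}"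
  let ?S = "{m. keys m \<subseteq> V \<and> pm_deg m \<le> k}"
  have "finite ?F" using assms by (intro finite_set_of_finite_funs) auto
  moreover have "lookup ` ?S \<subseteq> ?F"
  proof (clarify, intro conjI impI)
    fix a x assume a: "keys a \<subseteq> V" "pm_deg a \<le> k"
    then show "lookup a x = 0" if "x \<notin> V" using that by (auto simp: in_keys_iff)
    have "lookup a x \<le> pm_deg a"
      by (cases "x \<in> keys a") (auto simp: pm_deg_def in_keys_iff intro: member_le_sum)
    then show "lookup a x \<in> {..k}" using a by simp
  qed
  moreover have "inj_on lookup ?S" by (auto simp: inj_on_def lookup_inject)
  ultimately show ?thesis by (meson finite_imageD finite_subset)
qed

text \<open>Leading monomials multiply: among the exponents of least degree take the greatest one in
  the linear order inherited from the variables, which is compatible with addition. Finitely many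
  variables guarantee such a maximum, so both series are restricted to the variables of one nonzero
  monomial of each. The domain property gives meaning to ranks of flows, whose times are indexed by
  \<open>nat\<close>.\<close>

lemma mps_mult_eq_0:
  fixes f g :: "('v::linorder) mps"
  assumes "f * g = 0" shows "f = 0 \<or> g = 0"
proof (rule ccontr)
  assume "\<not> (f = 0 \<or> g = 0)"
  then obtain mf mg where mf: "mcoeff f mf \<noteq> 0" and mg: "mcoeff g mg \<noteq> 0"
    by (metis mps_eqI mcoeff_zero)
  define V where "V = keys mf \<union> keys mg"
  have V: "finite V" by (simp add: V_def)
  define F where "F = mps_restrict V f"
  define G where "G = mps_restrict V g"
  have FG: "F * G = 0" using assms by (metis F_def G_def mps_restrict_mult mps_restrict_simps(1))
  have max: "\<exists>a d. mcoeff H a \<noteq> 0 \<and> pm_deg a = d \<and> (\<forall>b. mcoeff H b \<noteq> 0 \<longrightarrow> d \<le> pm_deg b) \<and>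
     (\<forall>b. mcoeff H b \<noteq> 0 \<longrightarrow> pm_deg b = d \<longrightarrow> b \<le> a)"
    if "mcoeff H m \<noteq> 0" "H \<in> mps_in V" for H m
  proof -
    define d where "d = (LEAST d. \<exists>b. mcoeff H b \<noteq> 0 \<and> pm_deg b = d)"
    have d: "\<exists>b. mcoeff H b \<noteq> 0 \<and> pm_deg b = d" unfolding d_def by (rule LeastI_ex) (use that in auto)
    have dl: "mcoeff H b \<noteq> 0 \<Longrightarrow> d \<le> pm_deg b" for b unfolding d_def by (rule Least_le) auto
    let ?S = "{b. mcoeff H b \<noteq> 0 \<and> pm_deg b = d}"
    have fin: "finite ?S"
      by (rule finite_subset[OF _ finite_pm_deg[OF V, of d]]) (use that(2) in \<open>auto simp: mps_in_def\<close>)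
    have "Max ?S \<in> ?S" using d fin by (intro Max_in) auto
    then show ?thesis using dl fin by (intro exI[of _ "Max ?S"] exI[of _ d]) auto
  qed
  obtain a d where a: "mcoeff F a \<noteq> 0" "pm_deg a = d" "\<And>b. mcoeff F b \<noteq> 0 \<Longrightarrow> d \<le> pm_deg b"
     "\<And>b. mcoeff F b \<noteq> 0 \<Longrightarrow> pm_deg b = d \<Longrightarrow> b \<le> a"
    using max[of F mf] mf by (auto simp: F_def mcoeff_restrict V_def)
  obtain b e where b: "mcoeff G b \<noteq> 0" "pm_deg b = e" "\<And>x. mcoeff G x \<noteq> 0 \<Longrightarrow> e \<le> pm_deg x"
     "\<And>x. mcoeff G x \<noteq> 0 \<Longrightarrow> pm_deg x = e \<Longrightarrow> x \<le> b"
    using max[of G mg] mg by (auto simp: G_def mcoeff_restrict V_def)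
  have "mcoeff (F * G) (a + b) = (\<Sum>p\<in>{(a, b)}. mcoeff F (fst p) * mcoeff G (snd p))"
    unfolding mcoeff_mult
  proof (rule sum.mono_neutral_right)
    show "\<forall>p\<in>{p. fst p + snd p = a + b} - {(a, b)}. mcoeff F (fst p) * mcoeff G (snd p) = 0"
    proof (rule ballI, rule ccontr)
      fix p assume p: "p \<in> {p. fst p + snd p = a + b} - {(a, b)}" and nz: "mcoeff F (fst p) * mcoeff G (snd p) \<noteq> 0"
      have s: "fst p + snd p = a + b" using p by simp
      then have "pm_deg (fst p) + pm_deg (snd p) = d + e" using a(2) b(2) by (metis pm_deg_add)
      moreover have "d \<le> pm_deg (fst p)" "e \<le> pm_deg (snd p)" using nz a(3) b(3) by auto
      ultimately have "pm_deg (fst p) = d" "pm_deg (snd p) = e" by auto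
      then have le: "fst p \<le> a" "snd p \<le> b" using nz a(4) b(4) by auto
      then have "fst p = a"
        using s by (metis add_less_le_mono less_irrefl order_le_less)
      then have "p = (a, b)" using s by (metis add_left_imp_eq prod.collapse)
      then show False using p by simp
    qed
  qed auto
  then show False using FG a(1) b(1) by simp
qed

instance mps :: (linorder) idom
  by standard (use mps_mult_eq_0 in blast)

section \<open>Homomorphisms and derivations\<close>

lemma mcoeff_low_0: "mcoeff f 0 = 0 \<Longrightarrow> pm_deg a < 1 \<Longrightarrow> mcoeff f a = 0"
  by simp

text \<open>The quotient by v of those terms of the series that v divides.\<close>

lift_definition mps_shift :: "'v \<Rightarrow> 'v mps \<Rightarrow> 'v mps"
  is "\<lambda>v f m. f (m + Poly_Mapping.single v 1)" .

lemma mps_shift_in: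
  assumes "f \<in> mps_in V" shows "mps_shift v f \<in> mps_in V"
proof -
  have "keys m \<subseteq> V" if "mcoeff f (m + Poly_Mapping.single v 1) \<noteq> 0" for m
  proof -
    have "keys (m + Poly_Mapping.single v 1) \<subseteq> V" using assms that unfolding mps_in_def by blast
    then show ?thesis unfolding keys_add_nat by blast
  qed
  then show ?thesis by (simp add: mps_in_def mps_shift.rep_eq)
qed

lemma mps_split_var: "f = mps_restrict (- {u}) f + mps_var u * mps_shift u f"
proof (rule mps_eqI)
  fix m
  show "mcoeff f m = mcoeff (mps_restrict (- {u}) f + mps_var u * mps_shift u f) m"
  proof (cases "lookup m u = 0")
    case True then show ?thesis by (simp add: mcoeff_var_mult mcoeff_restrict in_keys_iff)
  next
    case False
    then have "\<not> keys m \<subseteq> - {u}" by (auto simp: in_keys_iff)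
    moreover have "m - Poly_Mapping.single u 1 + Poly_Mapping.single u 1 = m"
      using False pm_add_diff_single[of m u] by (simp add: add.commute)
    ultimately show ?thesis using False
      by (simp add: mcoeff_var_mult mcoeff_restrict mps_shift.rep_eq)
  qed
qed

lemma mps_restrict_in_mono: "f \<in> mps_in V \<Longrightarrow> mps_restrict U f \<in> mps_in V"
  by (auto simp: mps_in_def mcoeff_restrict)

text \<open>Hadamard's lemma for series: one variable u is split off, and the others are split off
  from the part with u = 0.\<close>

lemma mps_decompose:
  assumes "finite U" "f \<in> mps_in W"
  shows "\<exists>q. (\<forall>u\<in>U. q u \<in> mps_in W) \<and> f = mps_restrict (- U) f + (\<Sum>u\<in>U. mps_var u * q u)"
  using assms
proof (induction U arbitrary: f)
  case empty then show ?case by (simp add: mps_restrict_id)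
next
  case (insert u U)
  let ?g = "mps_restrict (- {u}) f"
  obtain q where q: "\<forall>u\<in>U. q u \<in> mps_in W" "?g = mps_restrict (- U) ?g + (\<Sum>u\<in>U. mps_var u * q u)"
    using insert.IH[of ?g] insert.prems by (auto simp: mps_restrict_in_mono)
  let ?q = "q(u := mps_shift u f)"
  have "f = ?g + mps_var u * mps_shift u f" by (rule mps_split_var)
  also have "\<dots> = mps_restrict (- insert u U) f + ((\<Sum>u\<in>U. mps_var u * q u) + mps_var u * mps_shift u f)"
  proof -
    have "- U \<inter> - {u} = - insert u U" by auto
    then show ?thesis by (subst q(2)) (simp add: add.assoc)
  qed
  also have "(\<Sum>u\<in>U. mps_var u * q u) = (\<Sum>u\<in>U. mps_var u * ?q u)"
    using insert.hyps by (intro sum.cong) auto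
  also have "\<dots> + mps_var u * mps_shift u f = (\<Sum>u\<in>insert u U. mps_var u * ?q u)"
    using insert.hyps by simp
  finally show ?case using q(1) insert.prems by (intro exI[of _ ?q]) (auto simp: mps_shift_in)
qed

lemma mps_decompose_all:
  assumes "finite V" "f \<in> mps_in V"
  shows "\<exists>q. (\<forall>u\<in>V. q u \<in> mps_in V) \<and> f = mps_const (mcoeff f 0) + (\<Sum>u\<in>V. mps_var u * q u)"
proof -
  have "mps_restrict (- V) f = mps_restrict (- V) (mps_restrict V f)"
    using assms by (simp add: mps_restrict_id)
  also have "\<dots> = mps_const (mcoeff f 0)"
    by (simp add: mps_restrict_empty)
  finally show ?thesis using mps_decompose[OF assms] by simp
qed

text \<open>An identity between series follows once it is compatible with multiplication by variables:
  the order of \<open>E f\<close> can be increased indefinitely.\<close>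

lemma mps_functional_zero:
  assumes V: "finite V" and f: "f \<in> mps_in V"
    and add: "\<And>f g. f \<in> mps_in V \<Longrightarrow> g \<in> mps_in V \<Longrightarrow> E (f + g) = E f + E g"
    and const: "\<And>c. E (mps_const c) = 0"
    and var: "\<And>v f. v \<in> V \<Longrightarrow> f \<in> mps_in V \<Longrightarrow> E (mps_var v * f) = u v * E f"
    and u: "\<And>v. v \<in> V \<Longrightarrow> mcoeff (u v) 0 = 0"
  shows "E f = 0"
proof -
  have E0: "E 0 = 0" using const[of 0] by simp
  have E_sum: "E (sum q A) = (\<Sum>x\<in>A. E (q x))" if "finite A" "\<forall>x\<in>A. q x \<in> mps_in V" for q :: "'a \<Rightarrow> 'a mps" and A
    using that by (induction A rule: finite_induct) (auto simp: E0 add mps_in_sum)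
  have "mcoeff (E f) m = 0" if "pm_deg m < r" "f \<in> mps_in V" for r m f
    using that
  proof (induction r arbitrary: m f)
    case (Suc r)
    obtain q where q: "\<forall>u\<in>V. q u \<in> mps_in V" "f = mps_const (mcoeff f 0) + (\<Sum>u\<in>V. mps_var u * q u)"
      using mps_decompose_all[OF V Suc.prems(2)] by blast
    have in1: "\<forall>u\<in>V. mps_var u * q u \<in> mps_in V" using q(1) by (auto intro!: mps_in_mult)
    have "E f = E (mps_const (mcoeff f 0)) + (\<Sum>v\<in>V. E (mps_var v * q v))"
      by (subst q(2)) (use in1 in \<open>simp add: add mps_in_sum E_sum V\<close>)
    also have "\<dots> = (\<Sum>v\<in>V. u v * E (q v))"
      using q(1) by (simp add: const var)
    finally have "mcoeff (E f) m = (\<Sum>v\<in>V. mcoeff (u v * E (q v)) m)" by (simp add: mcoeff_sum)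
    also have "\<dots> = 0"
    proof (rule sum.neutral, rule ballI)
      fix v assume v: "v \<in> V"
      show "mcoeff (u v * E (q v)) m = 0"
        by (rule mcoeff_mult_eq_0[where k = 1 and l = r])
          (use v u q(1) Suc in \<open>auto intro: mcoeff_low_0\<close>)
    qed
    finally show ?case .
  qed simp
  then show ?thesis using f by (intro mps_eqI) auto
qed

text \<open>Neumann iteration for b (1 + N) = c. As N vanishes at 0, each round settles the
  coefficients of one more degree, so the iterates stabilize degree by degree.\<close>

lemma matrix_row_solve:
  fixes N :: "'i \<Rightarrow> 'i \<Rightarrow> 'v mps"
  assumes I: "finite I" and N0: "\<And>j k. j \<in> I \<Longrightarrow> k \<in> I \<Longrightarrow> mcoeff (N j k) 0 = 0"
    and NV: "\<And>j k. j \<in> I \<Longrightarrow> k \<in> I \<Longrightarrow> N j k \<in> mps_in V" and c: "\<And>k. k \<in> I \<Longrightarrow> c k \<in> mps_in V"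
  shows "\<exists>b. \<forall>k\<in>I. b k \<in> mps_in V \<and> b k = c k - (\<Sum>j\<in>I. b j * N j k)"
proof -
  define x where "x r = ((\<lambda>y k. c k - (\<Sum>j\<in>I. y j * N j k)) ^^ r) (\<lambda>_. 0)" for r
  have x0: "x 0 k = 0" and xS: "x (Suc r) k = c k - (\<Sum>j\<in>I. x r j * N j k)" for r k
    by (simp_all add: x_def)
  have xV: "k \<in> I \<Longrightarrow> x r k \<in> mps_in V" for r k
    by (induction r arbitrary: k) (auto simp: x0 xS c NV intro!: mps_in_diff mps_in_sum mps_in_mult)
  have mono: "mcoeff ((y - z) * N j k) m = 0"
    if "\<And>m. pm_deg m < r \<Longrightarrow> mcoeff y m = mcoeff z m" "pm_deg m < Suc r" "j \<in> I" "k \<in> I" for y z j k r m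
    by (rule mcoeff_mult_eq_0[where k = r and l = 1]) (use that N0 in \<open>auto intro: mcoeff_low_0\<close>)
  have stab: "k \<in> I \<Longrightarrow> pm_deg m < r \<Longrightarrow> mcoeff (x r k) m = mcoeff (x (r + s) k) m" for k m r s
  proof (induction r arbitrary: k m)
    case (Suc r)
    have "mcoeff (x r j * N j k) m = mcoeff (x (r + s) j * N j k) m" if "j \<in> I" for j
      using mono[where y = "x r j" and z = "x (r + s) j", OF Suc.IH[OF that] Suc.prems(2) that Suc.prems(1)]
      by (simp add: left_diff_distrib)
    then show ?case by (simp add: xS mcoeff_sum)
  qed simp
  \<comment> \<open>A coefficient of degree q is final from iterate q + 1 on, hence it is read off
    there.\<close>
  define b where "b k = Abs_mps (\<lambda>m. mcoeff (x (Suc (pm_deg m)) k) m)" for k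
  have b: "mcoeff (b k) m = mcoeff (x (Suc (pm_deg m)) k) m" for k m
    by (simp add: b_def Abs_mps_inverse)
  have bx: "mcoeff (b k) m = mcoeff (x r k) m" if "k \<in> I" "pm_deg m < r" for k m r
    using stab[OF that(1), of m "Suc (pm_deg m)" "r - Suc (pm_deg m)"] that by (simp add: b)
  show ?thesis
  proof (intro exI ballI conjI)
    fix k assume k: "k \<in> I"
    show "b k \<in> mps_in V" using xV[OF k] by (auto simp: mps_in_def b)
    show "b k = c k - (\<Sum>j\<in>I. b j * N j k)"
    proof (rule mps_eqI)
      fix m
      have "mcoeff (b j * N j k) m = mcoeff (x (pm_deg m) j * N j k) m" if "j \<in> I" for j
        using mono[where y = "b j" and z = "x (pm_deg m) j" and r = "pm_deg m", OF bx[OF that] _ that k, of m]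
        by (simp add: left_diff_distrib)
      then show "mcoeff (b k) m = mcoeff (c k - (\<Sum>j\<in>I. b j * N j k)) m"
        by (simp add: b xS mcoeff_sum)
    qed
  qed
qed

text \<open>Row i of the inverse solves b = e_i - b (M - 1), and M - 1 vanishes at 0. This is how
  information at the origin becomes information about series.\<close>

lemma matrix_left_inverse:
  fixes M :: "'i \<Rightarrow> 'i \<Rightarrow> 'v mps"
  assumes I: "finite I" and M0: "\<And>j k. j \<in> I \<Longrightarrow> k \<in> I \<Longrightarrow> mcoeff (M j k) 0 = (if j = k then 1 else 0)"
    and MV: "\<And>j k. j \<in> I \<Longrightarrow> k \<in> I \<Longrightarrow> M j k \<in> mps_in V"
  obtains B where "\<And>i j. i \<in> I \<Longrightarrow> j \<in> I \<Longrightarrow> B i j \<in> mps_in V"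
    "\<And>i k. i \<in> I \<Longrightarrow> k \<in> I \<Longrightarrow> (\<Sum>j\<in>I. B i j * M j k) = (if i = k then 1 else 0)"
proof -
  have "\<exists>b. \<forall>k\<in>I. b k \<in> mps_in V \<and> b k = (if i = k then 1 else 0) - (\<Sum>j\<in>I. b j * (M j k - (if j = k then 1 else 0)))" for i
    by (rule matrix_row_solve[OF I]) (use M0 MV in \<open>auto intro!: mps_in_diff\<close>)
  then have "\<forall>i. \<exists>b. \<forall>k\<in>I. b k \<in> mps_in V \<and> b k = (if i = k then 1 else 0) - (\<Sum>j\<in>I. b j * (M j k - (if j = k then 1 else 0)))"
    by blast
  from choice[OF this] obtain B where B: "\<And>i k. k \<in> I \<Longrightarrow> B i k \<in> mps_in V"
    "\<And>i k. k \<in> I \<Longrightarrow> B i k = (if i = k then 1 else 0) - (\<Sum>j\<in>I. B i j * (M j k - (if j = k then 1 else 0)))"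
    by blast
  have "(\<Sum>j\<in>I. B i j * M j k) = (if i = k then 1 else 0)" if "k \<in> I" for i k
  proof -
    have "(\<Sum>j\<in>I. B i j * (M j k - (if j = k then 1 else 0))) = (\<Sum>j\<in>I. B i j * M j k - (if j = k then B i j else 0))"
      by (rule sum.cong) (auto simp: algebra_simps)
    also have "\<dots> = (\<Sum>j\<in>I. B i j * M j k) - B i k"
      using I that by (simp add: sum_subtractf)
    finally show ?thesis using B(2)[OF that, of i] by (simp add: algebra_simps)
  qed
  then show thesis using B(1) that by blast
qed

text \<open>The laws are asked for on \<open>mps_in V\<close> with V finite, which is where
  \<open>mps_subst\<close> is meaningful. Sending variables to series without constant term replaces
  continuity: it lets identities between homomorphisms be checked on variables.\<close>

definition mps_hom :: "'v set \<Rightarrow> ('v mps \<Rightarrow> 'w mps) \<Rightarrow> bool" where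
  "mps_hom V \<phi> \<longleftrightarrow> finite V \<and> (\<forall>c. \<phi> (mps_const c) = mps_const c) \<and>
     (\<forall>f\<in>mps_in V. \<forall>g\<in>mps_in V. \<phi> (f + g) = \<phi> f + \<phi> g \<and> \<phi> (f * g) = \<phi> f * \<phi> g) \<and>
     (\<forall>v\<in>V. mcoeff (\<phi> (mps_var v)) 0 = 0)"

definition mps_derivation :: "('v mps \<Rightarrow> 'v mps) \<Rightarrow> bool" where
  "mps_derivation D \<longleftrightarrow> (\<forall>f g. D (f + g) = D f + D g) \<and> (\<forall>f g. D (f * g) = D f * g + f * D g) \<and>
     (\<forall>c. D (mps_const c) = 0)"

lemma derivation_deriv: "mps_derivation (mps_deriv v)"
  by (simp add: mps_derivation_def mps_deriv_mult)

context
  fixes D :: "'v mps \<Rightarrow> 'v mps" assumes D: "mps_derivation D"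
begin
lemma derivation_add: "D (f + g) = D f + D g" using D by (auto simp: mps_derivation_def)
lemma derivation_mult: "D (f * g) = D f * g + f * D g" using D by (auto simp: mps_derivation_def)
lemma derivation_const: "D (mps_const c) = 0" using D by (auto simp: mps_derivation_def)
lemma derivation_0: "D 0 = 0" using derivation_const[of 0] by simp
lemma derivation_diff: "D (f - g) = D f - D g"
  using derivation_add[of "f - g" g] by (simp add: algebra_simps)
lemma derivation_sum: "D (sum f A) = (\<Sum>x\<in>A. D (f x))"
  by (induction A rule: infinite_finite_induct) (auto simp: derivation_0 derivation_add)
end

context
  fixes V :: "'v set" and \<phi> :: "'v mps \<Rightarrow> 'w mps" assumes hom: "mps_hom V \<phi>"
begin
lemma hom_finite: "finite V" using hom by (auto simp: mps_hom_def)
lemma hom_const: "\<phi> (mps_const c) = mps_const c" using hom by (auto simp: mps_hom_def)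
lemma hom_0: "\<phi> 0 = 0" using hom_const[of 0] by simp
lemma hom_1: "\<phi> 1 = 1" using hom_const[of 1] by simp
lemma hom_add: "f \<in> mps_in V \<Longrightarrow> g \<in> mps_in V \<Longrightarrow> \<phi> (f + g) = \<phi> f + \<phi> g"
  using hom by (auto simp: mps_hom_def)
lemma hom_mult: "f \<in> mps_in V \<Longrightarrow> g \<in> mps_in V \<Longrightarrow> \<phi> (f * g) = \<phi> f * \<phi> g"
  using hom by (auto simp: mps_hom_def)
lemma hom_var_0: "v \<in> V \<Longrightarrow> mcoeff (\<phi> (mps_var v)) 0 = 0"
  using hom by (auto simp: mps_hom_def)
lemma hom_diff: "f \<in> mps_in V \<Longrightarrow> g \<in> mps_in V \<Longrightarrow> \<phi> (f - g) = \<phi> f - \<phi> g"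
  using hom_add[of "f - g" g] mps_in_diff[of f V g] by (auto simp: algebra_simps)
lemma hom_sum: "(\<And>x. x \<in> A \<Longrightarrow> f x \<in> mps_in V) \<Longrightarrow> \<phi> (sum f A) = (\<Sum>x\<in>A. \<phi> (f x))"
  by (induction A rule: infinite_finite_induct) (auto simp: hom_0 hom_add mps_in_sum)
lemma hom_coeff_0: 
  assumes f: "f \<in> mps_in V" shows "mcoeff (\<phi> f) 0 = mcoeff f 0"
proof -
  obtain q where q: "\<forall>u\<in>V. q u \<in> mps_in V" "f = mps_const (mcoeff f 0) + (\<Sum>u\<in>V. mps_var u * q u)"
    using mps_decompose_all[OF hom_finite f] by blast
  have "\<phi> f = mps_const (mcoeff f 0) + (\<Sum>u\<in>V. \<phi> (mps_var u) * \<phi> (q u))"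
    by (subst q(2)) (use q(1) in \<open>simp add: hom_add hom_sum hom_mult hom_const mps_in_sum mps_in_mult\<close>)
  then have "mcoeff (\<phi> f) 0 = mcoeff f 0 + (\<Sum>u\<in>V. mcoeff (\<phi> (mps_var u) * \<phi> (q u)) 0)"
    by (simp add: mcoeff_sum)
  also have "(\<Sum>u\<in>V. mcoeff (\<phi> (mps_var u) * \<phi> (q u)) 0) = 0"
    by (rule sum.neutral) (simp add: hom_var_0)
  finally show ?thesis by simp
qed
text \<open>By the product rule the difference E of the two sides satisfies E (v f) = \<phi> v * E
  f, and it kills constants. Such a functional has arbitrarily high order, so the rule holds for an
  arbitrary derivation D.\<close>

lemma hom_chain:
  assumes D: "mps_derivation D" and f: "f \<in> mps_in V"
  shows "D (\<phi> f) = (\<Sum>v\<in>V. \<phi> (mps_deriv v f) * D (\<phi> (mps_var v)))"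
proof -
  let ?E = "\<lambda>f. D (\<phi> f) - (\<Sum>v\<in>V. \<phi> (mps_deriv v f) * D (\<phi> (mps_var v)))"
  have "?E f = 0"
  proof (rule mps_functional_zero[OF hom_finite f, where u = "\<lambda>v. \<phi> (mps_var v)"])
    fix f g assume "f \<in> mps_in V" "g \<in> mps_in V"
    then show "?E (f + g) = ?E f + ?E g"
      by (simp add: hom_add derivation_add[OF D] mps_in_deriv sum.distrib algebra_simps)
  next
    fix v f assume v: "v \<in> V" and f: "f \<in> mps_in V"
    have "\<phi> (mps_deriv w (mps_var v * f)) = (if v = w then \<phi> f else 0) + \<phi> (mps_var v) * \<phi> (mps_deriv w f)" for w
      using v f by (simp add: mps_deriv_mult mps_deriv_var hom_add hom_mult mps_in_deriv mps_in_mult hom_0 hom_1)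
    then have "(\<Sum>w\<in>V. \<phi> (mps_deriv w (mps_var v * f)) * D (\<phi> (mps_var w))) =
      (\<Sum>w\<in>V. (if v = w then \<phi> f * D (\<phi> (mps_var w)) else 0) + \<phi> (mps_var v) * (\<phi> (mps_deriv w f) * D (\<phi> (mps_var w))))"
      by (intro sum.cong) (auto simp: algebra_simps)
    also have "\<dots> = \<phi> f * D (\<phi> (mps_var v)) + \<phi> (mps_var v) * (\<Sum>w\<in>V. \<phi> (mps_deriv w f) * D (\<phi> (mps_var w)))"
      using v hom_finite by (simp add: sum.distrib sum_distrib_left)
    finally show "?E (mps_var v * f) = \<phi> (mps_var v) * ?E f"
      using v f by (simp add: hom_mult derivation_mult[OF D] algebra_simps)
  qed (simp_all add: hom_const derivation_const[OF D] hom_0 hom_var_0)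
  then show ?thesis by simp
qed
end

lemma hom_unique:
  assumes a: "mps_hom V \<phi>" "mps_hom V \<psi>" "\<And>v. v \<in> V \<Longrightarrow> \<phi> (mps_var v) = \<psi> (mps_var v)" "f \<in> mps_in V"
  shows "\<phi> f = \<psi> f"
proof -
  have "\<phi> f - \<psi> f = 0"
    by (rule mps_functional_zero[OF hom_finite[OF a(1)] a(4), where u = "\<lambda>v. \<phi> (mps_var v)" and E = "\<lambda>f. \<phi> f - \<psi> f"])
      (auto simp: hom_add[OF a(1)] hom_add[OF a(2)] hom_mult[OF a(1)] hom_mult[OF a(2)] a(3)
         hom_const[OF a(1)] hom_const[OF a(2)] algebra_simps intro: hom_var_0[OF a(2)])
  then show ?thesis by simp
qed

lemma hom_comp:
  assumes "mps_hom V \<phi>" "mps_hom W \<psi>" "\<And>f. f \<in> mps_in V \<Longrightarrow> \<phi> f \<in> mps_in W"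
  shows "mps_hom V (\<lambda>f. \<psi> (\<phi> f))"
  unfolding mps_hom_def
  using hom_finite[OF assms(1)] assms(3) hom_const[OF assms(1)] hom_const[OF assms(2)]
    hom_add[OF assms(1)] hom_mult[OF assms(1)] hom_add[OF assms(2)] hom_mult[OF assms(2)]
    hom_coeff_0[OF assms(2)] hom_var_0[OF assms(1)]
  by auto

section \<open>Substitution\<close>

context
  fixes V :: "'v set" and g :: "'v \<Rightarrow> 'w mps"
  assumes V: "finite V" and g0: "\<And>v. v \<in> V \<Longrightarrow> mcoeff (g v) 0 = 0"
begin

text \<open>The bound k is left free so that coefficients of different degrees can be expanded over
  one common finite set of exponents, as is needed to exchange sums in a product.\<close>

private lemma subst_coeff:
  assumes f: "f \<in> mps_in V" and k: "pm_deg m \<le> k"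
  shows "mcoeff (mps_subst f g) m =
    (\<Sum>a | keys a \<subseteq> V \<and> pm_deg a \<le> k. mcoeff f a * mcoeff (\<Prod>v\<in>V. g v ^ lookup a v) m)"
proof -
  let ?B = "{a. keys a \<subseteq> V \<and> pm_deg a \<le> k}"
  have P: "(\<Prod>v\<in>keys a. g v ^ lookup a v) = (\<Prod>v\<in>V. g v ^ lookup a v)" if "keys a \<subseteq> V" for a
    by (rule prod.mono_neutral_left[OF V that]) (auto simp: in_keys_iff)
  have "mcoeff (mps_subst f g) m = Sum_any (\<lambda>a. mcoeff f a * mcoeff (\<Prod>v\<in>keys a. g v ^ lookup a v) m)"
    by (simp add: mps_subst_def Abs_mps_inverse)
  also have "\<dots> = (\<Sum>a\<in>?B. mcoeff f a * mcoeff (\<Prod>v\<in>keys a. g v ^ lookup a v) m)"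
  proof (rule Sum_any.expand_superset[OF finite_pm_deg[OF V]], clarify)
    fix a assume nz: "mcoeff f a * mcoeff (\<Prod>v\<in>keys a. g v ^ lookup a v) m \<noteq> 0"
    then have ka: "keys a \<subseteq> V" using f mps_in_coeff by fastforce
    have "\<not> pm_deg m < pm_deg a"
      using nz mcoeff_prod_power_eq_0[of "keys a" g m "lookup a"] ka g0 by (auto simp: pm_deg_def)
    then show "keys a \<subseteq> V \<and> pm_deg a \<le> k" using ka k by simp
  qed
  also have "\<dots> = (\<Sum>a\<in>?B. mcoeff f a * mcoeff (\<Prod>v\<in>V. g v ^ lookup a v) m)"
    by (rule sum.cong) (auto simp: P)
  finally show ?thesis .
qed

private lemma subst_add':
  assumes "f \<in> mps_in V" "h \<in> mps_in V" shows "mps_subst (f + h) g = mps_subst f g + mps_subst h g"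
  by (rule mps_eqI) (use assms in \<open>simp add: subst_coeff[OF _ order_refl] mps_in_add sum.distrib algebra_simps\<close>)

private lemma subst_const': "mps_subst (mps_const c) g = mps_const c"
proof (rule mps_eqI)
  fix m
  have "mcoeff (mps_subst (mps_const c) g) m =
    (\<Sum>a\<in>{0}. mcoeff (mps_const c) a * mcoeff (\<Prod>v\<in>V. g v ^ lookup a v) m)"
    unfolding subst_coeff[OF mps_in_simps(3) order_refl]
    by (rule sum.mono_neutral_right[OF finite_pm_deg[OF V]]) (auto simp: mcoeff_const)
  then show "mcoeff (mps_subst (mps_const c) g) m = mcoeff (mps_const c) m"
    by (simp add: mcoeff_const mcoeff_one)
qed

private lemma subst_var_mult':
  assumes v: "v \<in> V" and f: "f \<in> mps_in V"
  shows "mps_subst (mps_var v * f) g = g v * mps_subst f g"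
proof (rule mps_eqI)
  fix m
  let ?B = "\<lambda>k. {a. keys a \<subseteq> V \<and> pm_deg a \<le> k}" and ?e = "Poly_Mapping.single v (1::nat)"
  let ?P = "\<lambda>a. \<Prod>v\<in>V. g v ^ lookup a v"
  have P: "?P (a + ?e) = g v * ?P a" for a
  proof -
    have "?P (a + ?e) = (\<Prod>w\<in>V. g w ^ lookup a w * (if w = v then g v else 1))"
      by (rule prod.cong) (auto simp: lookup_add lookup_single when_def)
    also have "\<dots> = ?P a * g v" using v V by (simp add: prod.distrib)
    finally show ?thesis by (simp add: mult.commute)
  qed
  have "mcoeff (mps_subst (mps_var v * f) g) m =
    (\<Sum>a\<in>?B (pm_deg m + 1). mcoeff (mps_var v * f) a * mcoeff (?P a) m)"
    using f v by (intro subst_coeff) (auto intro!: mps_in_mult)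
  also have "\<dots> = (\<Sum>a | a \<in> ?B (pm_deg m + 1) \<and> lookup a v > 0. mcoeff (mps_var v * f) a * mcoeff (?P a) m)"
    by (rule sum.mono_neutral_right) (use finite_pm_deg[OF V] in \<open>auto simp: mcoeff_var_mult\<close>)
  also have "\<dots> = (\<Sum>b\<in>?B (pm_deg m). mcoeff f b * mcoeff (g v * ?P b) m)"
  proof (rule sum.reindex_bij_witness[where i = "\<lambda>b. b + ?e" and j = "\<lambda>a. a - ?e"])
    fix a assume a: "a \<in> {a \<in> ?B (pm_deg m + 1). 0 < lookup a v}"
    then have e: "?e + (a - ?e) = a" by (intro pm_add_diff_single) auto
    then show e': "a - ?e + ?e = a" by (simp add: add.commute)
    have "keys (a - ?e + ?e) \<subseteq> V \<and> pm_deg (a - ?e + ?e) \<le> pm_deg m + 1" using a unfolding e' by simp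
    then show "a - ?e \<in> ?B (pm_deg m)" unfolding keys_add_nat pm_deg_add by auto
    show "mcoeff f (a - ?e) * mcoeff (g v * ?P (a - ?e)) m = mcoeff (mps_var v * f) a * mcoeff (?P a) m"
      using a unfolding P[symmetric] e' by (simp add: mcoeff_var_mult)
  next
    fix b assume "b \<in> ?B (pm_deg m)"
    then show "b + ?e \<in> {a \<in> ?B (pm_deg m + 1). 0 < lookup a v}"
      using v by (auto simp: keys_add_nat pm_deg_add lookup_add)
  qed simp
  also have "\<dots> = (\<Sum>p | fst p + snd p = m. \<Sum>b\<in>?B (pm_deg m). mcoeff (g v) (fst p) * (mcoeff f b * mcoeff (?P b) (snd p)))"
    unfolding mcoeff_mult sum_distrib_left by (subst sum.swap) (simp add: mult_ac)
  also have "\<dots> = (\<Sum>p | fst p + snd p = m. mcoeff (g v) (fst p) * mcoeff (mps_subst f g) (snd p))"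
    by (rule sum.cong[OF refl]) (subst subst_coeff[OF f, where k = "pm_deg m"], auto simp: sum_distrib_left pm_deg_add)
  finally show "mcoeff (mps_subst (mps_var v * f) g) m = mcoeff (g v * mps_subst f g) m"
    by (simp add: mcoeff_mult)
qed

lemma subst_var: "v \<in> V \<Longrightarrow> mps_subst (mps_var v) g = g v"
  using subst_var_mult'[of v "mps_const 1"] subst_const'[of 1] by simp

lemma subst_hom: "mps_hom V (\<lambda>f. mps_subst f g)"
proof -
  have const_mult: "mps_subst (mps_const c * h) g = mps_const c * mps_subst h g" if "h \<in> mps_in V" for c h
    by (rule mps_eqI) (use that in \<open>simp add: subst_coeff[OF _ order_refl] mps_in_mult sum_distrib_left mult.assoc\<close>)
  have mult: "mps_subst (f * h) g = mps_subst f g * mps_subst h g" if f: "f \<in> mps_in V" and h: "h \<in> mps_in V" for f h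
  proof -
    have "mps_subst (f * h) g - mps_subst f g * mps_subst h g = 0"
    proof (rule mps_functional_zero[OF V f, where u = g])
      fix v f assume v: "v \<in> V" and f: "f \<in> mps_in V"
      show "mps_subst (mps_var v * f * h) g - mps_subst (mps_var v * f) g * mps_subst h g =
        g v * (mps_subst (f * h) g - mps_subst f g * mps_subst h g)"
        using subst_var_mult'[OF v f] subst_var_mult'[OF v mps_in_mult[OF f h]] by (simp add: algebra_simps)
    qed (use h in \<open>simp_all add: distrib_right subst_add' subst_const' const_mult mps_in_mult g0\<close>)
    then show ?thesis by simp
  qed
  show ?thesis unfolding mps_hom_def using V by (auto simp: subst_add' subst_const' mult subst_var g0)
qed

lemma subst_in:
  assumes f: "f \<in> mps_in V" and W: "\<And>v. v \<in> V \<Longrightarrow> g v \<in> mps_in W" shows "mps_subst f g \<in> mps_in W"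
proof -
  have "(\<Prod>v\<in>V. g v ^ lookup a v) \<in> mps_in W" for a using W by (intro mps_in_prod mps_in_power)
  then have "mcoeff (mps_subst f g) m = 0" if "\<not> keys m \<subseteq> W" for m
    unfolding subst_coeff[OF f order_refl] using that mps_in_coeff by (intro sum.neutral) fastforce
  then show ?thesis by (auto simp: mps_in_def)
qed

lemma subst_low_order:
  assumes f: "f \<in> mps_in V" and low: "\<And>a. pm_deg a \<le> k \<Longrightarrow> mcoeff f a = 0" and m: "pm_deg m \<le> k"
  shows "mcoeff (mps_subst f g) m = 0"
  unfolding subst_coeff[OF f m] using low by (intro sum.neutral) auto

end

lemma subst_cong:
  assumes "finite V" "\<And>v. v \<in> V \<Longrightarrow> mcoeff (g v) 0 = 0" "\<And>v. v \<in> V \<Longrightarrow> g v = h v" "f \<in> mps_in V"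
  shows "mps_subst f g = mps_subst f h"
proof -
  have h0: "v \<in> V \<Longrightarrow> mcoeff (h v) 0 = 0" for v using assms by auto
  show ?thesis
    using hom_unique[OF subst_hom[OF assms(1,2)] subst_hom[of V h], OF _ _ _ _ assms(4)] assms(1,3) h0
    by (simp add: subst_var[OF assms(1,2)] subst_var[of V h])
qed

lemma subst_subst:
  assumes V: "finite V" "\<And>v. v \<in> V \<Longrightarrow> mcoeff (g v) 0 = 0" "\<And>v. v \<in> V \<Longrightarrow> g v \<in> mps_in W"
    and W: "mps_hom W \<psi>" and f: "f \<in> mps_in V"
  shows "\<psi> (mps_subst f g) = mps_subst f (\<lambda>v. \<psi> (g v))"
proof -
  have 0: "v \<in> V \<Longrightarrow> mcoeff (\<psi> (g v)) 0 = 0" for v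
    using hom_coeff_0[OF W V(3)] V(2) by simp
  show ?thesis
    by (rule hom_unique[OF hom_comp[OF subst_hom[OF V(1,2)] W] subst_hom[OF V(1) 0] _ f])
      (use V 0 in \<open>auto simp: subst_var subst_in\<close>)
qed

lemma finite_vars [simp]: "finite (vars N)" by (simp add: vars_def)
lemma vars_iff [simp]: "Inl k \<in> vars N \<longleftrightarrow> k < N" "Inr k \<in> vars N \<longleftrightarrow> k < N"
  by (auto simp: vars_def)

lemma derivation_vf: "mps_derivation (vf_apply N X)"
  by (simp add: mps_derivation_def vf_apply_def mps_deriv_mult sum.distrib sum_distrib_left
      sum_distrib_right algebra_simps)

lemma vf_apply_var: "vf_apply N X (mps_var v) = (if v \<in> vars N then X v else 0)"
  by (simp add: vf_apply_def mps_deriv_var if_distrib[of "\<lambda>x. _ * x"] cong: if_cong)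

lemma vf_apply_in:
  assumes "\<And>v. v \<in> vars N \<Longrightarrow> X v \<in> series N" "f \<in> series N" shows "vf_apply N X f \<in> series N"
  unfolding vf_apply_def using assms by (intro mps_in_sum mps_in_mult mps_in_deriv) auto

section \<open>Taylor expansion of a substitution\<close>

text \<open>It is enough to expand f (x - y) in doubled variables: Hadamard's lemma is applied twice
  in the variables y, and x and y are specialized to g1 and g1 - g2. The derivatives thus end up at
  g1, the mapping along which fields will be lifted.\<close>

lemma subst_taylor:
  fixes V :: "'v set" and g1 g2 :: "'v \<Rightarrow> 'w mps"
  assumes V: "finite V" and f: "f \<in> mps_in V"
    and g1: "\<And>v. v \<in> V \<Longrightarrow> g1 v \<in> mps_in W" "\<And>v. v \<in> V \<Longrightarrow> mcoeff (g1 v) 0 = 0"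
    and g2: "\<And>v. v \<in> V \<Longrightarrow> g2 v \<in> mps_in W" "\<And>v. v \<in> V \<Longrightarrow> mcoeff (g2 v) 0 = 0"
  shows "\<exists>q. (\<forall>u\<in>V. \<forall>v\<in>V. q u v \<in> mps_in W) \<and>
    mps_subst f g1 - mps_subst f g2 = (\<Sum>u\<in>V. mps_subst (mps_deriv u f) g1 * (g1 u - g2 u))
      + (\<Sum>u\<in>V. \<Sum>v\<in>V. q u v * (g1 u - g2 u) * (g1 v - g2 v))"
proof -
  define V2 where "V2 = V <+> V"
  define U where "U = (Inr ` V :: ('v + 'v) set)"
  define c where "c v = (mps_var (Inl v) - mps_var (Inr v) :: ('v + 'v) mps)" for v
  define x where "x v = (mps_var (Inl v) :: ('v + 'v) mps)" for v
  have fin: "finite V2" "finite U" using V by (auto simp: V2_def U_def)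
  have c: "v \<in> V \<Longrightarrow> c v \<in> mps_in V2" "mcoeff (c v) 0 = 0" for v
    by (auto simp: c_def V2_def intro!: mps_in_diff)
  have x: "v \<in> V \<Longrightarrow> x v \<in> mps_in V2" "mcoeff (x v) 0 = 0" for v
    by (auto simp: x_def V2_def)
  define P where "P = mps_subst f c"
  have P: "P \<in> mps_in V2" unfolding P_def by (rule subst_in) (use V f c in auto)
  have sumU: "(\<Sum>u\<in>U. h u) = (\<Sum>v\<in>V. h (Inr v))" for h :: "'v + 'v \<Rightarrow> ('v + 'v) mps"
    unfolding U_def by (subst sum.reindex) (auto simp: inj_on_def)
  define R where "R = mps_restrict (- U)"
  have Rvar: "R (mps_var (Inl v)) = mps_var (Inl v)" "v \<in> V \<Longrightarrow> R (mps_var (Inr v)) = 0" for v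
  proof -
    show "R (mps_var (Inl v)) = mps_var (Inl v)" unfolding R_def
      by (rule mps_restrict_id) (auto simp: U_def)
    assume "v \<in> V"
    then show "R (mps_var (Inr v)) = 0" unfolding R_def
      by (intro mps_eqI) (auto simp: mcoeff_restrict mcoeff_var U_def)
  qed
  have Rhom: "mps_hom V2 R"
    unfolding mps_hom_def using fin by (auto simp: R_def mcoeff_restrict)
  have RP: "R (mps_subst h c) = mps_subst h x" if "h \<in> mps_in V" for h
  proof -
    have "R (mps_subst h c) = mps_subst h (\<lambda>v. R (c v))"
      by (rule subst_subst[OF V c(2) c(1) Rhom that])
    also have "\<dots> = mps_subst h x"
      by (rule subst_cong[OF V _ _ that]) (auto simp: c_def x_def R_def Rvar[unfolded R_def])
    finally show ?thesis .
  qed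
  obtain Q where Q: "\<forall>u\<in>U. Q u \<in> mps_in V2" "P = R P + (\<Sum>u\<in>U. mps_var u * Q u)"
    using mps_decompose[OF fin(2) P] unfolding R_def by blast
  have "\<forall>u\<in>U. \<exists>q. (\<forall>w\<in>U. q w \<in> mps_in V2) \<and> Q u = R (Q u) + (\<Sum>w\<in>U. mps_var w * q w)"
    using mps_decompose[OF fin(2)] Q(1) unfolding R_def by blast
  from bchoice[OF this] obtain Q2 where Q2: "\<And>u w. u \<in> U \<Longrightarrow> w \<in> U \<Longrightarrow> Q2 u w \<in> mps_in V2"
    "\<And>u. u \<in> U \<Longrightarrow> Q u = R (Q u) + (\<Sum>w\<in>U. mps_var w * Q2 u w)" by blast
  have Rmult: "R (a * b) = R a * R b" "R (a + b) = R a + R b" for a b by (simp_all add: R_def)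
  \<comment> \<open>The linear coefficient is found by differentiating f (x - y) in y_u and setting
    y = 0; the sign comes from the inner derivative.\<close>
  have RQ: "R (Q (Inr u)) = - mps_subst (mps_deriv u f) x" if u: "u \<in> V" for u
  proof -
    have "mps_deriv (Inr u) P = (\<Sum>v\<in>V. mps_subst (mps_deriv v f) c * mps_deriv (Inr u) (c v))"
      unfolding P_def
      using hom_chain[OF subst_hom[OF V c(2)] derivation_deriv f, of "Inr u"] subst_var[OF V c(2)]
      by simp
    also have "\<dots> = - mps_subst (mps_deriv u f) c"
    proof -
      have "mps_subst (mps_deriv v f) c * mps_deriv (Inr u) (c v) =
          (if v = u then - mps_subst (mps_deriv u f) c else 0)" for v
        by (simp add: c_def mps_deriv_var)
      then show ?thesis using u V by simp
    qed
    finally have 1: "R (mps_deriv (Inr u) P) = - mps_subst (mps_deriv u f) x"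
      using RP[OF mps_in_deriv[OF f], of u]
      by (metis R_def diff_0 mps_restrict_simps(1) mps_restrict_simps(3))
    have "R P \<in> mps_in (- U)" by (simp add: R_def)
    then have "mps_deriv (Inr u) (R P) = 0" by (rule mps_deriv_outside) (use u in \<open>auto simp: U_def\<close>)
    then have "mps_deriv (Inr u) P = (\<Sum>w\<in>U. mps_deriv (Inr u) (mps_var w) * Q w + mps_var w * mps_deriv (Inr u) (Q w))"
      by (subst Q(2)) (simp add: mps_deriv_sum mps_deriv_mult)
    then have "R (mps_deriv (Inr u) P) = (\<Sum>w\<in>U. R (mps_deriv (Inr u) (mps_var w)) * R (Q w) + R (mps_var w) * R (mps_deriv (Inr u) (Q w)))"
      by (simp add: R_def mps_restrict_sum)
    also have "\<dots> = (\<Sum>v\<in>V. if v = u then R (Q (Inr v)) else 0)"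
      unfolding sumU by (rule sum.cong) (auto simp: Rvar mps_deriv_var hom_1[OF Rhom] hom_0[OF Rhom])
    finally show ?thesis using 1 u V by simp
  qed
  define \<delta> where "\<delta> v = g1 v - g2 v" for v
  define \<psi> where "\<psi> h = mps_subst h (case_sum g1 \<delta>)" for h
  have \<psi>0: "v \<in> V2 \<Longrightarrow> mcoeff (case_sum g1 \<delta> v) 0 = 0" and \<psi>in: "v \<in> V2 \<Longrightarrow> case_sum g1 \<delta> v \<in> mps_in W" for v
    using g1 g2 by (auto simp: V2_def \<delta>_def intro!: mps_in_diff)
  have \<psi>: "mps_hom V2 \<psi>" unfolding \<psi>_def by (rule subst_hom[OF fin(1) \<psi>0])
  have \<psi>var: "v \<in> V2 \<Longrightarrow> \<psi> (mps_var v) = case_sum g1 \<delta> v" for v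
    unfolding \<psi>_def by (rule subst_var[OF fin(1) \<psi>0])
  have \<psi>h: "h \<in> mps_in V2 \<Longrightarrow> \<psi> h \<in> mps_in W" for h
    unfolding \<psi>_def by (rule subst_in[OF fin(1) \<psi>0 _ \<psi>in])
  have \<psi>x: "\<psi> (mps_subst h x) = mps_subst h g1" if "h \<in> mps_in V" for h
  proof -
    have "\<psi> (mps_subst h x) = mps_subst h (\<lambda>v. \<psi> (x v))" by (rule subst_subst[OF V x(2) x(1) \<psi> that])
    also have "\<dots> = mps_subst h g1"
    proof (rule subst_cong[OF V _ _ that])
      show eq: "\<psi> (x v) = g1 v" if "v \<in> V" for v
        using \<psi>var[of "Inl v"] that by (simp add: x_def V2_def InlI)
      show "mcoeff (\<psi> (x v)) 0 = 0" if "v \<in> V" for v using eq[OF that] g1(2)[OF that] by simp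
    qed
    finally show ?thesis .
  qed
  have \<psi>P: "\<psi> P = mps_subst f g2"
  proof -
    have "\<psi> P = mps_subst f (\<lambda>v. \<psi> (c v))" unfolding P_def by (rule subst_subst[OF V c(2) c(1) \<psi> f])
    also have "\<dots> = mps_subst f g2"
    proof (rule subst_cong[OF V _ _ f])
      show eq: "\<psi> (c v) = g2 v" if "v \<in> V" for v
        using \<psi>var[of "Inl v"] \<psi>var[of "Inr v"] that hom_diff[OF \<psi>, of "mps_var (Inl v)" "mps_var (Inr v)"]
        by (simp add: c_def V2_def InlI InrI \<delta>_def)
      show "mcoeff (\<psi> (c v)) 0 = 0" if "v \<in> V" for v using eq[OF that] g2(2)[OF that] by simp
    qed
    finally show ?thesis .
  qed
  have xin: "h \<in> mps_in V \<Longrightarrow> mps_subst h x \<in> mps_in V2" for h by (rule subst_in[OF V x(2) _ x(1)])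
  have UV: "v \<in> V \<Longrightarrow> Inr v \<in> U" "v \<in> V \<Longrightarrow> Inr v \<in> V2" for v by (auto simp: U_def V2_def)
  have \<psi>Q: "\<psi> (Q (Inr u)) = - mps_subst (mps_deriv u f) g1 + (\<Sum>v\<in>V. \<delta> v * \<psi> (Q2 (Inr u) (Inr v)))" if u: "u \<in> V" for u
  proof -
    have RQin: "R (Q (Inr u)) \<in> mps_in V2" using Q(1) UV(1)[OF u] by (auto simp: R_def mps_restrict_in_mono)
    have "\<psi> (Q (Inr u)) = \<psi> (R (Q (Inr u)) + (\<Sum>w\<in>U. mps_var w * Q2 (Inr u) w))"
      using Q2(2)[OF UV(1)[OF u]] by simp
    also have "\<dots> = \<psi> (R (Q (Inr u))) + (\<Sum>v\<in>V. \<delta> v * \<psi> (Q2 (Inr u) (Inr v)))"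
      unfolding sumU using UV Q2(1) u RQin
      by (simp add: hom_add[OF \<psi>] hom_sum[OF \<psi>] hom_mult[OF \<psi>] mps_in_sum mps_in_mult \<psi>var)
    also have "\<psi> (R (Q (Inr u))) = - mps_subst (mps_deriv u f) g1"
      unfolding RQ[OF u] using hom_diff[OF \<psi> _ xin[OF mps_in_deriv[OF f]], of 0 u] \<psi>x[OF mps_in_deriv[OF f]]
      by (simp add: hom_0[OF \<psi>])
    finally show ?thesis .
  qed
  have "mps_subst f g2 = \<psi> (mps_subst f x + (\<Sum>u\<in>U. mps_var u * Q u))"
    using Q(2) RP[OF f] \<psi>P unfolding P_def by metis
  also have "\<dots> = mps_subst f g1 + (\<Sum>u\<in>V. \<delta> u * \<psi> (Q (Inr u)))"
    unfolding sumU using UV Q(1) xin[OF f]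
    by (simp add: hom_add[OF \<psi>] hom_sum[OF \<psi>] hom_mult[OF \<psi>] mps_in_sum mps_in_mult \<psi>var \<psi>x f)
  also have "(\<Sum>u\<in>V. \<delta> u * \<psi> (Q (Inr u))) = - (\<Sum>u\<in>V. mps_subst (mps_deriv u f) g1 * \<delta> u)
     + (\<Sum>u\<in>V. \<Sum>v\<in>V. \<psi> (Q2 (Inr u) (Inr v)) * \<delta> u * \<delta> v)"
    by (simp add: \<psi>Q distrib_left sum.distrib sum_distrib_left sum_negf sum_subtractf algebra_simps cong: sum.cong)
  finally have "mps_subst f g1 - mps_subst f g2 = (\<Sum>u\<in>V. mps_subst (mps_deriv u f) g1 * \<delta> u)
     + (\<Sum>u\<in>V. \<Sum>v\<in>V. (- \<psi> (Q2 (Inr u) (Inr v))) * \<delta> u * \<delta> v)"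
    by (simp add: sum_negf)
  moreover have "\<forall>u\<in>V. \<forall>v\<in>V. - \<psi> (Q2 (Inr u) (Inr v)) \<in> mps_in W"
    using UV Q2(1) \<psi>h by auto
  ultimately show ?thesis unfolding \<delta>_def
    by (intro exI[of _ "\<lambda>u v. - \<psi> (Q2 (Inr u) (Inr v))"] conjI)
qed

section \<open>Inverse matrices\<close>

lemma wedge_inverse:
  assumes "wedge d w I \<noteq> 0"
  obtains C where "\<And>i l. i < d \<Longrightarrow> l < d \<Longrightarrow> (\<Sum>k<d. C i k * w k (I l)) = (if i = l then 1 else 0)"
    "\<And>i l. i < d \<Longrightarrow> l < d \<Longrightarrow> (\<Sum>k<d. w i (I k) * C k l) = (if i = l then 1 else 0)"
proof -
  define A where "A = mat d d (\<lambda>(j, k). w j (I k))"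
  have A: "A \<in> carrier_mat d d" by (simp add: A_def)
  have "det A = wedge d w I"
    unfolding det_def'[OF A] wedge_def lessThan_atLeast0
  proof (rule sum.cong[OF refl])
    fix p assume "p \<in> {p. p permutes {0..<d}}"
    then have "i < d \<Longrightarrow> p i < d" for i using permutes_in_image[of p "{0..<d}" i] by auto
    then have "(\<Prod>i = 0..<d. A $$ (i, p i)) = (\<Prod>j = 0..<d. w j (I (p j)))"
      by (intro prod.cong) (auto simp: A_def)
    then show "signof p * (\<Prod>i = 0..<d. A $$ (i, p i)) = of_int (sign p) * (\<Prod>j = 0..<d. w j (I (p j)))"
      by simp
  qed
  then have dA: "det A \<noteq> 0" using assms by simp
  define C where "C i k = inverse (det A) * adj_mat A $$ (i, k)" for i k
  have c: "adj_mat A \<in> carrier_mat d d" using adj_mat(1)[OF A] .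
  have "(\<Sum>k<d. C i k * w k (I l)) = (if i = l then 1 else 0)" if "i < d" "l < d" for i l
  proof -
    have e: "(\<Sum>k<d. adj_mat A $$ (i, k) * w k (I l)) = (adj_mat A * A) $$ (i, l)"
      using that c by (simp add: scalar_prod_def A_def lessThan_atLeast0)
    have "(\<Sum>k<d. adj_mat A $$ (i, k) * w k (I l)) = (if i = l then det A else 0)"
      unfolding e adj_mat(3)[OF A] using that by simp
    then show ?thesis using dA unfolding C_def mult.assoc sum_distrib_left[symmetric] by auto
  qed
  moreover have "(\<Sum>k<d. w i (I k) * C k l) = (if i = l then 1 else 0)" if "i < d" "l < d" for i l
  proof -
    have e: "(\<Sum>k<d. w i (I k) * adj_mat A $$ (k, l)) = (A * adj_mat A) $$ (i, l)"
      using that c by (simp add: scalar_prod_def A_def lessThan_atLeast0)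
    have "(\<Sum>k<d. w i (I k) * adj_mat A $$ (k, l)) = (if i = l then det A else 0)"
      unfolding e adj_mat(2)[OF A] using that by simp
    moreover have "(\<Sum>k<d. w i (I k) * C k l) = inverse (det A) * (\<Sum>k<d. w i (I k) * adj_mat A $$ (k, l))"
      unfolding C_def sum_distrib_left by (simp add: mult_ac)
    ultimately show ?thesis using dA by auto
  qed
  ultimately show thesis by (rule that)
qed

lemma complex_right_inverse_left:
  fixes A B :: "nat \<Rightarrow> nat \<Rightarrow> complex"
  assumes AB: "\<And>i l. i < d \<Longrightarrow> l < d \<Longrightarrow> (\<Sum>k<d. A i k * B k l) = (if i = l then 1 else 0)"
    and il: "i < d" "l < d"
  shows "(\<Sum>k<d. B i k * A k l) = (if i = l then 1 else 0)"
proof -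
  let ?A = "mat d d (\<lambda>(i, j). A i j)" and ?B = "mat d d (\<lambda>(i, j). B i j)"
  have "?A * ?B = 1\<^sub>m d"
  proof (rule eq_matI)
    fix i l assume "i < dim_row (1\<^sub>m d :: complex mat)" "l < dim_col (1\<^sub>m d :: complex mat)"
    then show "(?A * ?B) $$ (i, l) = 1\<^sub>m d $$ (i, l)"
      using AB[of i l, unfolded lessThan_atLeast0] by (simp add: scalar_prod_def)
  qed auto
  then have "?B * ?A = 1\<^sub>m d" using mat_mult_left_right_inverse[of ?A d ?B] by simp
  then have "(?B * ?A) $$ (i, l) = (1\<^sub>m d :: complex mat) $$ (i, l)" by simp
  then show ?thesis using il by (simp add: scalar_prod_def lessThan_atLeast0)
qed

lemma sum_delta_matrix:
  assumes "finite I" "i \<in> I"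
  shows "(\<Sum>j\<in>I. (if i = j then 1 else 0) * f j) = (f i :: 'a::comm_ring_1)"
    "(\<Sum>j\<in>I. f j * (if j = i then 1 else 0)) = f i"
  using assms by (simp_all add: if_distrib[of "\<lambda>x. x * _"] if_distrib[of "\<lambda>x. _ * x"] cong: if_cong)

lemma matrix_left_inverse_series:
  fixes A :: "nat \<Rightarrow> nat \<Rightarrow> 'v mps"
  assumes A: "\<And>i j. i < d \<Longrightarrow> j < d \<Longrightarrow> A i j \<in> mps_in V"
    and C: "\<And>i l. i < d \<Longrightarrow> l < d \<Longrightarrow> (\<Sum>k<d. C i k * mcoeff (A k l) 0) = (if i = l then 1 else 0)"
  obtains B where "\<And>i j. i < d \<Longrightarrow> j < d \<Longrightarrow> B i j \<in> mps_in V"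
    "\<And>i l. i < d \<Longrightarrow> l < d \<Longrightarrow> (\<Sum>k<d. B i k * A k l) = (if i = l then 1 else 0)"
proof -
  define M where "M i l = (\<Sum>k<d. mps_const (C i k) * A k l)" for i l
  have M: "mcoeff (M i l) 0 = (if i = l then 1 else 0)" "M i l \<in> mps_in V" if "i < d" "l < d" for i l
    using A C that by (auto simp: M_def mcoeff_sum intro!: mps_in_sum mps_in_mult)
  obtain B where B: "\<And>i j. i \<in> {..<d} \<Longrightarrow> j \<in> {..<d} \<Longrightarrow> B i j \<in> mps_in V"
    "\<And>i k. i \<in> {..<d} \<Longrightarrow> k \<in> {..<d} \<Longrightarrow> (\<Sum>j<d. B i j * M j k) = (if i = k then 1 else 0)"
    by (rule matrix_left_inverse[of "{..<d}" M V]) (use M in auto)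
  show thesis
  proof (rule that)
    show "(\<Sum>j<d. B i j * mps_const (C j k)) \<in> mps_in V" if "i < d" for i k
      using B(1) that by (auto intro!: mps_in_sum mps_in_mult)
    fix i l assume il: "i < d" "l < d"
    have "(\<Sum>k<d. (\<Sum>j<d. B i j * mps_const (C j k)) * A k l) = (\<Sum>j<d. B i j * M j l)"
      unfolding M_def sum_distrib_left sum_distrib_right by (subst sum.swap) (simp add: mult.assoc)
    then show "(\<Sum>k<d. (\<Sum>j<d. B i j * mps_const (C j k)) * A k l) = (if i = l then 1 else 0)"
      using B(2)[of i l] il by simp
  qed
qed

text \<open>A right inverse is a left inverse of the transpose; associativity makes it equal to the
  left inverse.\<close>

lemma matrix_inverse_series:
  fixes A :: "nat \<Rightarrow> nat \<Rightarrow> 'v mps"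
  assumes A: "\<And>i j. i < d \<Longrightarrow> j < d \<Longrightarrow> A i j \<in> mps_in V"
    and C: "\<And>i l. i < d \<Longrightarrow> l < d \<Longrightarrow> (\<Sum>k<d. C i k * mcoeff (A k l) 0) = (if i = l then 1 else 0)"
    and C': "\<And>i l. i < d \<Longrightarrow> l < d \<Longrightarrow> (\<Sum>k<d. mcoeff (A i k) 0 * C k l) = (if i = l then 1 else 0)"
  obtains B where "\<And>i j. i < d \<Longrightarrow> j < d \<Longrightarrow> B i j \<in> mps_in V"
    "\<And>i l. i < d \<Longrightarrow> l < d \<Longrightarrow> (\<Sum>k<d. B i k * A k l) = (if i = l then 1 else 0)"
    "\<And>i l. i < d \<Longrightarrow> l < d \<Longrightarrow> (\<Sum>k<d. A i k * B k l) = (if i = l then 1 else 0)"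
proof -
  obtain B where B: "\<And>i j. i < d \<Longrightarrow> j < d \<Longrightarrow> B i j \<in> mps_in V"
    "\<And>i l. i < d \<Longrightarrow> l < d \<Longrightarrow> (\<Sum>k<d. B i k * A k l) = (if i = l then 1 else 0)"
    by (rule matrix_left_inverse_series[OF A C], assumption+, rule that)
  obtain D' where D': "\<And>i j. i < d \<Longrightarrow> j < d \<Longrightarrow> D' i j \<in> mps_in V"
    "\<And>i l. i < d \<Longrightarrow> l < d \<Longrightarrow> (\<Sum>k<d. D' i k * A l k) = (if i = l then 1 else 0)"
  proof (rule matrix_left_inverse_series[of d "\<lambda>i j. A j i" V "\<lambda>i j. C j i"])
    show "(\<Sum>k<d. C k i * mcoeff (A l k) 0) = (if i = l then 1 else 0)" if "i < d" "l < d" for i l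
      using C'[OF that(2,1)] by (auto simp: mult.commute)
  qed (use A in auto)
  have AD: "(\<Sum>k<d. A i k * D' l k) = (if i = l then 1 else 0)" if "i < d" "l < d" for i l
    using D'(2)[OF that(2,1)] by (auto simp: mult.commute)
  have BD: "B i l = D' l i" if il: "i < d" "l < d" for i l
  proof -
    have "B i l = (\<Sum>j<d. B i j * (\<Sum>k<d. A j k * D' l k))"
    proof -
      have "(\<Sum>j<d. B i j * (\<Sum>k<d. A j k * D' l k)) = (\<Sum>j<d. B i j * (if j = l then 1 else 0))"
        using il AD by (intro sum.cong) auto
      then show ?thesis using il sum_delta_matrix(2)[of "{..<d}" l "B i"] by simp
    qed
    also have "\<dots> = (\<Sum>k<d. (\<Sum>j<d. B i j * A j k) * D' l k)"
      unfolding sum_distrib_left sum_distrib_right by (subst sum.swap) (simp add: mult.assoc)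
    also have "\<dots> = (\<Sum>k<d. (if i = k then 1 else 0) * D' l k)"
      using il B(2) by (intro sum.cong) auto
    also have "\<dots> = D' l i" using il sum_delta_matrix(1)[of "{..<d}" i "D' l"] by simp
    finally show ?thesis .
  qed
  have "(\<Sum>k<d. A i k * B k l) = (if i = l then 1 else 0)" if "i < d" "l < d" for i l
  proof -
    have "(\<Sum>k<d. A i k * B k l) = (\<Sum>k<d. A i k * D' l k)" using BD that by (intro sum.cong) auto
    then show ?thesis using AD[OF that] by simp
  qed
  then show thesis using B that by blast
qed

section \<open>Tangent fields adapted to a nondegenerate minor\<close>

text \<open>The variables \<open>p k\<close> play the role of the dependent variables in the
  implicit function theorem: the Jacobian of \<rho> with respect to them is invertible, with inverse
  B. The equations are never solved; the inverse matrix alone yields enough tangent fields.\<close>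

locale pivot =
  fixes N d :: nat and \<rho> :: "nat \<Rightarrow> (nat + nat) mps" and p :: "nat \<Rightarrow> nat + nat"
    and B :: "nat \<Rightarrow> nat \<Rightarrow> (nat + nat) mps"
  assumes rho_in: "j < d \<Longrightarrow> \<rho> j \<in> series N"
    and p_in: "k < d \<Longrightarrow> p k \<in> vars N"
    and p_inj: "inj_on p {..<d}"
    and B_in: "k < d \<Longrightarrow> j < d \<Longrightarrow> B k j \<in> series N"
    and B_left: "k < d \<Longrightarrow> l < d \<Longrightarrow> (\<Sum>j<d. B k j * mps_deriv (p l) (\<rho> j)) = (if k = l then 1 else 0)"
    and B_right: "i < d \<Longrightarrow> j < d \<Longrightarrow> (\<Sum>k<d. mps_deriv (p k) (\<rho> i) * B k j) = (if i = j then 1 else 0)"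
begin

definition free :: "(nat + nat) set" where "free = vars N - p ` {..<d}"

definition cf :: "nat \<Rightarrow> nat + nat \<Rightarrow> (nat + nat) mps" where
  "cf k v = (\<Sum>j<d. B k j * mps_deriv v (\<rho> j))"

text \<open>The coordinate field of v, corrected in the dependent directions so that it annihilates
  every component of \<rho> exactly and not only modulo the ideal.\<close>

definition T :: "nat + nat \<Rightarrow> vfield" where
  "T v u = (if u = v then 1 else 0) - (\<Sum>k<d. if u = p k then cf k v else 0)"

lemma free_vars: "v \<in> free \<Longrightarrow> v \<in> vars N" by (auto simp: free_def)
lemma finite_free [simp]: "finite free" by (simp add: free_def)

lemma cf_in: "k < d \<Longrightarrow> cf k v \<in> series N"
  unfolding cf_def using B_in rho_in by (auto intro!: mps_in_sum mps_in_mult mps_in_deriv)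

lemma cf_p: "k < d \<Longrightarrow> l < d \<Longrightarrow> cf k (p l) = (if k = l then 1 else 0)"
  by (simp add: cf_def B_left)

lemma T_in: "T v u \<in> series N"
  unfolding T_def using cf_in by (auto intro!: mps_in_diff mps_in_sum)

lemma T_outside: "v \<in> vars N \<Longrightarrow> u \<notin> vars N \<Longrightarrow> T v u = 0"
  unfolding T_def using p_in by (auto intro!: sum.neutral)

lemma T_free: "u \<in> free \<Longrightarrow> T v u = (if u = v then 1 else 0)"
  unfolding T_def by (subst sum.neutral) (auto simp: free_def)

lemma T_p: "l < d \<Longrightarrow> v \<in> free \<Longrightarrow> T v (p l) = - cf l v"
proof -
  assume l: "l < d" and v: "v \<in> free"
  have "(\<Sum>k<d. if p l = p k then cf k v else 0) = (\<Sum>k<d. if k = l then cf k v else 0)"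
    using p_inj l by (intro sum.cong) (auto simp: inj_on_def)
  then show ?thesis using l v by (auto simp: T_def free_def)
qed

lemma sum_vars_split: "(\<Sum>v\<in>vars N. h v) = (\<Sum>v\<in>free. h v) + (\<Sum>k<d. h (p k) :: 'x::comm_monoid_add)"
proof -
  have "vars N = free \<union> p ` {..<d}" using p_in by (auto simp: free_def)
  then have "(\<Sum>v\<in>vars N. h v) = (\<Sum>v\<in>free \<union> p ` {..<d}. h v)" by simp
  also have "\<dots> = (\<Sum>v\<in>free. h v) + (\<Sum>v\<in>p ` {..<d}. h v)"
    by (rule sum.union_disjoint) (auto simp: free_def)
  finally show ?thesis by (simp add: sum.reindex[OF p_inj])
qed

lemma card_free: "card free + d = 2 * N"
proof -
  have "card free = card (vars N) - card (p ` {..<d})"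
    unfolding free_def using p_in by (intro card_Diff_subset) auto
  moreover have "card (p ` {..<d}) \<le> card (vars N)" by (rule card_mono) (use p_in in auto)
  moreover have "card (vars N) = 2 * N" unfolding vars_def by (subst card_Plus) auto
  ultimately show ?thesis by (simp add: card_image[OF p_inj])
qed

lemma T_rho: "v \<in> free \<Longrightarrow> i < d \<Longrightarrow> vf_apply N (T v) (\<rho> i) = 0"
proof -
  assume v: "v \<in> free" and i: "i < d"
  have "vf_apply N (T v) (\<rho> i) = mps_deriv v (\<rho> i) - (\<Sum>k<d. cf k v * mps_deriv (p k) (\<rho> i))"
    unfolding vf_apply_def sum_vars_split using v
    by (simp add: T_free T_p if_distrib[of "\<lambda>x. x * _"] sum_negf cong: if_cong)
  also have "(\<Sum>k<d. cf k v * mps_deriv (p k) (\<rho> i)) =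
      (\<Sum>j<d. (\<Sum>k<d. mps_deriv (p k) (\<rho> i) * B k j) * mps_deriv v (\<rho> j))"
    unfolding cf_def sum_distrib_left sum_distrib_right by (subst sum.swap) (simp add: mult_ac)
  also have "\<dots> = mps_deriv v (\<rho> i)"
    using i sum_delta_matrix(1)[of "{..<d}" i "\<lambda>j. mps_deriv v (\<rho> j)"] by (simp add: B_right)
  finally show ?thesis by simp
qed

text \<open>In particular, a vector killed by the differential of \<open>\<rho>\<close> is determined by its free components.\<close>

lemma kernel_identity:
  fixes w :: "nat + nat \<Rightarrow> 'w mps"
  assumes \<phi>: "mps_hom (vars N) \<phi>" and u: "u \<in> vars N"
  shows "w u - (\<Sum>v\<in>free. w v * \<phi> (T v u)) =
    (\<Sum>l<d. if u = p l then \<Sum>j<d. \<phi> (B l j) * (\<Sum>v\<in>vars N. \<phi> (mps_deriv v (\<rho> j)) * w v) else 0)"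
proof (cases "u \<in> free")
  case True
  then have "(\<Sum>v\<in>free. w v * \<phi> (T v u)) = (\<Sum>v\<in>free. if v = u then w v else 0)"
    by (intro sum.cong) (auto simp: T_free hom_0[OF \<phi>] hom_1[OF \<phi>])
  moreover have "(\<Sum>l<d. if u = p l then \<Sum>j<d. \<phi> (B l j) * (\<Sum>v\<in>vars N. \<phi> (mps_deriv v (\<rho> j)) * w v) else 0) = 0"
    using True by (intro sum.neutral) (auto simp: free_def)
  ultimately show ?thesis using True by simp
next
  case False
  then obtain l where l: "l < d" "u = p l" using u by (auto simp: free_def)
  have neg: "\<phi> (T v u) = - \<phi> (cf l v)" if "v \<in> free" for v
    using hom_diff[OF \<phi>, of 0 "cf l v"] l T_p[OF l(1) that] cf_in[OF l(1)] by (simp add: hom_0[OF \<phi>])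
  have cf: "\<phi> (cf l v) = (\<Sum>j<d. \<phi> (B l j) * \<phi> (mps_deriv v (\<rho> j)))" for v
    unfolding cf_def using l rho_in B_in
    by (subst hom_sum[OF \<phi>]) (auto simp: hom_mult[OF \<phi>] mps_in_deriv intro!: mps_in_mult)
  have "(\<Sum>k<d. if u = p k then \<Sum>j<d. \<phi> (B k j) * (\<Sum>v\<in>vars N. \<phi> (mps_deriv v (\<rho> j)) * w v) else 0)
    = (\<Sum>k<d. if k = l then \<Sum>j<d. \<phi> (B k j) * (\<Sum>v\<in>vars N. \<phi> (mps_deriv v (\<rho> j)) * w v) else 0)"
    using l p_inj by (intro sum.cong) (auto simp: inj_on_def)
  also have "\<dots> = (\<Sum>j<d. \<phi> (B l j) * (\<Sum>v\<in>vars N. \<phi> (mps_deriv v (\<rho> j)) * w v))"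
    using l by simp
  also have "\<dots> = (\<Sum>v\<in>vars N. \<phi> (cf l v) * w v)"
    unfolding cf sum_distrib_left sum_distrib_right by (subst sum.swap) (simp add: mult_ac)
  also have "\<dots> = (\<Sum>v\<in>free. \<phi> (cf l v) * w v) + (\<Sum>k<d. (if l = k then 1 else 0) * w (p k))"
    unfolding sum_vars_split using l by (auto simp: cf_p hom_0[OF \<phi>] hom_1[OF \<phi>] intro!: sum.cong)
  also have "\<dots> = w u - (\<Sum>v\<in>free. w v * \<phi> (T v u))"
  proof -
    have "(\<Sum>v\<in>free. \<phi> (cf l v) * w v) = - (\<Sum>v\<in>free. w v * \<phi> (T v u))"
      by (simp add: neg sum_negf mult.commute)
    moreover have "(\<Sum>k<d. (if l = k then 1 else 0) * w (p k)) = w u"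
      using l sum_delta_matrix(1)[of "{..<d}" l "\<lambda>k. w (p k)"] by simp
    ultimately show ?thesis by simp
  qed
  finally show ?thesis by simp
qed

end

lemma pivot_exists:
  assumes rho: "\<And>j. j < d \<Longrightarrow> \<rho> j \<in> series N"
    and w: "wedge d (\<lambda>j v. mps_at0 (mps_deriv v (\<rho> j))) p \<noteq> 0"
  shows "\<exists>B. pivot N d \<rho> p B"
proof -
  obtain C where C: "\<And>i l. i < d \<Longrightarrow> l < d \<Longrightarrow> (\<Sum>k<d. C i k * mcoeff (mps_deriv (p l) (\<rho> k)) 0) = (if i = l then 1 else 0)"
    "\<And>i l. i < d \<Longrightarrow> l < d \<Longrightarrow> (\<Sum>k<d. mcoeff (mps_deriv (p k) (\<rho> i)) 0 * C k l) = (if i = l then 1 else 0)"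
    by (rule wedge_inverse[OF w, unfolded mps_at0_def], rule that)
  obtain B where B: "\<And>i j. i < d \<Longrightarrow> j < d \<Longrightarrow> B i j \<in> series N"
    "\<And>i l. i < d \<Longrightarrow> l < d \<Longrightarrow> (\<Sum>k<d. B i k * mps_deriv (p l) (\<rho> k)) = (if i = l then 1 else 0)"
    "\<And>i l. i < d \<Longrightarrow> l < d \<Longrightarrow> (\<Sum>k<d. mps_deriv (p k) (\<rho> i) * B k l) = (if i = l then 1 else 0)"
    by (rule matrix_inverse_series[of d "\<lambda>k l. mps_deriv (p l) (\<rho> k)" "vars N" C])
      (use C rho in \<open>auto intro: mps_in_deriv\<close>)
  \<comment> \<open>Invertibility at 0 forces this: a variable outside would give a zero column,
    and, below, a repeated variable two equal columns.\<close>
  have "p k \<in> vars N" if k: "k < d" for k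
  proof (rule ccontr)
    assume "p k \<notin> vars N"
    then have "mps_deriv (p k) (\<rho> j) = 0" if "j < d" for j using mps_deriv_outside[OF rho[OF that]] by simp
    then show False using C(1)[OF k k] by simp
  qed
  moreover have "inj_on p {..<d}"
  proof (rule inj_onI, rule ccontr)
    fix k l assume kl: "k \<in> {..<d}" "l \<in> {..<d}" "p k = p l" "k \<noteq> l"
    then show False using C(1)[of k k] C(1)[of k l] by simp
  qed
  ultimately have "pivot N d \<rho> p B" by unfold_locales (use rho B in auto)
  then show ?thesis by (intro exI[of _ B])
qed

section \<open>Ideals\<close>

text \<open>Inductive, so that images under homomorphisms, derivations and conjugation are
  controlled by the generators alone, without carrying coefficients.\<close>

inductive_set gen_ideal :: "'v set \<Rightarrow> 'v mps set \<Rightarrow> 'v mps set" for V G where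
  zero: "0 \<in> gen_ideal V G"
| gen: "g \<in> G \<Longrightarrow> g \<in> gen_ideal V G"
| add: "x \<in> gen_ideal V G \<Longrightarrow> y \<in> gen_ideal V G \<Longrightarrow> x + y \<in> gen_ideal V G"
| mult: "a \<in> mps_in V \<Longrightarrow> x \<in> gen_ideal V G \<Longrightarrow> a * x \<in> gen_ideal V G"

lemma gen_ideal_uminus: "x \<in> gen_ideal V G \<Longrightarrow> - x \<in> gen_ideal V G"
  using gen_ideal.mult[OF mps_in_simps(3)[of "- 1"], of x V G] by simp

lemma gen_ideal_diff: "x \<in> gen_ideal V G \<Longrightarrow> y \<in> gen_ideal V G \<Longrightarrow> x - y \<in> gen_ideal V G"
  using gen_ideal.add[of x V G "- y"] gen_ideal_uminus[of y V G] by simp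

lemma gen_ideal_sum: "(\<And>i. i \<in> A \<Longrightarrow> f i \<in> gen_ideal V G) \<Longrightarrow> sum f A \<in> gen_ideal V G"
  by (induction A rule: infinite_finite_induct) (auto intro: gen_ideal.zero gen_ideal.add)

lemma gen_ideal_subset:
  assumes "x \<in> gen_ideal V G" "G \<subseteq> gen_ideal V H" shows "x \<in> gen_ideal V H"
  using assms(1)
  by induction (use assms(2) in \<open>auto intro: gen_ideal.zero gen_ideal.add gen_ideal.mult\<close>)

lemma gen_ideal_mono: "G \<subseteq> H \<Longrightarrow> x \<in> gen_ideal V G \<Longrightarrow> x \<in> gen_ideal V H"
  by (rule gen_ideal_subset[of x V G H]) (auto intro: gen_ideal.gen)

lemma gen_ideal_in:
  assumes "x \<in> gen_ideal V G" "G \<subseteq> mps_in V" shows "x \<in> mps_in V"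
  using assms(1) by induction (use assms(2) in auto)

lemma gen_ideal_hom_zero:
  assumes "x \<in> gen_ideal V G" "mps_hom V \<phi>" "G \<subseteq> mps_in V" "\<And>g. g \<in> G \<Longrightarrow> \<phi> g = 0"
  shows "\<phi> x = 0"
  using assms(1)
proof induction
  case (add x y)
  then show ?case using hom_add[OF assms(2)] gen_ideal_in[OF _ assms(3)] by auto
next
  case (mult a x)
  then show ?case using hom_mult[OF assms(2)] gen_ideal_in[OF _ assms(3)] by auto
qed (use assms(4) hom_0[OF assms(2)] in auto)

lemma gen_ideal_derivation:
  assumes "x \<in> gen_ideal V G" "mps_derivation D" "\<And>f. f \<in> mps_in V \<Longrightarrow> D f \<in> mps_in V"
    and "G \<subseteq> gen_ideal V H" "\<And>g. g \<in> G \<Longrightarrow> D g \<in> gen_ideal V H"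
  shows "D x \<in> gen_ideal V H"
  using assms(1)
proof induction
  case zero show ?case by (simp add: derivation_0[OF assms(2)] gen_ideal.zero)
next
  case (gen g) then show ?case by (rule assms(5))
next
  case (add x y) then show ?case by (auto simp: derivation_add[OF assms(2)] intro: gen_ideal.add)
next
  case (mult a x)
  have "x \<in> gen_ideal V H" using gen_ideal_subset[OF mult.hyps(2) assms(4)] .
  then show ?case using mult assms(3)
    by (auto simp: derivation_mult[OF assms(2)] intro!: gen_ideal.add gen_ideal.mult)
qed

lemma gen_ideal_coeff_0:
  assumes "x \<in> gen_ideal V G" "\<And>g. g \<in> G \<Longrightarrow> mcoeff g 0 = 0" shows "mcoeff x 0 = 0"
  using assms(1) by induction (use assms(2) in auto)

definition ideal_of :: "nat \<Rightarrow> nat \<Rightarrow> (nat \<Rightarrow> (nat + nat) mps) \<Rightarrow> (nat + nat) mps set" where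
  "ideal_of N d \<rho> = gen_ideal (vars N) (\<rho> ` {..<d})"

lemma matrix_multiple_ideal:
  assumes "is_matrix_multiple N e \<sigma> d \<rho>" "i < e" shows "\<sigma> i \<in> ideal_of N d \<rho>"
proof -
  obtain a where "\<forall>i<e. \<forall>j<d. a i j \<in> series N" "\<forall>i<e. \<sigma> i = (\<Sum>j<d. a i j * \<rho> j)"
    using assms(1) unfolding is_matrix_multiple_def by blast
  moreover have "(\<Sum>j<d. a i j * \<rho> j) \<in> ideal_of N d \<rho>" if "\<forall>j<d. a i j \<in> series N" for a
    unfolding ideal_of_def
    by (rule gen_ideal_sum, rule gen_ideal.mult) (use that in \<open>auto intro: gen_ideal.gen\<close>)
  ultimately show ?thesis using assms(2) by auto
qed

section \<open>Defining series of a formal submanifold\<close>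

lemma is_defining_in: "is_defining N d \<rho> \<Longrightarrow> j < d \<Longrightarrow> \<rho> j \<in> series N"
  by (simp add: is_defining_def tuples_def)

lemma is_defining_0: "is_defining N d \<rho> \<Longrightarrow> j < d \<Longrightarrow> mcoeff (\<rho> j) 0 = 0"
  by (simp add: is_defining_def mps_at0_def)

text \<open>Since \<sigma> vanishes at 0, the differentials at 0 satisfy d\<rho> = a(0) d\<sigma>;
  the former has rank d, so a(0) and hence a is invertible. The definitions choose their defining
  series independently of each other, and the ideal is what these choices have in common.\<close>

lemma same_manifold_ideal:
  assumes "(\<rho>, \<sigma>) \<in> same_manifold N d" shows "ideal_of N d \<rho> = ideal_of N d \<sigma>"
proof -
  have def: "is_defining N d \<rho>" "is_defining N d \<sigma>" and mult: "is_matrix_multiple N d \<rho> d \<sigma>"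
    using assms by (auto simp: same_manifold_def)
  obtain a where a: "\<And>i j. i < d \<Longrightarrow> j < d \<Longrightarrow> a i j \<in> series N"
    "\<And>i. i < d \<Longrightarrow> \<rho> i = (\<Sum>j<d. a i j * \<sigma> j)"
    using mult unfolding is_matrix_multiple_def by blast
  obtain I where w: "wedge d (\<lambda>j v. mps_at0 (mps_deriv v (\<rho> j))) I \<noteq> 0"
    using def(1) by (auto simp: is_defining_def fun_eq_iff)
  obtain C where "\<And>i l. i < d \<Longrightarrow> l < d \<Longrightarrow>
      (\<Sum>k<d. C i k * mps_at0 (mps_deriv (I l) (\<rho> k))) = (if i = l then 1 else 0)"
    and C': "\<And>i l. i < d \<Longrightarrow> l < d \<Longrightarrow>
      (\<Sum>k<d. mps_at0 (mps_deriv (I k) (\<rho> i)) * C k l) = (if i = l then 1 else 0)"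
    by (rule wedge_inverse[OF w], rule that)
  note C = C'[unfolded mps_at0_def]
  \<comment> \<open>The columns of d\<sigma>(0) selected by I, times the inverse C of the same minor
    of d\<rho>(0): a right inverse of a(0), which for square matrices is also a left
    inverse.\<close>
  define Y where "Y j l = (\<Sum>k<d. mcoeff (mps_deriv (I k) (\<sigma> j)) 0 * C k l)" for j l
  have d0: "mcoeff (mps_deriv v (\<rho> i)) 0 = (\<Sum>j<d. mcoeff (a i j) 0 * mcoeff (mps_deriv v (\<sigma> j)) 0)" if "i < d" for v i
    unfolding a(2)[OF that] using is_defining_0[OF def(2)]
    by (simp add: mps_deriv_sum mps_deriv_mult mcoeff_sum)
  have aY: "(\<Sum>j<d. mcoeff (a i j) 0 * Y j l) = (if i = l then 1 else 0)" if "i < d" "l < d" for i l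
  proof -
    have "(\<Sum>j<d. mcoeff (a i j) 0 * Y j l) = (\<Sum>k<d. mcoeff (mps_deriv (I k) (\<rho> i)) 0 * C k l)"
      unfolding Y_def d0[OF that(1)] sum_distrib_left sum_distrib_right
      by (subst sum.swap) (simp add: mult.assoc)
    then show ?thesis using C[OF that] by simp
  qed
  have Ya: "(\<Sum>k<d. Y i k * mcoeff (a k l) 0) = (if i = l then 1 else 0)" if "i < d" "l < d" for i l
    using complex_right_inverse_left[of d "\<lambda>i j. mcoeff (a i j) 0" Y, OF aY that] by simp
  obtain b where b: "\<And>i j. i < d \<Longrightarrow> j < d \<Longrightarrow> b i j \<in> series N"
    "\<And>i l. i < d \<Longrightarrow> l < d \<Longrightarrow> (\<Sum>k<d. b i k * a k l) = (if i = l then 1 else 0)"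
    by (rule matrix_left_inverse_series[of d a "vars N" Y, OF a(1) Ya], assumption+, rule that)
  have \<sigma>: "\<sigma> i = (\<Sum>k<d. b i k * \<rho> k)" if i: "i < d" for i
  proof -
    have "(\<Sum>k<d. b i k * \<rho> k) = (\<Sum>j<d. (\<Sum>k<d. b i k * a k j) * \<sigma> j)"
      unfolding sum_distrib_right
      by (subst sum.swap) (simp add: a(2) sum_distrib_left mult.assoc)
    also have "\<dots> = (\<Sum>j<d. (if i = j then 1 else 0) * \<sigma> j)"
      using i b(2) by (intro sum.cong) auto
    also have "\<dots> = \<sigma> i" using i sum_delta_matrix(1)[of "{..<d}" i \<sigma>] by simp
    finally show ?thesis by simp
  qed
  have "\<sigma> i \<in> ideal_of N d \<rho>" if "i < d" for i
    unfolding ideal_of_def \<sigma>[OF that]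
    by (rule gen_ideal_sum, rule gen_ideal.mult) (use b(1)[OF that] in \<open>auto intro: gen_ideal.gen\<close>)
  moreover have "\<rho> i \<in> ideal_of N d \<sigma>" if "i < d" for i
    using matrix_multiple_ideal[OF mult that] .
  ultimately show ?thesis unfolding ideal_of_def
    by (auto intro: gen_ideal_subset[of _ "vars N" "\<rho> ` {..<d}"] gen_ideal_subset[of _ "vars N" "\<sigma> ` {..<d}"])
qed

lemma submanifold_member:
  assumes "formal_submanifold N d M" "\<rho> \<in> M"
  shows "is_defining N d \<rho>"
  using assms unfolding formal_submanifold_def quotient_def same_manifold_def by auto

lemma submanifold_ideal:
  assumes "formal_submanifold N d M" "\<rho> \<in> M" "\<sigma> \<in> M"
  shows "ideal_of N d \<rho> = ideal_of N d \<sigma>"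
proof -
  obtain \<tau> where "(\<tau>, \<rho>) \<in> same_manifold N d" "(\<tau>, \<sigma>) \<in> same_manifold N d"
    using assms unfolding formal_submanifold_def quotient_def by auto
  then show ?thesis using same_manifold_ideal by metis
qed

section \<open>Conjugation\<close>

definition bar_var :: "nat + nat \<Rightarrow> (nat + nat) mps" where
  "bar_var = case_sum (mps_var \<circ> Inr) (mps_var \<circ> Inl)"

text \<open>The antilinear involution that conjugates coefficients and exchanges Z with \<zeta>. It
  fixes each component of a defining series and exchanges the two halves of a complexified
  mapping.\<close>

definition mps_bar :: "(nat + nat) mps \<Rightarrow> (nat + nat) mps" where
  "mps_bar f = mps_subst (mps_cnj f) bar_var"

lemma bar_var_simps [simp]: "bar_var (Inl k) = mps_var (Inr k)" "bar_var (Inr k) = mps_var (Inl k)"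
  by (simp_all add: bar_var_def)

lemma bar_var_0 [simp]: "mcoeff (bar_var v) 0 = 0" by (cases v) auto
lemma bar_var_in: "v \<in> vars N \<Longrightarrow> bar_var v \<in> series N" by (cases v) auto

lemma mps_cnj_deriv: "mps_cnj (mps_deriv v f) = mps_deriv v (mps_cnj f)"
  by (rule mps_eqI) (simp add: mcoeff_deriv)

lemma bar_hom: "mps_hom (vars N) (\<lambda>f. mps_subst f bar_var)"
  by (rule subst_hom) auto

lemma bar_in: "f \<in> series N \<Longrightarrow> mps_bar f \<in> series N"
  unfolding mps_bar_def by (rule subst_in[of "vars N"]) (auto simp: bar_var_in)

lemma bar_0 [simp]: "mps_bar 0 = 0" 
  unfolding mps_bar_def using hom_0[OF bar_hom[of 0]] by simp
lemma bar_add: "f \<in> series N \<Longrightarrow> g \<in> series N \<Longrightarrow> mps_bar (f + g) = mps_bar f + mps_bar g"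
  unfolding mps_bar_def by (simp add: hom_add[OF bar_hom[of N]] mps_in_cnj)
lemma bar_mult: "f \<in> series N \<Longrightarrow> g \<in> series N \<Longrightarrow> mps_bar (f * g) = mps_bar f * mps_bar g"
  unfolding mps_bar_def by (simp add: hom_mult[OF bar_hom[of N]] mps_in_cnj)
lemma bar_coeff_0: "f \<in> series N \<Longrightarrow> mcoeff (mps_bar f) 0 = cnj (mcoeff f 0)"
  unfolding mps_bar_def by (simp add: hom_coeff_0[OF bar_hom[of N]] mps_in_cnj)

lemma bar_deriv:
  assumes f: "f \<in> series N"
  shows "mps_deriv (Inr k) (mps_bar f) = mps_bar (mps_deriv (Inl k) f)"
    and "mps_deriv (Inl k) (mps_bar f) = mps_bar (mps_deriv (Inr k) f)"
proof -
  have v: "v \<in> vars N \<Longrightarrow> mps_subst (mps_var v) bar_var = bar_var v" for v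
    by (rule subst_var[of "vars N"]) auto
  have chain: "mps_deriv u (mps_bar f) =
      (\<Sum>v\<in>vars N. mps_bar (mps_deriv v f) * mps_deriv u (bar_var v))" for u
    unfolding mps_bar_def mps_cnj_deriv
    using hom_chain[OF bar_hom derivation_deriv mps_in_cnj[OF f], of u] by (simp add: v)
  have z: "\<not> k < N \<Longrightarrow> mps_deriv (Inl k) f = 0" "\<not> k < N \<Longrightarrow> mps_deriv (Inr k) f = 0"
    using mps_deriv_outside[OF f] by auto
  have "mps_bar (mps_deriv v f) * mps_deriv (Inr k) (bar_var v) =
      (if v = Inl k then mps_bar (mps_deriv (Inl k) f) else 0)" for v
    by (cases v) (auto simp: mps_deriv_var)
  then show "mps_deriv (Inr k) (mps_bar f) = mps_bar (mps_deriv (Inl k) f)"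
    unfolding chain using z(1) by simp
  have "mps_bar (mps_deriv v f) * mps_deriv (Inl k) (bar_var v) =
      (if v = Inr k then mps_bar (mps_deriv (Inr k) f) else 0)" for v
    by (cases v) (auto simp: mps_deriv_var)
  then show "mps_deriv (Inl k) (mps_bar f) = mps_bar (mps_deriv (Inr k) f)"
    unfolding chain using z(2) by simp
qed

lemma bar_bar:
  assumes f: "f \<in> series N" shows "mps_bar (mps_bar f) = f"
proof -
  have var: "v \<in> vars N \<Longrightarrow> mps_subst (mps_var v) bar_var = bar_var v" for v
    by (rule subst_var[of "vars N"]) auto
  have in': "g \<in> series N \<Longrightarrow> mps_subst g bar_var \<in> series N" for g
    by (rule subst_in[of "vars N"]) (auto simp: bar_var_in)
  have cnj_var: "mps_cnj (bar_var v) = bar_var v" for v by (cases v) auto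
  \<comment> \<open>Conjugation moves constants and so is no \<open>mps_hom\<close>; the order
    argument still applies to the difference, which kills constants.\<close>
  have c: "mps_cnj (mps_subst g bar_var) - mps_subst (mps_cnj g) bar_var = 0" if g: "g \<in> series N" for g
    by (rule mps_functional_zero[OF finite_vars g, where u = bar_var])
      (simp_all add: hom_add[OF bar_hom[of N]] hom_mult[OF bar_hom[of N]] hom_const[OF bar_hom[of N]]
         mps_in_cnj var cnj_var algebra_simps)
  have "mps_bar (mps_bar f) = mps_subst (mps_subst f bar_var) bar_var"
    using c[OF mps_in_cnj[OF f]] by (simp add: mps_bar_def)
  also have "\<dots> = f"
  proof (rule hom_unique[OF hom_comp[OF bar_hom bar_hom in'] _ _ f])
    show "mps_hom (vars N) (\<lambda>f. f)" by (auto simp: mps_hom_def)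
    show "mps_subst (mps_subst (mps_var v) bar_var) bar_var = mps_var v" if "v \<in> vars N" for v
      using that var by (cases v) auto
  qed
  finally show ?thesis .
qed

lemma is_defining_bar: "is_defining N d \<rho> \<Longrightarrow> j < d \<Longrightarrow> mps_bar (\<rho> j) = \<rho> j"
  by (simp add: is_defining_def mps_bar_def bar_var_def)

lemma gen_ideal_bar:
  assumes "x \<in> gen_ideal (vars N) G" "G \<subseteq> series N" "\<And>g. g \<in> G \<Longrightarrow> mps_bar g \<in> gen_ideal (vars N) H"
  shows "mps_bar x \<in> gen_ideal (vars N) H"
  using assms(1)
proof induction
  case (add x y)
  then show ?case using bar_add[of x N y] gen_ideal_in[OF _ assms(2)] by (auto intro: gen_ideal.add)
next
  case (mult a x)
  then show ?case using bar_mult[of a N x] gen_ideal_in[OF _ assms(2)] bar_in by (auto intro: gen_ideal.mult)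
qed (use assms(3) in \<open>auto intro: gen_ideal.zero\<close>)

section \<open>Generic defining series\<close>

text \<open>One choice I of indices is used twice. With \<zeta>-variables dependent,
  \<open>zeta.T (Inr i)\<close> is of type (0,1) and \<open>zeta.T (Inl j)\<close> lifts the
  derivative in Z_j to M; with Z-variables dependent, \<open>z\<close> gives the (1,0) fields. By
  reality of \<rho> one nonvanishing minor yields the other.\<close>

locale generic_series = zeta: pivot N d \<rho> "\<lambda>k. Inr (I k)" B + z: pivot N d \<rho> "\<lambda>k. Inl (I k)" B'
  for N d \<rho> I B B' +
  assumes rho_0: "j < d \<Longrightarrow> mcoeff (\<rho> j) 0 = 0"
    and rho_bar: "j < d \<Longrightarrow> mps_bar (\<rho> j) = \<rho> j"

lemma generic_series_exists:
  assumes M: "formal_submanifold N d M" "generic d M"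
  shows "\<exists>\<rho>\<in>M. \<exists>I B B'. generic_series N d \<rho> I B B'"
proof -
  obtain \<rho> I where \<rho>: "\<rho> \<in> M" and w: "wedge d (\<lambda>j k. mps_at0 (mps_deriv (Inl k) (\<rho> j))) I \<noteq> 0"
    using M(2) by (auto simp: generic_def fun_eq_iff)
  have def: "is_defining N d \<rho>" by (rule submanifold_member[OF M(1) \<rho>])
  have wl: "wedge d (\<lambda>j v. mps_at0 (mps_deriv v (\<rho> j))) (\<lambda>k. Inl (I k)) \<noteq> 0"
    using w by (simp add: wedge_def)
  have "mps_at0 (mps_deriv (Inr k) (\<rho> j)) = cnj (mps_at0 (mps_deriv (Inl k) (\<rho> j)))" if "j < d" for j k
    using bar_deriv(1)[OF is_defining_in[OF def that], of k] is_defining_bar[OF def that]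
      bar_coeff_0[OF mps_in_deriv[OF is_defining_in[OF def that]]] by (simp add: mps_at0_def)
  then have "wedge d (\<lambda>j v. mps_at0 (mps_deriv v (\<rho> j))) (\<lambda>k. Inr (I k)) =
    cnj (wedge d (\<lambda>j v. mps_at0 (mps_deriv v (\<rho> j))) (\<lambda>k. Inl (I k)))"
    by (simp add: wedge_def)
  then have wr: "wedge d (\<lambda>j v. mps_at0 (mps_deriv v (\<rho> j))) (\<lambda>k. Inr (I k)) \<noteq> 0" using wl by simp
  obtain B where B: "pivot N d \<rho> (\<lambda>k. Inr (I k)) B"
    using pivot_exists[OF is_defining_in[OF def] wr] by blast
  obtain B' where B': "pivot N d \<rho> (\<lambda>k. Inl (I k)) B'"
    using pivot_exists[OF is_defining_in[OF def] wl] by blast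
  have "generic_series N d \<rho> I B B'"
    unfolding generic_series_def generic_series_axioms_def
    using B B' is_defining_0[OF def] is_defining_bar[OF def] by blast
  then show ?thesis using \<rho> by blast
qed

text \<open>Tangency as stability of the ideal: independent of the defining series and inherited by
  combinations and brackets.\<close>

definition tangential :: "nat \<Rightarrow> (nat + nat) mps set \<Rightarrow> vfield \<Rightarrow> bool" where
  "tangential N J X \<longleftrightarrow> (\<forall>v. X v \<in> series N) \<and> (\<forall>f\<in>J. vf_apply N X f \<in> J)"

lemma tangential_if:
  assumes \<rho>: "\<And>j. j < d \<Longrightarrow> \<rho> j \<in> series N" and X: "\<And>v. X v \<in> series N"
    and "\<And>j. j < d \<Longrightarrow> vf_apply N X (\<rho> j) \<in> ideal_of N d \<rho>"
  shows "tangential N (ideal_of N d \<rho>) X"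
  unfolding tangential_def
proof (intro conjI ballI allI X)
  fix f assume f: "f \<in> ideal_of N d \<rho>"
  show "vf_apply N X f \<in> ideal_of N d \<rho>"
    unfolding ideal_of_def
    by (rule gen_ideal_derivation[OF f[unfolded ideal_of_def] derivation_vf])
      (use assms in \<open>auto intro: gen_ideal.gen vf_apply_in simp: ideal_of_def\<close>)
qed

lemma tangent_fields_tangential:
  assumes M: "formal_submanifold N d M" "\<rho> \<in> M" and X: "X \<in> tangent_fields N d M"
  shows "tangential N (ideal_of N d \<rho>) X"
proof -
  obtain \<sigma> where \<sigma>: "\<sigma> \<in> M" "is_matrix_multiple N d (\<lambda>i. vf_apply N X (\<sigma> i)) d \<sigma>"
    using X by (auto simp: tangent_fields_def)
  have "X v \<in> series N" for v
    using X by (cases "v \<in> vars N") (auto simp: tangent_fields_def tuples_def)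
  then have "tangential N (ideal_of N d \<sigma>) X"
    by (intro tangential_if is_defining_in[OF submanifold_member[OF M(1) \<sigma>(1)]])
      (use matrix_multiple_ideal[OF \<sigma>(2)] in auto)
  then show ?thesis using submanifold_ideal[OF M \<sigma>(1)] by simp
qed

lemma (in pivot) T_tangential: "v \<in> free \<Longrightarrow> tangential N (ideal_of N d \<rho>) (T v)"
  by (rule tangential_if) (auto simp: rho_in T_in T_rho ideal_of_def gen_ideal.zero)

lemma (in pivot) T_tangent_field:
  assumes "\<rho> \<in> M" "v \<in> free" shows "T v \<in> tangent_fields N d M"
proof -
  have "is_matrix_multiple N d (\<lambda>i. vf_apply N (T v) (\<rho> i)) d \<rho>"
    unfolding is_matrix_multiple_def by (rule exI[of _ "\<lambda>_ _. 0"]) (simp add: T_rho assms)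
  then show ?thesis
    unfolding tangent_fields_def tuples_def using assms T_in T_outside free_vars by auto
qed

lemma sum_vars: "(\<Sum>v\<in>vars N. h v) = (\<Sum>k<N. h (Inl k)) + (\<Sum>k<N. h (Inr k) :: 'x::comm_monoid_add)"
  unfolding vars_def by (subst sum.Plus) auto

lemma vf_apply_sum: "vf_apply N (\<lambda>v. \<Sum>i\<in>A. c i * X i v) f = (\<Sum>i\<in>A. c i * vf_apply N (X i) f)"
  unfolding vf_apply_def sum_distrib_left sum_distrib_right by (subst sum.swap) (simp add: mult.assoc)

lemma tangential_sum:
  assumes "\<And>i. i \<in> A \<Longrightarrow> c i \<in> series N" "\<And>i. i \<in> A \<Longrightarrow> tangential N (gen_ideal (vars N) G) (X i)"
  shows "tangential N (gen_ideal (vars N) G) (\<lambda>v. \<Sum>i\<in>A. c i * X i v)"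
  using assms unfolding tangential_def vf_apply_sum
  by (auto intro!: mps_in_sum mps_in_mult gen_ideal_sum gen_ideal.mult)

section \<open>The reflection identity\<close>

lemma formal_mapping_in: "formal_mapping N N' H \<Longrightarrow> H k \<in> mps_in {..<N}"
  by (cases "k < N'") (auto simp: formal_mapping_def tuples_def)

lemma formal_mapping_0: "formal_mapping N N' H \<Longrightarrow> mcoeff (H k) 0 = 0"
  by (cases "k < N'") (auto simp: formal_mapping_def tuples_def mps_at0_def)

lemma Inl_hom: "mps_hom {..<N :: nat} (\<lambda>f. mps_subst f (mps_var \<circ> Inl))"
  and Inr_hom: "mps_hom {..<N :: nat} (\<lambda>f. mps_subst f (mps_var \<circ> Inr))"
  by (auto intro!: subst_hom)

lemma Inl_subst_in: "f \<in> mps_in {..<N :: nat} \<Longrightarrow> mps_subst f (mps_var \<circ> Inl) \<in> mps_in (Inl ` {..<N})"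
  and Inr_subst_in: "f \<in> mps_in {..<N :: nat} \<Longrightarrow> mps_subst f (mps_var \<circ> Inr) \<in> mps_in (Inr ` {..<N})"
  by (auto intro!: subst_in[of "{..<N}"])

lemma Inl_series: "f \<in> mps_in (Inl ` {..<N}) \<Longrightarrow> f \<in> series N"
  and Inr_series: "f \<in> mps_in (Inr ` {..<N}) \<Longrightarrow> f \<in> series N"
  by (erule mps_in_mono; auto)+

context
  fixes N N' H assumes H: "formal_mapping N N' H"
begin
lemma cpl_Inl: "complexification H (Inl k) \<in> mps_in (Inl ` {..<N})"
  unfolding complexification_def using Inl_subst_in[OF formal_mapping_in[OF H]] by simp
lemma cpl_Inr: "complexification H (Inr k) \<in> mps_in (Inr ` {..<N})"
  unfolding complexification_def using Inr_subst_in[OF mps_in_cnj[OF formal_mapping_in[OF H]]] by simp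
lemma cpl_in: "complexification H v \<in> series N"
  using cpl_Inl cpl_Inr Inl_series Inr_series by (cases v) auto
lemma cpl_0: "mcoeff (complexification H v) 0 = 0"
proof (cases v)
  case (Inl k)
  then show ?thesis using hom_coeff_0[OF Inl_hom formal_mapping_in[OF H], of k] formal_mapping_0[OF H]
    by (simp add: complexification_def)
next
  case (Inr k)
  then show ?thesis using hom_coeff_0[OF Inr_hom mps_in_cnj[OF formal_mapping_in[OF H]], of k] formal_mapping_0[OF H]
    by (simp add: complexification_def)
qed
lemma cpl_hom: "mps_hom (vars N') (\<lambda>f. mps_subst f (complexification H))"
  by (rule subst_hom) (auto simp: cpl_0)
lemma cpl_subst_in: "f \<in> series N' \<Longrightarrow> mps_subst f (complexification H) \<in> series N"
  by (rule subst_in[of "vars N'"]) (auto simp: cpl_0 cpl_in)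
lemma cpl_subst_var: "v \<in> vars N' \<Longrightarrow> mps_subst (mps_var v) (complexification H) = complexification H v"
  by (rule subst_var[of "vars N'"]) (auto simp: cpl_0)
end

definition free_idx :: "nat \<Rightarrow> nat \<Rightarrow> (nat \<Rightarrow> nat) \<Rightarrow> nat set" where
  "free_idx N d I = {..<N} - I ` {..<d}"

lemma finite_free_idx [simp]: "finite (free_idx N d I)" by (simp add: free_idx_def)

lemma free_Inr:
  assumes "pivot N d \<rho> (\<lambda>k. Inr (I k)) B"
  shows "pivot.free N d (\<lambda>k. Inr (I k)) = Inl ` {..<N} \<union> Inr ` free_idx N d I"
proof -
  have "pivot.free N d (\<lambda>k. Inr (I k)) = vars N - (\<lambda>k. Inr (I k)) ` {..<d}"
    by (rule pivot.free_def[OF assms])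
  then show ?thesis by (auto simp: vars_def free_idx_def)
qed

lemma sum_free_Inr:
  assumes "pivot N d \<rho> (\<lambda>k. Inr (I k)) B"
  shows "(\<Sum>v\<in>pivot.free N d (\<lambda>k. Inr (I k)). h v) =
    (\<Sum>k<N. h (Inl k)) + (\<Sum>i\<in>free_idx N d I. h (Inr i) :: 'x::comm_monoid_add)"
proof -
  have "(\<Sum>v\<in>Inl ` {..<N} \<union> Inr ` free_idx N d I. h v) =
    (\<Sum>v\<in>Inl ` {..<N}. h v) + (\<Sum>v\<in>Inr ` free_idx N d I. h v)"
    by (rule sum.union_disjoint) auto
  then show ?thesis unfolding free_Inr[OF assms] by (simp add: sum.reindex)
qed

section \<open>Lifting (0,1) fields through a submersive mapping\<close>

lemma vf_apply_linear: "vf_apply N (\<lambda>v. c * X v) f = c * vf_apply N X f"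
  by (simp add: vf_apply_def sum_distrib_left mult.assoc)

text \<open>By submersivity (assumption \<open>e\<close>) a square matrix of the push-forward is invertible at \<open>0\<close>,
  hence invertible.\<close>

lemma (in generic_series) lift_field:
  assumes tgt: "pivot N' d' \<rho>' (\<lambda>k. Inr (I' k)) C"
    and H: "formal_mapping N N' H"
    and ideal: "\<And>j. j < d' \<Longrightarrow> mps_subst (\<rho>' j) (complexification H) \<in> ideal_of N d \<rho>"
    and e: "\<And>x y. x \<in> free_idx N' d' I' \<Longrightarrow> y \<in> free_idx N' d' I' \<Longrightarrow>
      (\<Sum>i\<in>free_idx N d I. e x i * mcoeff (vf_apply N (zeta.T (Inr i)) (complexification H (Inr y))) 0)
        = (if x = y then 1 else 0)"
    and X': "tangential N' (ideal_of N' d' \<rho>') X'" "\<And>k. k < N' \<Longrightarrow> X' (Inl k) = 0"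
  shows "\<exists>E. tangential N (ideal_of N d \<rho>) E \<and> (\<forall>k. E (Inl k) = 0) \<and>
    (\<forall>f\<in>series N'. vf_apply N E (mps_subst f (complexification H))
        - mps_subst (vf_apply N' X' f) (complexification H) \<in> ideal_of N d \<rho>)"
proof -
  interpret tgt: pivot N' d' \<rho>' "\<lambda>k. Inr (I' k)" C by (rule tgt)
  define \<phi> where "\<phi> f = mps_subst f (complexification H)" for f
  define c where "c = complexification H"
  define F where "F = free_idx N d I"
  define F' where "F' = free_idx N' d' I'"
  define J where "J = ideal_of N d \<rho>"
  define J' where "J' = ideal_of N' d' \<rho>'"
  have Jg: "J = gen_ideal (vars N) (\<rho> ` {..<d})" by (simp add: J_def ideal_of_def)
  have J'g: "J' = gen_ideal (vars N') (\<rho>' ` {..<d'})" by (simp add: J'_def ideal_of_def)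
  have \<phi>: "mps_hom (vars N') \<phi>" unfolding \<phi>_def by (rule cpl_hom[OF H])
  have \<phi>in: "f \<in> series N' \<Longrightarrow> \<phi> f \<in> series N" for f unfolding \<phi>_def by (rule cpl_subst_in[OF H])
  have \<phi>var: "v \<in> vars N' \<Longrightarrow> \<phi> (mps_var v) = c v" for v unfolding \<phi>_def c_def by (rule cpl_subst_var[OF H])
  have \<rho>'in: "\<rho>' ` {..<d'} \<subseteq> series N'" using tgt.rho_in by auto
  have \<phi>J: "\<phi> x \<in> J" if "x \<in> J'" for x
    using that unfolding J'g
  proof induction
    case (add x y)
    then show ?case using hom_add[OF \<phi>] gen_ideal_in[OF _ \<rho>'in] by (auto simp: Jg intro: gen_ideal.add)
  next
    case (mult a x)
    then show ?case using hom_mult[OF \<phi>] gen_ideal_in[OF _ \<rho>'in] \<phi>in by (auto simp: Jg intro: gen_ideal.mult)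
  qed (use ideal hom_0[OF \<phi>] in \<open>auto simp: \<phi>_def J_def ideal_of_def intro: gen_ideal.zero\<close>)
  have tang: "tangential N J (zeta.T (Inr i))" if "i \<in> F" for i
    unfolding J_def by (rule zeta.T_tangential) (use that in \<open>simp add: F_def free_Inr[OF zeta.pivot_axioms]\<close>)
  define M where "M x y = (\<Sum>i\<in>F. mps_const (e x i) * vf_apply N (zeta.T (Inr i)) (c (Inr y)))" for x y
  have cin: "c v \<in> series N" for v unfolding c_def by (rule cpl_in[OF H])
  have M: "mcoeff (M x y) 0 = (if x = y then 1 else 0)" "M x y \<in> series N" if "x \<in> F'" "y \<in> F'" for x y
    using e[of x y] that
    by (auto simp: M_def mcoeff_sum F_def F'_def c_def cpl_in[OF H] zeta.T_in intro!: mps_in_sum mps_in_mult vf_apply_in)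
  obtain W where W: "\<And>i j. i \<in> F' \<Longrightarrow> j \<in> F' \<Longrightarrow> W i j \<in> series N"
    "\<And>i k. i \<in> F' \<Longrightarrow> k \<in> F' \<Longrightarrow> (\<Sum>j\<in>F'. W i j * M j k) = (if i = k then 1 else 0)"
    by (rule matrix_left_inverse[of F' M "vars N"]) (use M in \<open>auto simp: F'_def\<close>)
  \<comment> \<open>Inverting M normalizes the combined fields: \<open>E0 x\<close> moves the free
    \<zeta>-component x of the mapping with speed 1 and the other free ones with speed 0, exactly
    and not only at 0.\<close>
  define E0 where "E0 x v = (\<Sum>y\<in>F'. W x y * (\<Sum>i\<in>F. mps_const (e y i) * zeta.T (Inr i) v))" for x v
  have E0_tang: "tangential N J (E0 x)" if "x \<in> F'" for x
    unfolding E0_def Jg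
    by (intro tangential_sum) (use W(1) tang that in \<open>auto simp: Jg[symmetric]\<close>)
  have E0_Inl: "E0 x (Inl k) = 0" for x k
    unfolding E0_def zeta.T_def by (auto intro!: sum.neutral)
  have E0_c: "vf_apply N (E0 x) (c (Inr y)) = (if x = y then 1 else 0)" if "x \<in> F'" "y \<in> F'" for x y
  proof -
    have "vf_apply N (E0 x) f = (\<Sum>y\<in>F'. W x y * (\<Sum>i\<in>F. mps_const (e y i) * vf_apply N (zeta.T (Inr i)) f))" for f
      unfolding E0_def by (subst vf_apply_sum, subst vf_apply_sum) simp
    then show ?thesis using W(2)[OF that] by (simp add: M_def)
  qed
  have E0_cInl: "vf_apply N (E0 x) (c (Inl k)) = 0" for x k
  proof -
    have "mps_deriv (Inr j) (c (Inl k)) = 0" for j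
      by (rule mps_deriv_outside[OF cpl_Inl[OF H, of k, folded c_def]]) auto
    then show ?thesis unfolding vf_apply_def sum_vars by (simp add: E0_Inl)
  qed
  have E0_pre: "vf_apply N (E0 x) (\<phi> f) - \<phi> (vf_apply N' (tgt.T (Inr x)) f) \<in> J"
    if x: "x \<in> F'" and f: "f \<in> series N'" for x f
  proof -
    define w where "w v = vf_apply N (E0 x) (c v)" for v
    \<comment> \<open>Push-forward and target field have the same free components, and the
      differential of \<rho>' annihilates both modulo J; by \<open>kernel_identity\<close> the
      remaining components agree modulo J as well.\<close>
    have wc: "w v - \<phi> (tgt.T (Inr x) v) \<in> J" if v: "v \<in> vars N'" for v
    proof -
      have chain: "vf_apply N (E0 x) (\<phi> g) = (\<Sum>v\<in>vars N'. \<phi> (mps_deriv v g) * w v)" if "g \<in> series N'" for g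
        using hom_chain[OF \<phi> derivation_vf that] by (simp add: \<phi>var w_def)
      have r: "(\<Sum>v\<in>vars N'. \<phi> (mps_deriv v (\<rho>' j)) * w v) \<in> J" if "j < d'" for j
        unfolding chain[OF tgt.rho_in[OF that], symmetric]
        using E0_tang[OF x] ideal[OF that] by (auto simp: tangential_def \<phi>_def J_def)
      have "(\<Sum>u\<in>tgt.free. w u * \<phi> (tgt.T u v)) = (\<Sum>i\<in>F'. (if i = x then \<phi> (tgt.T (Inr x) v) else 0))"
        unfolding sum_free_Inr[OF tgt] F'_def[symmetric]
        using E0_c[OF x] by (auto simp: w_def E0_cInl intro!: sum.cong)
      also have "\<dots> = \<phi> (tgt.T (Inr x) v)" using x by (simp add: F'_def)
      finally have "w v - \<phi> (tgt.T (Inr x) v) =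
        (\<Sum>l<d'. if v = Inr (I' l) then \<Sum>j<d'. \<phi> (C l j) * (\<Sum>v\<in>vars N'. \<phi> (mps_deriv v (\<rho>' j)) * w v) else 0)"
        using tgt.kernel_identity[OF \<phi> v, of w] by simp
      also have "\<dots> \<in> J" unfolding Jg
      proof (rule gen_ideal_sum)
        fix l assume l: "l \<in> {..<d'}"
        have "(\<Sum>j<d'. \<phi> (C l j) * (\<Sum>v\<in>vars N'. \<phi> (mps_deriv v (\<rho>' j)) * w v)) \<in> gen_ideal (vars N) (\<rho> ` {..<d})"
          by (rule gen_ideal_sum, rule gen_ideal.mult) (use r l \<phi>in tgt.B_in in \<open>auto simp: Jg[symmetric]\<close>)
        then show "(if v = Inr (I' l) then \<Sum>j<d'. \<phi> (C l j) * (\<Sum>v\<in>vars N'. \<phi> (mps_deriv v (\<rho>' j)) * w v) else 0)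
          \<in> gen_ideal (vars N) (\<rho> ` {..<d})" by (simp add: gen_ideal.zero)
      qed
      finally show ?thesis .
    qed
    have "vf_apply N (E0 x) (\<phi> f) = (\<Sum>v\<in>vars N'. \<phi> (mps_deriv v f) * w v)"
      using hom_chain[OF \<phi> derivation_vf f] by (simp add: \<phi>var w_def)
    moreover have "\<phi> (vf_apply N' (tgt.T (Inr x)) f) = (\<Sum>v\<in>vars N'. \<phi> (mps_deriv v f) * \<phi> (tgt.T (Inr x) v))"
      unfolding vf_apply_def using f tgt.T_in
      by (subst hom_sum[OF \<phi>]) (auto simp: hom_mult[OF \<phi>] mps_in_deriv mult.commute intro!: mps_in_mult)
    ultimately have "vf_apply N (E0 x) (\<phi> f) - \<phi> (vf_apply N' (tgt.T (Inr x)) f) =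
      (\<Sum>v\<in>vars N'. \<phi> (mps_deriv v f) * (w v - \<phi> (tgt.T (Inr x) v)))"
      by (simp add: sum_subtractf right_diff_distrib)
    also have "\<dots> \<in> J" unfolding Jg
      using wc f \<phi>in by (intro gen_ideal_sum gen_ideal.mult) (auto simp: Jg[symmetric] mps_in_deriv)
    finally show ?thesis .
  qed
  \<comment> \<open>Modulo the ideal of M' the field X' is the combination of the
    \<open>tgt.T (Inr x)\<close> with its own free components as coefficients (see
    \<open>dX\<close>); the lift uses these coefficients, pulled back.\<close>
  define E where "E v = (\<Sum>x\<in>F'. \<phi> (X' (Inr x)) * E0 x v)" for v
  have X'in: "X' v \<in> series N'" for v using X'(1) by (simp add: tangential_def)
  have "tangential N J E"
    unfolding E_def Jg by (rule tangential_sum) (use E0_tang \<phi>in X'in in \<open>auto simp: Jg\<close>)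
  moreover have "E (Inl k) = 0" for k by (simp add: E_def E0_Inl)
  moreover have "vf_apply N E (\<phi> f) - \<phi> (vf_apply N' X' f) \<in> J" if f: "f \<in> series N'" for f
  proof -
    define g where "g = vf_apply N' X' f - (\<Sum>x\<in>F'. X' (Inr x) * vf_apply N' (tgt.T (Inr x)) f)"
    have id: "mps_hom (vars N') (\<lambda>f. f)" by (auto simp: mps_hom_def)
    have rJ: "(\<Sum>v\<in>vars N'. mps_deriv v (\<rho>' j) * X' v) \<in> J'" if "j < d'" for j
    proof -
      have "\<rho>' j \<in> J'" using that by (auto simp: J'g intro: gen_ideal.gen)
      then have "vf_apply N' X' (\<rho>' j) \<in> J'" using X'(1) by (simp add: tangential_def J'_def)
      then show ?thesis by (simp add: vf_apply_def mult.commute)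
    qed
    have dX: "X' v - (\<Sum>x\<in>F'. X' (Inr x) * tgt.T (Inr x) v) \<in> J'" if v: "v \<in> vars N'" for v
    proof -
      have "X' v - (\<Sum>x\<in>F'. X' (Inr x) * tgt.T (Inr x) v) =
        (\<Sum>l<d'. if v = Inr (I' l) then \<Sum>j<d'. C l j * (\<Sum>v\<in>vars N'. mps_deriv v (\<rho>' j) * X' v) else 0)"
        using tgt.kernel_identity[OF id v, of X'] X'(2) by (simp add: sum_free_Inr[OF tgt] F'_def)
      also have "\<dots> \<in> J'" unfolding J'g
      proof (rule gen_ideal_sum)
        fix l assume l: "l \<in> {..<d'}"
        have "(\<Sum>j<d'. C l j * (\<Sum>v\<in>vars N'. mps_deriv v (\<rho>' j) * X' v)) \<in> gen_ideal (vars N') (\<rho>' ` {..<d'})"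
          by (rule gen_ideal_sum, rule gen_ideal.mult) (use rJ l tgt.B_in in \<open>auto simp: J'g[symmetric]\<close>)
        then show "(if v = Inr (I' l) then \<Sum>j<d'. C l j * (\<Sum>v\<in>vars N'. mps_deriv v (\<rho>' j) * X' v) else 0)
          \<in> gen_ideal (vars N') (\<rho>' ` {..<d'})" by (simp add: gen_ideal.zero)
      qed
      finally show ?thesis .
    qed
    have "g = (\<Sum>v\<in>vars N'. mps_deriv v f * (X' v - (\<Sum>x\<in>F'. X' (Inr x) * tgt.T (Inr x) v)))"
    proof -
      have "(\<Sum>x\<in>F'. X' (Inr x) * vf_apply N' (tgt.T (Inr x)) f) =
        vf_apply N' (\<lambda>v. \<Sum>x\<in>F'. X' (Inr x) * tgt.T (Inr x) v) f" by (simp add: vf_apply_sum)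
      then show ?thesis unfolding g_def
        by (simp add: vf_apply_def sum_subtractf right_diff_distrib mult.commute)
    qed
    also have "\<dots> \<in> J'" unfolding J'g
      using dX f by (intro gen_ideal_sum gen_ideal.mult) (auto simp: J'g[symmetric] mps_in_deriv)
    finally have g: "g \<in> J'" .
    have vin: "vf_apply N' (tgt.T (Inr x)) f \<in> series N'" for x
      using f tgt.T_in by (auto intro: vf_apply_in)
    have s_in: "(\<Sum>x\<in>F'. X' (Inr x) * vf_apply N' (tgt.T (Inr x)) f) \<in> series N'"
      using vin X'in by (auto intro!: mps_in_sum mps_in_mult)
    have g_in: "g \<in> series N'" using g \<rho>'in unfolding J'g by (rule gen_ideal_in)
    have "vf_apply N' X' f = g + (\<Sum>x\<in>F'. X' (Inr x) * vf_apply N' (tgt.T (Inr x)) f)"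
      by (simp add: g_def)
    then have "\<phi> (vf_apply N' X' f) = \<phi> g + \<phi> (\<Sum>x\<in>F'. X' (Inr x) * vf_apply N' (tgt.T (Inr x)) f)"
      using hom_add[OF \<phi> g_in s_in] by simp
    also have "\<phi> (\<Sum>x\<in>F'. X' (Inr x) * vf_apply N' (tgt.T (Inr x)) f)
        = (\<Sum>x\<in>F'. \<phi> (X' (Inr x)) * \<phi> (vf_apply N' (tgt.T (Inr x)) f))"
      using vin X'in by (subst hom_sum[OF \<phi>]) (auto simp: hom_mult[OF \<phi>] intro!: mps_in_mult)
    finally have "vf_apply N E (\<phi> f) - \<phi> (vf_apply N' X' f) =
      (\<Sum>x\<in>F'. \<phi> (X' (Inr x)) * (vf_apply N (E0 x) (\<phi> f) - \<phi> (vf_apply N' (tgt.T (Inr x)) f))) - \<phi> g"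
      unfolding E_def by (simp add: vf_apply_sum right_diff_distrib sum_subtractf)
    also have "\<dots> \<in> J" unfolding Jg
      by (rule gen_ideal_diff, rule gen_ideal_sum, rule gen_ideal.mult)
        (use E0_pre f \<phi>J[OF g] X'in \<phi>in in \<open>auto simp: Jg[symmetric]\<close>)
    finally show ?thesis .
  qed
  ultimately show ?thesis unfolding J_def \<phi>_def by blast
qed

lemma id_hom: "finite V \<Longrightarrow> mps_hom V (\<lambda>f. f)"
  by (auto simp: mps_hom_def)

lemma CR_fields_cases:
  assumes "X \<in> CR_fields N d M"
  obtains m c Y where "X = (\<lambda>v. \<Sum>i<m. c i * Y i v)" "\<And>i. i < (m::nat) \<Longrightarrow> c i \<in> series N"
    "\<And>i. i < m \<Longrightarrow> Y i \<in> tangent_10 N d M \<union> tangent_01 N d M"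
  using assms unfolding CR_fields_def by blast

lemma CR_fields_gen:
  assumes "X \<in> tangent_10 N d M \<union> tangent_01 N d M" shows "X \<in> CR_fields N d M"
proof -
  show ?thesis unfolding CR_fields_def
    using assms by (intro CollectI exI[of _ "1::nat"] exI[of _ "\<lambda>_. 1"] exI[of _ "\<lambda>_. X"]) auto
qed

lemma ideal_of_0:
  assumes "\<And>j. j < d \<Longrightarrow> mcoeff (\<rho> j) 0 = 0" "x \<in> ideal_of N d \<rho>" shows "mcoeff x 0 = 0"
  using gen_ideal_coeff_0[OF assms(2)[unfolded ideal_of_def]] assms(1) by auto

text \<open>A CR field may mix both types, but its \<zeta>-part alone is annihilated by d\<rho> at
  0: (1,0) fields contribute nothing to it, and (0,1) fields consist of it.\<close>

lemma CR_fields_kernel: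
  assumes M: "formal_submanifold N d M" "\<rho> \<in> M" and X: "X \<in> CR_fields N d M" and j: "j < d"
  shows "(\<Sum>k<N. mcoeff (mps_deriv (Inr k) (\<rho> j)) 0 * mcoeff (X (Inr k)) 0) = 0"
proof -
  have def: "is_defining N d \<rho>" by (rule submanifold_member[OF M])
  obtain m c Y where XY: "X = (\<lambda>v. \<Sum>i<m. c i * Y i v)" "\<And>i. i < (m::nat) \<Longrightarrow> c i \<in> series N"
    "\<And>i. i < m \<Longrightarrow> Y i \<in> tangent_10 N d M \<union> tangent_01 N d M"
    by (rule CR_fields_cases[OF X], rule that)
  have Y0: "(\<Sum>k<N. mcoeff (mps_deriv (Inr k) (\<rho> j)) 0 * mcoeff (Y i (Inr k)) 0) = 0" if i: "i < m" for i
  proof (cases "Y i \<in> tangent_10 N d M")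
    case True
    then show ?thesis by (intro sum.neutral) (auto simp: tangent_10_def)
  next
    case False
    then have Y: "Y i \<in> tangent_fields N d M" "\<And>k. k < N \<Longrightarrow> Y i (Inl k) = 0"
      using XY(3)[OF i] by (auto simp: tangent_01_def)
    have "\<rho> j \<in> ideal_of N d \<rho>" using j by (auto simp: ideal_of_def intro: gen_ideal.gen)
    then have "vf_apply N (Y i) (\<rho> j) \<in> ideal_of N d \<rho>"
      using tangent_fields_tangential[OF M Y(1)] by (auto simp: tangential_def)
    then have "mcoeff (vf_apply N (Y i) (\<rho> j)) 0 = 0"
      using ideal_of_0[of d \<rho> _ N] is_defining_0[OF def] by blast
    then show ?thesis unfolding vf_apply_def sum_vars by (simp add: Y(2) mcoeff_sum mult.commute)
  qed
  have "(\<Sum>k<N. mcoeff (mps_deriv (Inr k) (\<rho> j)) 0 * mcoeff (X (Inr k)) 0) =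
    (\<Sum>i<m. mcoeff (c i) 0 * (\<Sum>k<N. mcoeff (mps_deriv (Inr k) (\<rho> j)) 0 * mcoeff (Y i (Inr k)) 0))"
    unfolding XY(1) sum_distrib_left mcoeff_sum by (subst sum.swap) (simp add: mult_ac)
  also have "\<dots> = 0" using Y0 by (intro sum.neutral) auto
  finally show ?thesis .
qed

text \<open>Submersivity provides CR vectors at 0 that map to the values of the basis fields of M'.
  Their \<zeta>-part decides, because the conjugate half of the mapping depends on \<zeta> alone,
  and that part is a combination of the \<open>zeta.T (Inr i)\<close> at 0; the row
  \<open>e x\<close> lists its coefficients.\<close>

lemma (in generic_series) submersive_matrix:
  assumes M: "formal_submanifold N d M" "\<rho> \<in> M"
    and tgt: "pivot N' d' \<rho>' (\<lambda>k. Inr (I' k)) C" and \<rho>': "\<rho>' \<in> M'"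
    and H: "formal_mapping N N' H" and sub: "CR_submersive N d M N' d' M' H"
  shows "\<exists>e. \<forall>x\<in>free_idx N' d' I'. \<forall>y\<in>free_idx N' d' I'.
      (\<Sum>i\<in>free_idx N d I. e x i * mcoeff (vf_apply N (zeta.T (Inr i)) (complexification H (Inr y))) 0)
        = (if x = y then 1 else 0)"
proof -
  interpret tgt: pivot N' d' \<rho>' "\<lambda>k. Inr (I' k)" C by (rule tgt)
  have "\<exists>X\<in>CR_fields N d M. \<forall>y\<in>free_idx N' d' I'.
      tangent_map N H (\<lambda>v. mps_at0 (X v)) (Inr y) = (if x = y then 1 else 0)" if x: "x \<in> free_idx N' d' I'" for x
  proof -
    have fr: "y \<in> free_idx N' d' I' \<Longrightarrow> Inr y \<in> tgt.free" for y
      by (simp add: free_Inr[OF tgt])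
    have "tgt.T (Inr x) \<in> tangent_fields N' d' M'" by (rule tgt.T_tangent_field[OF \<rho>' fr[OF x]])
    then have "tgt.T (Inr x) \<in> tangent_01 N' d' M'"
      by (auto simp: tangent_01_def tgt.T_def intro!: sum.neutral)
    then have "(\<lambda>v. mps_at0 (tgt.T (Inr x) v)) \<in> fields_at0 (CR_fields N' d' M')"
      unfolding fields_at0_def using CR_fields_gen by blast
    then have "(\<lambda>v. mps_at0 (tgt.T (Inr x) v)) \<in> tangent_map N H ` fields_at0 (CR_fields N d M)"
      using sub unfolding CR_submersive_def by simp
    then obtain X where "X \<in> CR_fields N d M"
      "(\<lambda>v. mps_at0 (tgt.T (Inr x) v)) = tangent_map N H (\<lambda>v. mps_at0 (X v))"
      unfolding fields_at0_def by blast
    moreover have "mps_at0 (tgt.T (Inr x) (Inr y)) = (if x = y then 1 else 0)" if "y \<in> free_idx N' d' I'" for y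
      using tgt.T_free[OF fr[OF that], of "Inr x"] by (auto simp: mps_at0_def)
    ultimately show ?thesis by metis
  qed
  then obtain X where X: "\<And>x. x \<in> free_idx N' d' I' \<Longrightarrow> X x \<in> CR_fields N d M"
    "\<And>x y. x \<in> free_idx N' d' I' \<Longrightarrow> y \<in> free_idx N' d' I' \<Longrightarrow>
      tangent_map N H (\<lambda>v. mps_at0 (X x v)) (Inr y) = (if x = y then 1 else 0)" by metis
  have "(\<Sum>i\<in>free_idx N d I. mcoeff (X x (Inr i)) 0 * mcoeff (vf_apply N (zeta.T (Inr i)) (complexification H (Inr y))) 0)
        = (if x = y then 1 else 0)" if x: "x \<in> free_idx N' d' I'" and y: "y \<in> free_idx N' d' I'" for x y
  proof -
    \<comment> \<open>Discarding the Z-part leaves a vector that is still in the kernel of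
      d\<rho>(0), and whose free components belong to the (0,1) fields alone.\<close>
    define w :: vfield where "w = case_sum (\<lambda>_. 0) (\<lambda>k. X x (Inr k))"
    define D where "D v = mcoeff (mps_deriv v (complexification H (Inr y))) 0" for v
    have DInl: "D (Inl k) = 0" for k
      unfolding D_def by (subst mps_deriv_outside[OF cpl_Inr[OF H]]) auto
    have w: "mcoeff (X x (Inr k)) 0 = (\<Sum>i\<in>free_idx N d I. mcoeff (X x (Inr i)) 0 * mcoeff (zeta.T (Inr i) (Inr k)) 0)"
      if k: "k < N" for k
    proof -
      have "mcoeff (w (Inr k) - (\<Sum>v\<in>zeta.free. w v * zeta.T v (Inr k))) 0 = 0"
        unfolding zeta.kernel_identity[OF id_hom[OF finite_vars], of "Inr k" w, simplified vars_iff, OF k]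
        using CR_fields_kernel[OF M X(1)[OF x]]
        by (auto simp: mcoeff_sum sum_vars w_def intro!: sum.neutral)
      then show ?thesis by (simp add: sum_free_Inr[OF zeta.pivot_axioms] w_def mcoeff_sum)
    qed
    have "(if x = y then 1 else 0) = (\<Sum>k<N. D (Inr k) * mcoeff (X x (Inr k)) 0)"
      using X(2)[OF x y] unfolding tangent_map_def sum_vars D_def[symmetric] mps_at0_def by (simp add: DInl)
    also have "\<dots> = (\<Sum>k<N. D (Inr k) * (\<Sum>i\<in>free_idx N d I. mcoeff (X x (Inr i)) 0 * mcoeff (zeta.T (Inr i) (Inr k)) 0))"
      by (rule sum.cong[OF refl]) (subst w, auto)
    also have "\<dots> = (\<Sum>i\<in>free_idx N d I. mcoeff (X x (Inr i)) 0 * (\<Sum>k<N. mcoeff (zeta.T (Inr i) (Inr k)) 0 * D (Inr k)))"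
      unfolding sum_distrib_left by (subst sum.swap) (simp add: mult_ac)
    also have "\<dots> = (\<Sum>i\<in>free_idx N d I. mcoeff (X x (Inr i)) 0 *
       mcoeff (vf_apply N (zeta.T (Inr i)) (complexification H (Inr y))) 0)"
      unfolding vf_apply_def sum_vars by (simp add: mcoeff_sum D_def[symmetric] DInl)
    finally show ?thesis by simp
  qed
  then show ?thesis by (intro exI[of _ "\<lambda>x i. mcoeff (X x (Inr i)) 0"]) auto
qed

lemma maps_into_ideal:
  assumes M: "formal_submanifold N d M" "\<rho> \<in> M" and M': "formal_submanifold N' d' M'" "\<rho>' \<in> M'"
    and H: "maps_into N d M N' d' M' H" and f: "f \<in> ideal_of N' d' \<rho>'"
  shows "mps_subst f (complexification H) \<in> ideal_of N d \<rho>"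
proof -
  have Hf: "formal_mapping N N' H" using H by (simp add: maps_into_def)
  note hom = cpl_hom[OF Hf]
  obtain \<sigma> \<sigma>' where \<sigma>: "\<sigma> \<in> M" "\<sigma>' \<in> M'"
    "is_matrix_multiple N d' (\<lambda>i. mps_subst (\<sigma>' i) (complexification H)) d \<sigma>"
    using H by (auto simp: maps_into_def)
  have \<sigma>'in: "\<sigma>' ` {..<d'} \<subseteq> series N'" using is_defining_in[OF submanifold_member[OF M'(1) \<sigma>(2)]] by auto
  have I: "ideal_of N d \<rho> = ideal_of N d \<sigma>" "ideal_of N' d' \<rho>' = ideal_of N' d' \<sigma>'"
    using submanifold_ideal[OF M \<sigma>(1)] submanifold_ideal[OF M' \<sigma>(2)] by auto
  have "f \<in> gen_ideal (vars N') (\<sigma>' ` {..<d'})" using f I by (simp add: ideal_of_def)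
  then show ?thesis
    unfolding I(1)
  proof induction
    case zero then show ?case by (simp add: hom_0[OF hom] ideal_of_def gen_ideal.zero)
  next
    case (gen g) then show ?case using matrix_multiple_ideal[OF \<sigma>(3)] by auto
  next
    case (add x y)
    then show ?case using hom_add[OF hom] gen_ideal_in[OF _ \<sigma>'in] by (auto simp: ideal_of_def intro: gen_ideal.add)
  next
    case (mult a x)
    then show ?case using hom_mult[OF hom] gen_ideal_in[OF _ \<sigma>'in] cpl_subst_in[OF Hf]
      by (auto simp: ideal_of_def intro: gen_ideal.mult)
  qed
qed

section \<open>Iterated derivatives and the ideals generated by jets\<close>

lemma multi_pow_rel:
  assumes step: "\<And>i a b. i < n \<Longrightarrow> R a b \<Longrightarrow> R (D i a) (D' i b)" and ab: "R a b"
  shows "R (multi_pow n D \<alpha> a) (multi_pow n D' \<alpha> b)"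
proof -
  have pow: "R ((D i ^^ k) a) ((D' i ^^ k) b)" if "i < n" "R a b" for i k a b
    by (induction k) (use that step in auto)
  have "R (foldr (\<lambda>i F. (D i ^^ \<alpha> i) \<circ> F) xs id a) (foldr (\<lambda>i F. (D' i ^^ \<alpha> i) \<circ> F) xs id b)"
    if "set xs \<subseteq> {..<n}" for xs
    using that by (induction xs) (auto simp: ab intro: pow)
  then show ?thesis unfolding multi_pow_def by (simp add: lessThan_atLeast0)
qed

lemma multi_pow_graded:
  assumes step: "\<And>i r a. i < n \<Longrightarrow> P r a \<Longrightarrow> P (Suc r) (D i a)" and a: "P 0 a"
  shows "P (\<Sum>i<n. \<alpha> i) (multi_pow n D \<alpha> a)"
proof -
  have pow: "P (k + r) ((D i ^^ k) a)" if "i < n" "P r a" for i k r a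
    by (induction k) (use that step in auto)
  have "P (\<Sum>i\<leftarrow>xs. \<alpha> i) (foldr (\<lambda>i F. (D i ^^ \<alpha> i) \<circ> F) xs id a)" if "set xs \<subseteq> {..<n}" for xs
    using that by (induction xs) (auto simp: a intro: pow)
  from this[of "[0..<n]"] show ?thesis
    unfolding multi_pow_def by (simp add: lessThan_atLeast0 interv_sum_list_conv_sum_set_nat)
qed

text \<open>\<iota> is \<open>Inl\<close> or \<open>Inr\<close> and selects whether h or its
  conjugate is differentiated. Derivatives are indexed by words instead of multi-indices, so that
  one more derivative is one more letter.\<close>

definition jets :: "(nat \<Rightarrow> nat + nat) \<Rightarrow> nat \<Rightarrow> (nat + nat \<Rightarrow> (nat + nat) mps) \<Rightarrow> nat \<Rightarrow> (nat + nat) mps set" where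
  "jets \<iota> n \<delta> r = {foldr mps_deriv (map \<iota> w) (\<delta> (\<iota> k)) | w k. k < n \<and> length w \<le> r}"

definition jet_ideal where
  "jet_ideal N d \<rho> \<iota> n \<delta> r = gen_ideal (vars N) (\<rho> ` {..<d} \<union> jets \<iota> n \<delta> r)"

lemma foldr_deriv_in: "f \<in> mps_in V \<Longrightarrow> foldr mps_deriv w f \<in> mps_in V"
  by (induction w) (auto intro: mps_in_deriv)

lemma jet_ideal_mono: "r \<le> s \<Longrightarrow> x \<in> jet_ideal N d \<rho> \<iota> n \<delta> r \<Longrightarrow> x \<in> jet_ideal N d \<rho> \<iota> n \<delta> s"
  unfolding jet_ideal_def by (rule gen_ideal_mono[rotated], assumption) (force simp: jets_def)

lemma ideal_of_jet_ideal: "x \<in> ideal_of N d \<rho> \<Longrightarrow> x \<in> jet_ideal N d \<rho> \<iota> n \<delta> r"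
  unfolding jet_ideal_def ideal_of_def by (rule gen_ideal_mono[rotated])  auto

text \<open>The generators other than \<rho> depend on \<zeta> only, so a tangential field acts on
  them through \<zeta>-derivatives, at the cost of one order.\<close>

lemma jet_ideal_vf:
  assumes X: "tangential N (ideal_of N d \<rho>) X" and \<delta>: "\<And>k. \<delta> (Inr k) \<in> mps_in (Inr ` {..<N})"
    and x: "x \<in> jet_ideal N d \<rho> Inr n \<delta> r"
  shows "vf_apply N X x \<in> jet_ideal N d \<rho> Inr n \<delta> (Suc r)"
  unfolding jet_ideal_def
proof (rule gen_ideal_derivation[OF x[unfolded jet_ideal_def] derivation_vf])
  have Xin: "X v \<in> series N" for v using X by (simp add: tangential_def)
  show "f \<in> series N \<Longrightarrow> vf_apply N X f \<in> series N" for f using Xin by (rule vf_apply_in)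
  have "x \<in> jet_ideal N d \<rho> Inr n \<delta> (Suc r)" if "x \<in> \<rho> ` {..<d} \<union> jets Inr n \<delta> r" for x
    using jet_ideal_mono[of r "Suc r" x N d \<rho> Inr n \<delta>] gen_ideal.gen[OF that, of "vars N"] by (simp add: jet_ideal_def)
  then show "\<rho> ` {..<d} \<union> jets Inr n \<delta> r \<subseteq> gen_ideal (vars N) (\<rho> ` {..<d} \<union> jets Inr n \<delta> (Suc r))"
    by (auto simp: jet_ideal_def)
  fix g assume "g \<in> \<rho> ` {..<d} \<union> jets Inr n \<delta> r"
  then consider "g \<in> \<rho> ` {..<d}" | "g \<in> jets Inr n \<delta> r" by blast
  then show "vf_apply N X g \<in> gen_ideal (vars N) (\<rho> ` {..<d} \<union> jets Inr n \<delta> (Suc r))"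
  proof cases
    case 1
    then have "vf_apply N X g \<in> ideal_of N d \<rho>"
      using X by (auto simp: tangential_def ideal_of_def intro: gen_ideal.gen)
    then show ?thesis using ideal_of_jet_ideal unfolding jet_ideal_def by blast
  next
    case 2
    then obtain w k where g: "g = foldr mps_deriv (map Inr w) (\<delta> (Inr k))" "k < n" "length w \<le> r"
      by (auto simp: jets_def)
    have "g \<in> mps_in (Inr ` {..<N})" unfolding g(1) by (rule foldr_deriv_in[OF \<delta>])
    then have "mps_deriv (Inl j) g = 0" for j by (rule mps_deriv_outside) auto
    then have "vf_apply N X g = (\<Sum>j<N. X (Inr j) * foldr mps_deriv (map Inr (j # w)) (\<delta> (Inr k)))"
      by (simp add: vf_apply_def sum_vars g(1))
    also have "\<dots> \<in> gen_ideal (vars N) (\<rho> ` {..<d} \<union> jets Inr n \<delta> (Suc r))"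
    proof (rule gen_ideal_sum, rule gen_ideal.mult[OF Xin], rule gen_ideal.gen, rule UnI2)
      fix j show "foldr mps_deriv (map Inr (j # w)) (\<delta> (Inr k)) \<in> jets Inr n \<delta> (Suc r)"
        unfolding jets_def using g by (intro CollectI exI[of _ "j # w"] exI[of _ k]) auto
    qed
    finally show ?thesis .
  qed
qed

text \<open>Modulo J and the conjugate differences, the Taylor expansion of \<rho>' is a linear
  relation between the \<open>\<delta> (Inl k)\<close>. The (0,1) fields E kill these and so
  differentiate only the coefficients of the relation, while the conjugate side gains derivatives.
  At 0 the coefficients so obtained are the vectors of \<open>nondeg_span\<close>; as these span,
  the relations can be solved for each \<open>\<delta> (Inl k)\<close>.\<close>

lemma reflection:
  fixes N d N' d' :: nat and H1 H2 :: "nat \<Rightarrow> nat mps" and \<rho> \<rho>' :: "nat \<Rightarrow> (nat + nat) mps"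
  defines "J \<equiv> ideal_of N d \<rho>"
  assumes \<rho>: "\<And>j. j < d \<Longrightarrow> \<rho> j \<in> series N" "\<And>j. j < d \<Longrightarrow> mcoeff (\<rho> j) 0 = 0"
    and \<rho>': "\<And>j. j < d' \<Longrightarrow> \<rho>' j \<in> series N'"
    and H: "formal_mapping N N' H1" "formal_mapping N N' H2"
    and maps: "\<And>j. j < d' \<Longrightarrow> mps_subst (\<rho>' j) (complexification H1) \<in> J"
      "\<And>j. j < d' \<Longrightarrow> mps_subst (\<rho>' j) (complexification H2) \<in> J"
    and L: "\<And>i v. i < N' - d' \<Longrightarrow> L i v \<in> series N'"
    and E: "\<And>i. i < N' - d' \<Longrightarrow> tangential N J (E i)" "\<And>i k. i < N' - d' \<Longrightarrow> E i (Inl k) = 0"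
      "\<And>i f. i < N' - d' \<Longrightarrow> f \<in> series N' \<Longrightarrow> vf_apply N (E i) (mps_subst f (complexification H1))
        - mps_subst (vf_apply N' (L i) f) (complexification H1) \<in> J"
    and span: "nondeg_span N' d' \<rho>' L l = tuples {..<N'} UNIV"
    and k: "k < N'"
  defines "\<delta> \<equiv> \<lambda>v. complexification H1 v - complexification H2 v"
  shows "\<delta> (Inl k) \<in> jet_ideal N d \<rho> Inr N' \<delta> l"
proof -
  let ?JI = "jet_ideal N d \<rho> Inr N' \<delta>"
  note gi = gen_ideal.zero gen_ideal.add gen_ideal.mult gen_ideal_diff gen_ideal_sum
  have Jg: "J = gen_ideal (vars N) (\<rho> ` {..<d})" by (simp add: J_def ideal_of_def)
  have JI_J: "x \<in> J \<Longrightarrow> x \<in> ?JI r" for x r unfolding J_def by (rule ideal_of_jet_ideal)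
  have JIg: "?JI r = gen_ideal (vars N) (\<rho> ` {..<d} \<union> jets Inr N' \<delta> r)" for r by (simp add: jet_ideal_def)
  have J_in: "x \<in> J \<Longrightarrow> x \<in> series N" for x unfolding Jg by (rule gen_ideal_in) (use \<rho> in auto)
  have J_0: "x \<in> J \<Longrightarrow> mcoeff x 0 = 0" for x unfolding J_def using \<rho>(2) by (rule ideal_of_0)
  have \<delta>Inl: "\<delta> (Inl k) \<in> mps_in (Inl ` {..<N})" for k unfolding \<delta>_def using cpl_Inl[OF H(1)] cpl_Inl[OF H(2)] by auto
  have \<delta>Inr: "\<delta> (Inr k) \<in> mps_in (Inr ` {..<N})" for k unfolding \<delta>_def using cpl_Inr[OF H(1)] cpl_Inr[OF H(2)] by auto
  have \<delta>in: "\<delta> v \<in> series N" for v unfolding \<delta>_def using cpl_in[OF H(1)] cpl_in[OF H(2)] by auto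
  have \<delta>0: "mcoeff (\<delta> v) 0 = 0" for v unfolding \<delta>_def using cpl_0[OF H(1)] cpl_0[OF H(2)] by auto
  have \<delta>JI: "k < N' \<Longrightarrow> \<delta> (Inr k) \<in> ?JI r" for k r
    unfolding JIg by (rule gen_ideal.gen) (auto simp: jets_def intro!: exI[of _ "[]"] exI[of _ k])
  define \<phi> where "\<phi> f = mps_subst f (complexification H1)" for f
  have \<phi>: "mps_hom (vars N') \<phi>" unfolding \<phi>_def by (rule cpl_hom[OF H(1)])
  have \<phi>in: "f \<in> series N' \<Longrightarrow> \<phi> f \<in> series N" for f unfolding \<phi>_def by (rule cpl_subst_in[OF H(1)])
  define n where "n = N' - d'"
  define D where "D i = vf_apply N (E i)" for i
  define D' where "D' i = vf_apply N' (L i)" for i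
  have Ein: "i < n \<Longrightarrow> E i v \<in> series N" for i v using E(1) by (simp add: tangential_def n_def)
  have Din: "i < n \<Longrightarrow> f \<in> series N \<Longrightarrow> D i f \<in> series N" for i f
    unfolding D_def using Ein by (auto intro: vf_apply_in)
  have D'in: "i < n \<Longrightarrow> f \<in> series N' \<Longrightarrow> D' i f \<in> series N'" for i f
    unfolding D'_def using L by (auto intro: vf_apply_in simp: n_def)
  have D: "mps_derivation (D i)" for i unfolding D_def by (rule derivation_vf)
  have D\<delta>: "D i (\<delta> (Inl k)) = 0" if "i < n" for i k
  proof -
    have "mps_deriv (Inr j) (\<delta> (Inl k)) = 0" for j by (rule mps_deriv_outside[OF \<delta>Inl]) auto
    then show ?thesis using E(2) that by (simp add: D_def vf_apply_def sum_vars n_def)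
  qed
  have DJ: "i < n \<Longrightarrow> x \<in> J \<Longrightarrow> D i x \<in> J" for i x
    using E(1) by (simp add: tangential_def D_def n_def)
  \<comment> \<open>x is the value at 0 of the coefficients of some relation. Relations can be added
    and scaled, so it is enough to treat spanning vectors.\<close>
  define P where "P x \<longleftrightarrow> (\<exists>m. (\<forall>k. m k \<in> series N) \<and> (\<forall>k<N'. mcoeff (m k) 0 = x k) \<and>
      (\<Sum>k<N'. m k * \<delta> (Inl k)) \<in> ?JI l)" for x :: "nat \<Rightarrow> complex"
  have P_gen: "P (\<lambda>k. if k < N' then mps_at0 (multi_pow n D' \<alpha> (mps_deriv (Inl k) (\<rho>' j))) else 0)"
    if j: "j < d'" and \<alpha>: "(\<Sum>i<n. \<alpha> i) \<le> l" for j \<alpha>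
  proof -
    obtain q where q: "\<And>u v. u \<in> vars N' \<Longrightarrow> v \<in> vars N' \<Longrightarrow> q u v \<in> series N"
      "mps_subst (\<rho>' j) (complexification H1) - mps_subst (\<rho>' j) (complexification H2) =
        (\<Sum>u\<in>vars N'. \<phi> (mps_deriv u (\<rho>' j)) * \<delta> u) + (\<Sum>u\<in>vars N'. \<Sum>v\<in>vars N'. q u v * \<delta> u * \<delta> v)"
      using subst_taylor[OF finite_vars \<rho>'[OF j],
          of "complexification H1" "vars N" "complexification H2"] cpl_in[OF H(1)] cpl_0[OF H(1)] cpl_in[OF H(2)] cpl_0[OF H(2)]
      unfolding \<delta>_def \<phi>_def by blast
    \<comment> \<open>The terms quadratic in the Z-differences are moved into the coefficients,
      where they vanish at 0. The default 0 keeps \<open>c k\<close> a series for indices beyond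
      N'.\<close>
    define c where "c k = \<phi> (mps_deriv (Inl k) (\<rho>' j)) + (\<Sum>i<N'. (if k < N' then q (Inl k) (Inl i) else 0) * \<delta> (Inl i))" for k
    have rin: "mps_deriv v (\<rho>' j) \<in> series N'" for v using \<rho>'[OF j] by (rule mps_in_deriv)
    have cin: "c k \<in> series N" for k
      unfolding c_def using rin \<phi>in q(1) \<delta>in by (auto intro!: mps_in_add mps_in_sum mps_in_mult)
    have eq: "mps_subst (\<rho>' j) (complexification H1) - mps_subst (\<rho>' j) (complexification H2) =
       (\<Sum>k<N'. c k * \<delta> (Inl k)) + ((\<Sum>k<N'. \<phi> (mps_deriv (Inr k) (\<rho>' j)) * \<delta> (Inr k))
       + (\<Sum>k<N'. \<Sum>i<N'. (q (Inl k) (Inr i) * \<delta> (Inl k)) * \<delta> (Inr i))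
       + (\<Sum>k<N'. (\<Sum>v\<in>vars N'. q (Inr k) v * \<delta> v) * \<delta> (Inr k)))"
    proof -
      have "(\<Sum>u\<in>vars N'. \<Sum>v\<in>vars N'. q u v * \<delta> u * \<delta> v) =
         (\<Sum>k<N'. (\<Sum>i<N'. q (Inl k) (Inl i) * \<delta> (Inl i)) * \<delta> (Inl k))
         + (\<Sum>k<N'. \<Sum>i<N'. (q (Inl k) (Inr i) * \<delta> (Inl k)) * \<delta> (Inr i))
         + (\<Sum>k<N'. (\<Sum>v\<in>vars N'. q (Inr k) v * \<delta> v) * \<delta> (Inr k))"
        unfolding sum_vars[of _ N'] by (simp add: sum.distrib sum_distrib_left sum_distrib_right distrib_right distrib_left mult_ac)
      moreover have "(\<Sum>k<N'. c k * \<delta> (Inl k)) = (\<Sum>k<N'. \<phi> (mps_deriv (Inl k) (\<rho>' j)) * \<delta> (Inl k))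
         + (\<Sum>k<N'. (\<Sum>i<N'. q (Inl k) (Inl i) * \<delta> (Inl i)) * \<delta> (Inl k))"
        by (simp add: c_def distrib_right sum.distrib)
      ultimately show ?thesis unfolding q(2) sum_vars[of "\<lambda>u. \<phi> (mps_deriv u (\<rho>' j)) * \<delta> u"] by simp
    qed
    have rest: "(\<Sum>k<N'. \<phi> (mps_deriv (Inr k) (\<rho>' j)) * \<delta> (Inr k))
       + (\<Sum>k<N'. \<Sum>i<N'. (q (Inl k) (Inr i) * \<delta> (Inl k)) * \<delta> (Inr i))
       + (\<Sum>k<N'. (\<Sum>v\<in>vars N'. q (Inr k) v * \<delta> v) * \<delta> (Inr k)) \<in> ?JI 0"
    proof -
      have "(\<Sum>k<N'. \<phi> (mps_deriv (Inr k) (\<rho>' j)) * \<delta> (Inr k)) \<in> ?JI 0" unfolding JIg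
        by (rule gen_ideal_sum, rule gen_ideal.mult) (use \<phi>in rin \<delta>JI in \<open>auto simp: JIg\<close>)
      moreover have "(\<Sum>k<N'. \<Sum>i<N'. (q (Inl k) (Inr i) * \<delta> (Inl k)) * \<delta> (Inr i)) \<in> ?JI 0" unfolding JIg
        by (rule gen_ideal_sum, rule gen_ideal_sum, rule gen_ideal.mult)
          (use q(1) \<delta>in \<delta>JI in \<open>auto simp: JIg intro!: mps_in_mult\<close>)
      moreover have "(\<Sum>k<N'. (\<Sum>v\<in>vars N'. q (Inr k) v * \<delta> v) * \<delta> (Inr k)) \<in> ?JI 0" unfolding JIg
        by (rule gen_ideal_sum, rule gen_ideal.mult)
          (use q(1) \<delta>in \<delta>JI in \<open>auto simp: JIg intro!: mps_in_sum mps_in_mult\<close>)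
      ultimately show ?thesis unfolding JIg by (intro gen_ideal.add)
    qed
    have t: "mps_subst (\<rho>' j) (complexification H1) - mps_subst (\<rho>' j) (complexification H2) \<in> ?JI 0"
      using JI_J maps[OF j] unfolding JIg by (auto intro: gen_ideal_diff)
    have c0: "(\<Sum>k<N'. c k * \<delta> (Inl k)) \<in> ?JI 0"
      using gen_ideal_diff[OF t[unfolded JIg] rest[unfolded JIg]] unfolding eq JIg by simp
    have "multi_pow n D \<alpha> (\<Sum>k<N'. c k * \<delta> (Inl k)) \<in> ?JI (\<Sum>i<n. \<alpha> i)"
      by (rule multi_pow_graded[of n "\<lambda>r a. a \<in> ?JI r" D, OF _ c0])
        (use jet_ideal_vf[of N d \<rho> _ \<delta>] E(1)[unfolded J_def] \<delta>Inr in \<open>simp add: n_def D_def\<close>)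
    then have DaJ: "multi_pow n D \<alpha> (\<Sum>k<N'. c k * \<delta> (Inl k)) \<in> ?JI l" by (rule jet_ideal_mono[OF \<alpha>])
    define m where "m k = multi_pow n D \<alpha> (c k)" for k
    have m_sum: "multi_pow n D \<alpha> (\<Sum>k<N'. c k * \<delta> (Inl k)) = (\<Sum>k<N'. m k * \<delta> (Inl k))"
    proof -
      have 1: "multi_pow n D \<alpha> (\<Sum>k<N'. c k * \<delta> (Inl k)) =
          (\<Sum>k<N'. (multi_pow n (\<lambda>i b k. D i (b k)) \<alpha> c) k * \<delta> (Inl k))"
        by (rule multi_pow_rel[where R = "\<lambda>a b. a = (\<Sum>k<N'. b k * \<delta> (Inl k))"])
          (simp_all add: derivation_sum[OF D] derivation_mult[OF D] D\<delta>)
      have 2: "(multi_pow n (\<lambda>i b k. D i (b k)) \<alpha> c) k = m k" for k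
        unfolding m_def by (rule multi_pow_rel[where R = "\<lambda>a b. a k = b"]) simp_all
      show ?thesis unfolding 1 2 by simp
    qed
    \<comment> \<open>Agreement with a pulled-back series modulo J and the
      \<open>\<delta> (Inl i)\<close>. Differentiation preserves it, as E kills these differences,
      and it forces equal values at 0.\<close>
    define R where "R a b \<longleftrightarrow> a \<in> series N \<and> b \<in> series N' \<and>
      (\<exists>s. (\<forall>i. s i \<in> series N) \<and> a - \<phi> b - (\<Sum>i<N'. s i * \<delta> (Inl i)) \<in> J)" for a b
    have R: "R (m k) (multi_pow n D' \<alpha> (mps_deriv (Inl k) (\<rho>' j)))" for k
      unfolding m_def
    proof (rule multi_pow_rel)
      have "c k - \<phi> (mps_deriv (Inl k) (\<rho>' j)) - (\<Sum>i<N'. (if k < N' \<and> i < N' then q (Inl k) (Inl i) else 0) * \<delta> (Inl i)) = 0"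
        by (auto simp: c_def intro!: sum.cong)
      then show "R (c k) (mps_deriv (Inl k) (\<rho>' j))"
        unfolding R_def using cin rin q(1) gen_ideal.zero[of "vars N" "\<rho> ` {..<d}"]
        by (intro conjI exI[of _ "\<lambda>i. if k < N' \<and> i < N' then q (Inl k) (Inl i) else 0"]) (auto simp: Jg)
    next
      fix i a b assume i: "i < n" and "R a b"
      then obtain s where ab: "a \<in> series N" "b \<in> series N'" "\<And>i. s i \<in> series N"
        "a - \<phi> b - (\<Sum>i<N'. s i * \<delta> (Inl i)) \<in> J" by (auto simp: R_def)
      have "D i (a - \<phi> b - (\<Sum>i<N'. s i * \<delta> (Inl i))) \<in> J" by (rule DJ[OF i ab(4)])
      then have 1: "D i a - D i (\<phi> b) - (\<Sum>k<N'. D i (s k) * \<delta> (Inl k)) \<in> J"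
        by (simp add: derivation_diff[OF D] derivation_sum[OF D] derivation_mult[OF D] D\<delta>[OF i])
      have 2: "D i (\<phi> b) - \<phi> (D' i b) \<in> J" using E(3)[OF _ ab(2), of i] i by (simp add: D_def D'_def \<phi>_def n_def)
      have "D i a - \<phi> (D' i b) - (\<Sum>k<N'. D i (s k) * \<delta> (Inl k)) \<in> J"
        using gen_ideal.add[OF 1[unfolded Jg] 2[unfolded Jg]] by (simp add: Jg algebra_simps)
      then show "R (D i a) (D' i b)"
        unfolding R_def using Din[OF i] D'in[OF i] ab by (intro conjI exI[of _ "\<lambda>k. D i (s k)"]) auto
    qed
    have m0: "mcoeff (m k) 0 = mcoeff (multi_pow n D' \<alpha> (mps_deriv (Inl k) (\<rho>' j))) 0" for k
    proof -
      obtain s where s: "multi_pow n D' \<alpha> (mps_deriv (Inl k) (\<rho>' j)) \<in> series N'"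
        "m k - \<phi> (multi_pow n D' \<alpha> (mps_deriv (Inl k) (\<rho>' j))) - (\<Sum>i<N'. s i * \<delta> (Inl i)) \<in> J"
        using R[of k] by (auto simp: R_def)
      have "(\<Sum>i<N'. mcoeff (s i) 0 * mcoeff (\<delta> (Inl i)) 0) = 0" by (intro sum.neutral) (simp add: \<delta>0)
      then show ?thesis using J_0[OF s(2)] hom_coeff_0[OF \<phi> s(1)] by (simp add: mcoeff_sum)
    qed
    have "m k \<in> series N" for k using R[of k] by (simp add: R_def)
    then show ?thesis unfolding P_def using DaJ m_sum m0
      by (intro exI[of _ m]) (auto simp: mps_at0_def)
  qed
  have D'_eq: "D' = (\<lambda>i. vf_apply N' (L i))" by (simp add: D'_def fun_eq_iff)
  have P_span: "P x" if "x \<in> nondeg_span N' d' \<rho>' L l" for x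
    using that unfolding nondeg_span_def
  proof (rule cvec.span_induct)
    show "cvec.subspace {x. P x}"
    proof (rule cvec.subspaceI)
      show "0 \<in> {x. P x}" unfolding P_def by (auto intro!: exI[of _ "\<lambda>_. 0"] simp: JIg gen_ideal.zero)
    next
      fix x y assume "x \<in> {x. P x}" "y \<in> {x. P x}"
      then obtain m m' where "\<forall>k. m k \<in> series N" "\<forall>k<N'. mcoeff (m k) 0 = x k" "(\<Sum>k<N'. m k * \<delta> (Inl k)) \<in> ?JI l"
        "\<forall>k. m' k \<in> series N" "\<forall>k<N'. mcoeff (m' k) 0 = y k" "(\<Sum>k<N'. m' k * \<delta> (Inl k)) \<in> ?JI l"
        unfolding P_def by auto
      then show "x + y \<in> {x. P x}" unfolding P_def
        by (intro CollectI exI[of _ "\<lambda>k. m k + m' k"])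
          (auto simp: distrib_right sum.distrib JIg intro: gen_ideal.add)
    next
      fix a x assume "x \<in> {x. P x}"
      then obtain m where m: "\<forall>k. m k \<in> series N" "\<forall>k<N'. mcoeff (m k) 0 = x k" "(\<Sum>k<N'. m k * \<delta> (Inl k)) \<in> ?JI l"
        unfolding P_def by auto
      have "mps_const a * (\<Sum>k<N'. m k * \<delta> (Inl k)) \<in> ?JI l" using m(3) by (auto simp: JIg intro: gen_ideal.mult)
      then show "cvec_scale a x \<in> {x. P x}" unfolding P_def using m
        by (intro CollectI exI[of _ "\<lambda>k. mps_const a * m k"])
          (auto simp: sum_distrib_left mult.assoc cvec_scale_def intro: mps_in_mult)
    qed
  qed (use P_gen[unfolded D'_eq n_def] in auto)
  have "\<exists>m. (\<forall>k. m k \<in> series N) \<and> (\<forall>k<N'. mcoeff (m k) 0 = (if k = i then 1 else 0)) \<and>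
      (\<Sum>k<N'. m k * \<delta> (Inl k)) \<in> ?JI l" if "i < N'" for i
  proof -
    have "(\<lambda>k. if k = i then 1 else 0) \<in> tuples {..<N'} (UNIV :: complex set)" using that by (auto simp: tuples_def)
    then show ?thesis using P_span unfolding span P_def by blast
  qed
  then have "\<forall>i\<in>{..<N'}. \<exists>m. (\<forall>k. m k \<in> series N) \<and> (\<forall>k<N'. mcoeff (m k) 0 = (if k = i then 1 else 0)) \<and>
      (\<Sum>k<N'. m k * \<delta> (Inl k)) \<in> ?JI l" by blast
  from bchoice[OF this] obtain m where m': "\<forall>i\<in>{..<N'}. (\<forall>k. m i k \<in> series N) \<and>
      (\<forall>k<N'. mcoeff (m i k) 0 = (if k = i then 1 else 0)) \<and> (\<Sum>k<N'. m i k * \<delta> (Inl k)) \<in> ?JI l" by blast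
  then have m: "\<And>i k. i < N' \<Longrightarrow> m i k \<in> series N"
    "\<And>i k. i < N' \<Longrightarrow> k < N' \<Longrightarrow> mcoeff (m i k) 0 = (if k = i then 1 else 0)"
    "\<And>i. i < N' \<Longrightarrow> (\<Sum>k<N'. m i k * \<delta> (Inl k)) \<in> ?JI l" by auto
  \<comment> \<open>The relations obtained for the unit vectors form a matrix that is the identity
    at 0.\<close>
  obtain W where W: "\<And>i j. i \<in> {..<N'} \<Longrightarrow> j \<in> {..<N'} \<Longrightarrow> W i j \<in> series N"
    "\<And>i k. i \<in> {..<N'} \<Longrightarrow> k \<in> {..<N'} \<Longrightarrow> (\<Sum>j<N'. W i j * m j k) = (if i = k then 1 else 0)"
    by (rule matrix_left_inverse[of "{..<N'}" m "vars N"]) (use m in auto)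
  have "(\<Sum>i<N'. W k i * (\<Sum>j<N'. m i j * \<delta> (Inl j))) \<in> ?JI l" unfolding JIg
    by (rule gen_ideal_sum, rule gen_ideal.mult) (use W(1) m(3) k in \<open>auto simp: JIg\<close>)
  also have "(\<Sum>i<N'. W k i * (\<Sum>j<N'. m i j * \<delta> (Inl j))) = (\<Sum>j<N'. (\<Sum>i<N'. W k i * m i j) * \<delta> (Inl j))"
    unfolding sum_distrib_left sum_distrib_right by (subst sum.swap) (simp add: mult.assoc)
  also have "\<dots> = (\<Sum>j<N'. (if k = j then 1 else 0) * \<delta> (Inl j))"
    using W(2) k by (intro sum.cong) auto
  also have "\<dots> = \<delta> (Inl k)" using k sum_delta_matrix(1)[of "{..<N'}" k "\<lambda>j. \<delta> (Inl j)"] by simp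
  finally show ?thesis .
qed

text \<open>Nondegeneracy comes with one defining series \<rho>' of M' and the invertible minor with
  another, \<sigma>. The fields L are lifted by means of \<sigma>, to whose ideal they are tangent,
  and the relation is expanded in \<rho>'.\<close>

lemma (in generic_series) reflection_submersive:
  assumes M: "formal_submanifold N d M" "\<rho> \<in> M"
    and M': "formal_submanifold N' d' M'" "generic d' M'" "nondegenerate N' d' M' l"
    and H1: "maps_into N d M N' d' M' H1" "CR_submersive N d M N' d' M' H1"
    and H2: "maps_into N d M N' d' M' H2"
    and k: "k < N'"
  shows "complexification H1 (Inl k) - complexification H2 (Inl k) \<in>
    jet_ideal N d \<rho> Inr N' (\<lambda>v. complexification H1 v - complexification H2 v) l"
proof -
  have Hf: "formal_mapping N N' H1" "formal_mapping N N' H2" using H1 H2 by (auto simp: maps_into_def)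
  obtain \<sigma> I' C C' where \<sigma>: "\<sigma> \<in> M'" "generic_series N' d' \<sigma> I' C C'"
    using generic_series_exists[OF M'(1,2)] by blast
  then have tgt: "pivot N' d' \<sigma> (\<lambda>k. Inr (I' k)) C" by (simp add: generic_series_def)
  obtain \<rho>' L where \<rho>': "\<rho>' \<in> M'" and L: "is_basis_01 N' d' M' \<rho>' L"
    and span: "nondeg_span N' d' \<rho>' L l = tuples {..<N'} UNIV"
    using M'(3) by (auto simp: nondegenerate_def)
  have def': "is_defining N' d' \<rho>'" by (rule submanifold_member[OF M'(1) \<rho>'])
  have Lt: "L i \<in> tangent_01 N' d' M'" if "i < N' - d'" for i using L that by (auto simp: is_basis_01_def)
  have Ltan: "tangential N' (ideal_of N' d' \<sigma>) (L i)" if "i < N' - d'" for i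
    using tangent_fields_tangential[OF M'(1) \<sigma>(1)] Lt[OF that] by (auto simp: tangent_01_def)
  obtain e where e: "\<forall>x\<in>free_idx N' d' I'. \<forall>y\<in>free_idx N' d' I'.
      (\<Sum>i\<in>free_idx N d I. e x i * mcoeff (vf_apply N (zeta.T (Inr i)) (complexification H1 (Inr y))) 0)
        = (if x = y then 1 else 0)"
    using submersive_matrix[OF M tgt \<sigma>(1) Hf(1) H1(2)] by blast
  have "\<exists>E. tangential N (ideal_of N d \<rho>) E \<and> (\<forall>k. E (Inl k) = 0) \<and>
    (\<forall>f\<in>series N'. vf_apply N E (mps_subst f (complexification H1))
        - mps_subst (vf_apply N' (L i) f) (complexification H1) \<in> ideal_of N d \<rho>)" if i: "i < N' - d'" for i
  proof (rule lift_field[OF tgt Hf(1) _ _ Ltan[OF i], where e = e])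
    show "mps_subst (\<sigma> j) (complexification H1) \<in> ideal_of N d \<rho>" if "j < d'" for j
      by (rule maps_into_ideal[OF M M'(1) \<sigma>(1) H1(1)]) (use that in \<open>auto simp: ideal_of_def intro: gen_ideal.gen\<close>)
    show "L i (Inl k) = 0" if "k < N'" for k using Lt[OF i] that by (simp add: tangent_01_def)
  qed (use e in auto)
  then have "\<forall>i\<in>{..<N' - d'}. \<exists>E. tangential N (ideal_of N d \<rho>) E \<and> (\<forall>k. E (Inl k) = 0) \<and>
    (\<forall>f\<in>series N'. vf_apply N E (mps_subst f (complexification H1))
        - mps_subst (vf_apply N' (L i) f) (complexification H1) \<in> ideal_of N d \<rho>)" by blast
  from bchoice[OF this] obtain E where E: "\<forall>i\<in>{..<N' - d'}. tangential N (ideal_of N d \<rho>) (E i) \<and> (\<forall>k. E i (Inl k) = 0) \<and>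
    (\<forall>f\<in>series N'. vf_apply N (E i) (mps_subst f (complexification H1))
        - mps_subst (vf_apply N' (L i) f) (complexification H1) \<in> ideal_of N d \<rho>)" by blast
  have gen': "j < d' \<Longrightarrow> \<rho>' j \<in> ideal_of N' d' \<rho>'" for j by (auto simp: ideal_of_def intro: gen_ideal.gen)
  show ?thesis
  proof (rule reflection[where \<rho>' = \<rho>' and d' = d' and L = L and E = E])
    show "mps_subst (\<rho>' j) (complexification H1) \<in> ideal_of N d \<rho>"
      "mps_subst (\<rho>' j) (complexification H2) \<in> ideal_of N d \<rho>" if "j < d'" for j
      using maps_into_ideal[OF M M'(1) \<rho>' H1(1) gen'[OF that]] maps_into_ideal[OF M M'(1) \<rho>' H2 gen'[OF that]] .
    show "L i v \<in> series N'" if "i < N' - d'" for i v using Ltan[OF that] by (simp add: tangential_def)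
  qed (use zeta.rho_in rho_0 is_defining_in[OF def'] Hf E span k in auto)
qed

section \<open>Conjugation exchanges jets in Z with jets in \<zeta>\<close>

lemma bar_cpl:
  assumes H: "formal_mapping N N' H"
  shows "mps_bar (complexification H (Inl k)) = complexification H (Inr k)"
    and "mps_bar (complexification H (Inr k)) = complexification H (Inl k)"
proof -
  have var: "v < N \<Longrightarrow> mps_subst (mps_var v) (mps_var \<circ> Inl) = mps_var (Inl v)"
    "v < N \<Longrightarrow> mps_subst (mps_var v) (mps_var \<circ> Inr) = mps_var (Inr v)" for v
    by (subst subst_var[of "{..<N}"]; simp)+
  have bv: "v < N \<Longrightarrow> mps_bar (mps_var (Inl v)) = mps_var (Inr v)" for v
    unfolding mps_bar_def by (subst mps_cnj_simps, subst subst_var[of "vars N"]) auto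
  have ser: "f \<in> mps_in {..<N} \<Longrightarrow> mps_subst f (mps_var \<circ> Inl) \<in> series N" for f
    by (rule Inl_series[OF Inl_subst_in])
  have "mps_bar (mps_subst f (mps_var \<circ> Inl)) - mps_subst (mps_cnj f) (mps_var \<circ> Inr) = 0"
    if f: "f \<in> mps_in {..<N}" for f
  proof (rule mps_functional_zero[OF _ f, where u = "\<lambda>v. mps_var (Inr v)"])
    fix f g :: "nat mps" assume fg: "f \<in> mps_in {..<N}" "g \<in> mps_in {..<N}"
    then show "mps_bar (mps_subst (f + g) (mps_var \<circ> Inl)) - mps_subst (mps_cnj (f + g)) (mps_var \<circ> Inr) =
      mps_bar (mps_subst f (mps_var \<circ> Inl)) - mps_subst (mps_cnj f) (mps_var \<circ> Inr) +
      (mps_bar (mps_subst g (mps_var \<circ> Inl)) - mps_subst (mps_cnj g) (mps_var \<circ> Inr))"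
      using bar_add[OF ser[OF fg(1)] ser[OF fg(2)]]
      by (simp add: hom_add[OF Inl_hom[of N]] hom_add[OF Inr_hom[of N]] mps_in_cnj)
  next
    fix c show "mps_bar (mps_subst (mps_const c) (mps_var \<circ> Inl)) - mps_subst (mps_cnj (mps_const c)) (mps_var \<circ> Inr) = 0"
      by (simp add: mps_bar_def hom_const[OF Inl_hom[of N]] hom_const[OF Inr_hom[of N]] hom_const[OF bar_hom[of N]])
  next
    fix v and f :: "nat mps" assume v: "v \<in> {..<N}" and f: "f \<in> mps_in {..<N}"
    then show "mps_bar (mps_subst (mps_var v * f) (mps_var \<circ> Inl)) - mps_subst (mps_cnj (mps_var v * f)) (mps_var \<circ> Inr)
      = mps_var (Inr v) * (mps_bar (mps_subst f (mps_var \<circ> Inl)) - mps_subst (mps_cnj f) (mps_var \<circ> Inr))"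
      using bar_mult[OF _ ser[OF f], of "mps_var (Inl v)"]
      by (simp add: hom_mult[OF Inl_hom[of N]] hom_mult[OF Inr_hom[of N]] mps_in_cnj var bv right_diff_distrib)
  qed auto
  then show 1: "mps_bar (complexification H (Inl k)) = complexification H (Inr k)" for k
    using formal_mapping_in[OF H, of k] by (simp add: complexification_def)
  show "mps_bar (complexification H (Inr k)) = complexification H (Inl k)"
    using bar_bar[OF cpl_in[OF H]] 1[of k] by metis
qed

lemma bar_diff: "f \<in> series N \<Longrightarrow> g \<in> series N \<Longrightarrow> mps_bar (f - g) = mps_bar f - mps_bar g"
  using bar_add[of "f - g" N g] by (auto simp: algebra_simps mps_in_diff)

lemma bar_foldr_deriv:
  assumes "f \<in> series N"
  shows "mps_bar (foldr mps_deriv (map Inl w) f) = foldr mps_deriv (map Inr w) (mps_bar f)"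
    "mps_bar (foldr mps_deriv (map Inr w) f) = foldr mps_deriv (map Inl w) (mps_bar f)"
  by (induction w) (simp_all add: bar_deriv[OF foldr_deriv_in[OF assms], symmetric])

context generic_series
begin

text \<open>Series in Z alone do not see the \<zeta>-correction of the lifted field. Their
  derivatives in Z can therefore be taken by fields tangent to M, which respect its ideal.\<close>

lemma zeta_T_Inl: "j < N \<Longrightarrow> f \<in> mps_in (Inl ` {..<N}) \<Longrightarrow> vf_apply N (zeta.T (Inl j)) f = mps_deriv (Inl j) f"
proof -
  assume j: "j < N" and f: "f \<in> mps_in (Inl ` {..<N})"
  have "mps_deriv (Inr k) f = 0" for k by (rule mps_deriv_outside[OF f]) auto
  moreover have "zeta.T (Inl j) (Inl k) = (if k = j then 1 else 0)" if "k < N" for k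
    using that by (subst zeta.T_free) (auto simp: free_Inr[OF zeta.pivot_axioms])
  ultimately have "vf_apply N (zeta.T (Inl j)) f = (\<Sum>k<N. (if k = j then 1 else 0) * mps_deriv (Inl k) f)"
    unfolding vf_apply_def sum_vars by simp
  then show ?thesis using j sum_delta_matrix(1)[of "{..<N}" j "\<lambda>k. mps_deriv (Inl k) f"]
    by (simp add: eq_commute[of j])
qed


context
  fixes N' l :: nat and \<delta> :: "nat + nat \<Rightarrow> (nat + nat) mps"
  assumes dInl: "\<And>k. \<delta> (Inl k) \<in> mps_in (Inl ` {..<N})" and dInr: "\<And>k. \<delta> (Inr k) \<in> mps_in (Inr ` {..<N})"
    and dbar: "\<And>k. mps_bar (\<delta> (Inl k)) = \<delta> (Inr k)" "\<And>k. mps_bar (\<delta> (Inr k)) = \<delta> (Inl k)"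
    and refl: "\<And>k. k < N' \<Longrightarrow> \<delta> (Inl k) \<in> jet_ideal N d \<rho> Inr N' \<delta> l"
begin

text \<open>Each lifted derivative applied to the reflection identity raises the order of the
  conjugate jets by one; a letter beyond N gives 0.\<close>

lemma jet_word:
  assumes k: "k < N'" shows "foldr mps_deriv (map Inl w) (\<delta> (Inl k)) \<in> jet_ideal N d \<rho> Inr N' \<delta> (length w + l)"
proof (induction w)
  case Nil then show ?case using refl[OF k] by simp
next
  case (Cons j w)
  let ?f = "foldr mps_deriv (map Inl w) (\<delta> (Inl k))"
  have f: "?f \<in> mps_in (Inl ` {..<N})" by (rule foldr_deriv_in[OF dInl])
  show ?case
  proof (cases "j < N")
    case True
    then have "Inl j \<in> zeta.free" by (simp add: free_Inr[OF zeta.pivot_axioms])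
    from jet_ideal_vf[OF zeta.T_tangential[OF this] dInr Cons.IH] zeta_T_Inl[OF True f]
    show ?thesis by simp
  next
    case False
    then have "mps_deriv (Inl j) ?f = 0" by (intro mps_deriv_outside[OF f]) auto
    then show ?thesis by (simp add: jet_ideal_def gen_ideal.zero)
  qed
qed

lemma jet_ideal_Inl_Inr:
  assumes "x \<in> jet_ideal N d \<rho> Inl N' \<delta> r" shows "x \<in> jet_ideal N d \<rho> Inr N' \<delta> (r + l)"
  unfolding jet_ideal_def
proof (rule gen_ideal_subset[OF assms[unfolded jet_ideal_def]], rule subsetI)
  fix g assume "g \<in> \<rho> ` {..<d} \<union> jets Inl N' \<delta> r"
  then consider "g \<in> \<rho> ` {..<d}" | w k where "g = foldr mps_deriv (map Inl w) (\<delta> (Inl k))" "k < N'" "length w \<le> r"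
    by (auto simp: jets_def)
  then show "g \<in> gen_ideal (vars N) (\<rho> ` {..<d} \<union> jets Inr N' \<delta> (r + l))"
  proof cases
    case 1 then show ?thesis by (auto intro: gen_ideal.gen)
  next
    case 2
    then show ?thesis using jet_ideal_mono[OF _ jet_word[OF 2(2)], of w "r + l"] by (simp add: jet_ideal_def)
  qed
qed

lemma jet_ideal_bar:
  "x \<in> jet_ideal N d \<rho> Inl N' \<delta> r \<Longrightarrow> mps_bar x \<in> jet_ideal N d \<rho> Inr N' \<delta> r"
  "x \<in> jet_ideal N d \<rho> Inr N' \<delta> r \<Longrightarrow> mps_bar x \<in> jet_ideal N d \<rho> Inl N' \<delta> r"
proof -
  note dser = Inl_series[OF dInl] Inr_series[OF dInr]
  have in1: "\<rho> ` {..<d} \<union> jets Inl N' \<delta> r \<subseteq> series N" "\<rho> ` {..<d} \<union> jets Inr N' \<delta> r \<subseteq> series N"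
    using zeta.rho_in dser by (auto simp: jets_def intro!: foldr_deriv_in)
  show "x \<in> jet_ideal N d \<rho> Inl N' \<delta> r \<Longrightarrow> mps_bar x \<in> jet_ideal N d \<rho> Inr N' \<delta> r"
    unfolding jet_ideal_def
  proof (erule gen_ideal_bar[OF _ in1(1)])
    fix g assume "g \<in> \<rho> ` {..<d} \<union> jets Inl N' \<delta> r"
    then have "mps_bar g \<in> \<rho> ` {..<d} \<union> jets Inr N' \<delta> r"
      by (auto simp: jets_def rho_bar bar_foldr_deriv[OF dser(1)] dbar)
    then show "mps_bar g \<in> gen_ideal (vars N) (\<rho> ` {..<d} \<union> jets Inr N' \<delta> r)" by (rule gen_ideal.gen)
  qed
  show "x \<in> jet_ideal N d \<rho> Inr N' \<delta> r \<Longrightarrow> mps_bar x \<in> jet_ideal N d \<rho> Inl N' \<delta> r"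
    unfolding jet_ideal_def
  proof (erule gen_ideal_bar[OF _ in1(2)])
    fix g assume "g \<in> \<rho> ` {..<d} \<union> jets Inr N' \<delta> r"
    then have "mps_bar g \<in> \<rho> ` {..<d} \<union> jets Inl N' \<delta> r"
      by (auto simp: jets_def rho_bar bar_foldr_deriv[OF dser(2)] dbar)
    then show "mps_bar g \<in> gen_ideal (vars N) (\<rho> ` {..<d} \<union> jets Inl N' \<delta> r)" by (rule gen_ideal.gen)
  qed
qed

text \<open>The mirror image of \<open>jet_ideal_Inl_Inr\<close>, obtained by conjugating before and
  after, since \<open>mps_bar\<close> fixes \<rho> and exchanges the two kinds of jets.\<close>

lemma jet_ideal_Inr_Inl:
  assumes x: "x \<in> jet_ideal N d \<rho> Inr N' \<delta> r" shows "x \<in> jet_ideal N d \<rho> Inl N' \<delta> (r + l)"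
proof -
  have "\<rho> ` {..<d} \<union> jets Inr N' \<delta> r \<subseteq> series N"
    using zeta.rho_in Inr_series[OF dInr] by (auto simp: jets_def intro!: foldr_deriv_in)
  then have "x \<in> series N" using x unfolding jet_ideal_def by (metis gen_ideal_in)
  moreover have "mps_bar (mps_bar x) \<in> jet_ideal N d \<rho> Inl N' \<delta> (r + l)"
    by (intro jet_ideal_bar(2) jet_ideal_Inl_Inr jet_ideal_bar(2)[OF x])
  ultimately show ?thesis using bar_bar by metis
qed

end
end

section \<open>Formal flows\<close>

definition pm_drop :: "'v \<Rightarrow> ('v \<Rightarrow>\<^sub>0 nat) \<Rightarrow> 'v \<Rightarrow>\<^sub>0 nat" where
  "pm_drop v m = m - Poly_Mapping.single v (lookup m v)"

lemma lookup_drop: "lookup (pm_drop v m) u = (if u = v then 0 else lookup m u)"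
  by (simp add: pm_drop_def lookup_minus lookup_single when_def)

lemma pm_drop_add: "pm_drop v (a + b) = pm_drop v a + pm_drop v b"
  by (rule pm_eqI) (simp add: lookup_drop lookup_add)

lemma pm_drop_single [simp]: "pm_drop v (Poly_Mapping.single v k) = 0"
  by (rule pm_eqI) (simp add: lookup_drop lookup_single when_def)

lemma pm_drop_split: "pm_drop v m + Poly_Mapping.single v (lookup m v) = m"
  by (rule pm_eqI) (simp add: lookup_drop lookup_add lookup_single when_def)

lemma pm_drop_id: "lookup m v = 0 \<Longrightarrow> pm_drop v m = m"
  by (rule pm_eqI) (auto simp: lookup_drop)

lemma derivation_power_mult:
  assumes D: "mps_derivation D"
  shows "(D ^^ a) (f * g) = (\<Sum>b\<le>a. mps_const (of_nat (a choose b)) * ((D ^^ b) f * (D ^^ (a - b)) g))"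
proof (induction a)
  case (Suc a)
  let ?t = "\<lambda>b c. (D ^^ b) f * (D ^^ c) g"
  have Dc: "D (mps_const x * h) = mps_const x * D h" for x h
    by (simp add: derivation_mult[OF D] derivation_const[OF D])
  have "(D ^^ Suc a) (f * g) = D ((D ^^ a) (f * g))" by simp
  also have "\<dots> = (\<Sum>b\<le>a. mps_const (of_nat (a choose b)) * (?t (Suc b) (a - b) + ?t b (Suc (a - b))))"
    unfolding Suc.IH derivation_sum[OF D] Dc by (simp add: derivation_mult[OF D])
  also have "\<dots> = (\<Sum>b\<le>a. mps_const (of_nat (a choose b)) * ?t (Suc b) (a - b)) +
       (\<Sum>b\<le>a. mps_const (of_nat (a choose b)) * ?t b (Suc a - b))"
    by (simp add: distrib_left sum.distrib Suc_diff_le)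
  also have "(\<Sum>b\<le>a. mps_const (of_nat (a choose b)) * ?t b (Suc a - b)) =
      (\<Sum>b\<le>Suc a. mps_const (of_nat (a choose b)) * ?t b (Suc a - b))"
    by (simp add: binomial_eq_0)
  also have "\<dots> = ?t 0 (Suc a) + (\<Sum>b\<le>a. mps_const (of_nat (a choose Suc b)) * ?t (Suc b) (a - b))"
    by (subst sum.atMost_Suc_shift) simp
  also have "(\<Sum>b\<le>a. mps_const (of_nat (a choose b)) * ?t (Suc b) (a - b)) +
      (?t 0 (Suc a) + (\<Sum>b\<le>a. mps_const (of_nat (a choose Suc b)) * ?t (Suc b) (a - b))) =
      ?t 0 (Suc a) + (\<Sum>b\<le>a. mps_const (of_nat (Suc a choose Suc b)) * ?t (Suc b) (a - b))"
    by (simp add: sum.distrib distrib_right)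
  also have "\<dots> = (\<Sum>b\<le>Suc a. mps_const (of_nat (Suc a choose b)) * ?t b (Suc a - b))"
    by (subst sum.atMost_Suc_shift) simp
  finally show ?case .
qed simp

text \<open>\<open>flow D m f\<close> is \<open>exp (t\<^sub>0 D\<^sub>0) \<dots> exp (t\<^bsub>m-1\<^esub> D\<^bsub>m-1\<^esub>) f\<close> evaluated at \<open>0\<close>.\<close>

primrec flow :: "(nat \<Rightarrow> 'v mps \<Rightarrow> 'v mps) \<Rightarrow> nat \<Rightarrow> 'v mps \<Rightarrow> nat mps" where
  "flow D 0 f = mps_const (mcoeff f 0)"
| "flow D (Suc m) f = Abs_mps (\<lambda>\<mu>. mcoeff (flow D m ((D m ^^ lookup \<mu> m) f)) (pm_drop m \<mu>) / fact (lookup \<mu> m))"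

lemma mcoeff_flow_Suc:
  "mcoeff (flow D (Suc m) f) \<mu> = mcoeff (flow D m ((D m ^^ lookup \<mu> m) f)) (pm_drop m \<mu>) / fact (lookup \<mu> m)"
  by (simp add: Abs_mps_inverse)

declare flow.simps(2) [simp del]

context
  fixes D :: "nat \<Rightarrow> 'v mps \<Rightarrow> 'v mps" assumes D: "\<And>i. mps_derivation (D i)"
begin

lemma power_add: "(D i ^^ a) (f + g) = (D i ^^ a) f + (D i ^^ a) g"
  by (induction a) (auto simp: derivation_add[OF D])

lemma power_zero: "(D i ^^ a) 0 = 0"
  by (induction a) (auto simp: derivation_0[OF D])

lemma power_eq_0: "D i f = 0 \<Longrightarrow> a > 0 \<Longrightarrow> (D i ^^ a) f = 0"
  by (cases a) (simp_all add: funpow_swap1 power_zero del: funpow.simps(2) add: funpow_Suc_right)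

lemma flow_add: "flow D m (f + g) = flow D m f + flow D m g"
proof (induction m arbitrary: f g)
  case (Suc m)
  show ?case by (rule mps_eqI) (simp add: mcoeff_flow_Suc power_add Suc.IH add_divide_distrib)
qed simp

lemma flow_const: "flow D m (mps_const c) = mps_const c"
proof (induction m)
  case (Suc m)
  show ?case
  proof (rule mps_eqI)
    fix \<mu>
    have "flow D m 0 = 0" using flow_add[of m 0 0] by (metis add.right_neutral add_left_cancel)
    moreover have "\<mu> = 0 \<longleftrightarrow> lookup \<mu> m = 0 \<and> pm_drop m \<mu> = 0"
      using pm_drop_split[of m \<mu>] by (auto simp: pm_drop_def)
    ultimately show "mcoeff (flow D (Suc m) (mps_const c)) \<mu> = mcoeff (mps_const c) \<mu>"
      using power_eq_0[OF derivation_const[OF D], of "lookup \<mu> m" m c] Suc.IH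
      by (cases "lookup \<mu> m = 0") (auto simp: mcoeff_flow_Suc mcoeff_const)
  qed
qed simp

lemma flow_0: "flow D m 0 = 0" using flow_const[of m 0] by simp

lemma flow_sum: "flow D m (sum f A) = (\<Sum>x\<in>A. flow D m (f x))"
  by (induction A rule: infinite_finite_induct) (auto simp: flow_0 flow_add)

text \<open>The exponential of a derivation is multiplicative. In the Leibniz sum the index b
  becomes the power of the last time variable in the first factor, and the factorials absorb the
  binomial coefficient.\<close>

lemma flow_mult: "flow D m (f * g) = flow D m f * flow D m g"
proof (induction m arbitrary: f g)
  case (Suc m)
  show ?case
  proof (rule mps_eqI)
    fix \<mu>
    define a where "a = lookup \<mu> m"
    define \<nu> where "\<nu> = pm_drop m \<mu>"
    let ?s = "\<lambda>k. Poly_Mapping.single m (k :: nat)"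
    let ?F = "\<lambda>b. flow D m ((D m ^^ b) f)" and ?G = "\<lambda>b. flow D m ((D m ^^ b) g)"
    have \<mu>: "\<mu> = \<nu> + ?s a" unfolding a_def \<nu>_def by (rule pm_drop_split[symmetric])
    have \<nu>m: "lookup \<nu> m = 0" by (simp add: \<nu>_def lookup_drop)
    have cf: "of_nat (a choose b) / fact a = (1 / (fact b * fact (a - b)) :: complex)" if "b \<le> a" for b
      using that by (simp add: binomial_fact)
    have "mcoeff (flow D (Suc m) (f * g)) \<mu> =
      (\<Sum>b\<le>a. of_nat (a choose b) * mcoeff (?F b * ?G (a - b)) \<nu>) / fact a"
      by (simp add: mcoeff_flow_Suc a_def[symmetric] \<nu>_def[symmetric] derivation_power_mult[OF D]
          flow_sum Suc.IH flow_const mcoeff_sum)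
    also have "\<dots> = (\<Sum>b\<le>a. \<Sum>p | fst p + snd p = \<nu>. 1 / (fact b * fact (a - b)) * (mcoeff (?F b) (fst p) * mcoeff (?G (a - b)) (snd p)))"
    proof -
      have "of_nat (a choose b) * mcoeff (?F b * ?G (a - b)) \<nu> / fact a =
         (\<Sum>p | fst p + snd p = \<nu>. 1 / (fact b * fact (a - b)) * (mcoeff (?F b) (fst p) * mcoeff (?G (a - b)) (snd p)))"
        if "b \<le> a" for b
        unfolding cf[OF that, symmetric] sum_distrib_left[symmetric] by (simp add: mcoeff_mult)
      then show ?thesis unfolding sum_divide_distrib by (intro sum.cong) auto
    qed
    also have "\<dots> = (\<Sum>(b, p)\<in>Sigma {..a} (\<lambda>_. {p. fst p + snd p = \<nu>}).
        1 / (fact b * fact (a - b)) * (mcoeff (?F b) (fst p) * mcoeff (?G (a - b)) (snd p)))"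
      by (rule sum.Sigma) auto
    also have "\<dots> = (\<Sum>q | fst q + snd q = \<mu>. mcoeff (flow D (Suc m) f) (fst q) * mcoeff (flow D (Suc m) g) (snd q))"
    proof (rule sum.reindex_bij_witness[
        where i = "\<lambda>q. (lookup (fst q) m, (pm_drop m (fst q), pm_drop m (snd q)))"
          and j = "\<lambda>(b, p). (fst p + ?s b, snd p + ?s (a - b))"])
      fix x assume "x \<in> Sigma {..a} (\<lambda>_. {p. fst p + snd p = \<nu>})"
      then obtain b p1 p2 where x: "x = (b, (p1, p2))" "b \<le> a" "p1 + p2 = \<nu>" by auto
      have "lookup p1 m + lookup p2 m = 0" using \<nu>m x(3) by (metis lookup_add)
      then have z: "lookup p1 m = 0" "lookup p2 m = 0" by auto
      have dr: "pm_drop m (p1 + ?s b) = p1" "pm_drop m (p2 + ?s (a - b)) = p2"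
        using z by (simp_all add: pm_drop_add pm_drop_id)
      have lk: "lookup (p1 + ?s b) m = b" "lookup (p2 + ?s (a - b)) m = a - b"
        using z by (simp_all add: lookup_add)
      show "(lookup (fst (case x of (b, p) \<Rightarrow> (fst p + ?s b, snd p + ?s (a - b)))) m,
          pm_drop m (fst (case x of (b, p) \<Rightarrow> (fst p + ?s b, snd p + ?s (a - b)))),
          pm_drop m (snd (case x of (b, p) \<Rightarrow> (fst p + ?s b, snd p + ?s (a - b))))) = x"
        using x(1) dr lk by simp
      have "(p1 + ?s b) + (p2 + ?s (a - b)) = (p1 + p2) + (?s b + ?s (a - b))" by (simp add: add_ac)
      also have "?s b + ?s (a - b) = ?s a" using x(2) by (simp add: single_add[symmetric])
      finally show "(case x of (b, p) \<Rightarrow> (fst p + ?s b, snd p + ?s (a - b))) \<in> {q. fst q + snd q = \<mu>}"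
        using x(1,3) \<mu> by simp
      show "mcoeff (flow D (Suc m) f) (fst (case x of (b, p) \<Rightarrow> (fst p + ?s b, snd p + ?s (a - b)))) *
          mcoeff (flow D (Suc m) g) (snd (case x of (b, p) \<Rightarrow> (fst p + ?s b, snd p + ?s (a - b)))) =
         (case x of (b, p) \<Rightarrow> 1 / (fact b * fact (a - b)) * (mcoeff (?F b) (fst p) * mcoeff (?G (a - b)) (snd p)))"
        using x(1) dr lk by (simp add: mcoeff_flow_Suc)
    next
      fix q :: "(nat \<Rightarrow>\<^sub>0 nat) \<times> (nat \<Rightarrow>\<^sub>0 nat)" assume "q \<in> {q. fst q + snd q = \<mu>}"
      then have q: "fst q + snd q = \<mu>" by simp
      have a: "lookup (fst q) m + lookup (snd q) m = a" unfolding a_def q[symmetric] by (simp add: lookup_add)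
      show "(case (lookup (fst q) m, pm_drop m (fst q), pm_drop m (snd q)) of
           (b, p) \<Rightarrow> (fst p + ?s b, snd p + ?s (a - b))) = q"
        using a by (auto simp: pm_drop_split prod_eq_iff a[symmetric])
      show "(lookup (fst q) m, pm_drop m (fst q), pm_drop m (snd q)) \<in> Sigma {..a} (\<lambda>_. {p. fst p + snd p = \<nu>})"
        using a q by (auto simp: \<nu>_def pm_drop_add[symmetric])
    qed
    finally show "mcoeff (flow D (Suc m) (f * g)) \<mu> = mcoeff (flow D (Suc m) f * flow D (Suc m) g) \<mu>"
      by (simp add: mcoeff_mult)
  qed
qed simp

lemma flow_coeff_0: "mcoeff (flow D m f) 0 = mcoeff f 0"
  by (induction m arbitrary: f) (simp_all add: mcoeff_flow_Suc pm_drop_def)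

lemma flow_hom: "finite V \<Longrightarrow> mps_hom V (flow D m)"
  by (simp add: mps_hom_def flow_const flow_add flow_mult flow_coeff_0)

lemma flow_in: "flow D m f \<in> mps_in {..<m}"
proof (induction m arbitrary: f)
  case (Suc m)
  have "keys \<mu> \<subseteq> {..<Suc m}" if "mcoeff (flow D (Suc m) f) \<mu> \<noteq> 0" for \<mu>
  proof -
    have "mcoeff (flow D m ((D m ^^ lookup \<mu> m) f)) (pm_drop m \<mu>) \<noteq> 0"
      using that by (simp add: mcoeff_flow_Suc)
    then have "keys (pm_drop m \<mu>) \<subseteq> {..<m}" using Suc.IH unfolding mps_in_def by blast
    moreover have "keys \<mu> \<subseteq> insert m (keys (pm_drop m \<mu>))"
      by (auto simp: in_keys_iff lookup_drop split: if_splits)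
    ultimately show ?thesis by auto
  qed
  then show ?case by (auto simp: mps_in_def)
qed simp

lemma flow_restrict: "m \<le> k \<Longrightarrow> mps_restrict {..<m} (flow D k f) = flow D m f"
proof (induction k arbitrary: f)
  case (Suc k)
  show ?case
  proof (cases "m = Suc k")
    case True then show ?thesis using mps_restrict_id[OF flow_in] by simp
  next
    case False
    then have mk: "m \<le> k" using Suc.prems by simp
    have "mps_restrict {..<m} (flow D (Suc k) f) = mps_restrict {..<m} (flow D k f)"
    proof (rule mps_eqI)
      fix \<mu>
      have "lookup \<mu> k = 0" if "keys \<mu> \<subseteq> {..<m}" using that mk by (auto simp: in_keys_iff)
      then show "mcoeff (mps_restrict {..<m} (flow D (Suc k) f)) \<mu> = mcoeff (mps_restrict {..<m} (flow D k f)) \<mu>"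
        by (auto simp: mcoeff_restrict mcoeff_flow_Suc pm_drop_id)
    qed
    then show ?thesis using Suc.IH[OF mk] by simp
  qed
qed (simp add: mps_restrict_empty)

text \<open>The last exponential acts on f directly, so differentiation in the last time just
  applies its derivation to f; for an earlier time the later exponentials stand in between.\<close>

lemma flow_deriv_last: "mps_deriv m (flow D (Suc m) f) = flow D (Suc m) (D m f)"
proof (rule mps_eqI)
  fix \<mu>
  let ?a = "lookup \<mu> m"
  have "lookup (\<mu> + Poly_Mapping.single m 1) m = Suc ?a" by (simp add: lookup_add)
  moreover have "pm_drop m (\<mu> + Poly_Mapping.single m 1) = pm_drop m \<mu>" unfolding pm_drop_add pm_drop_single by simp
  moreover have "of_nat (?a + 1) * (x / fact (Suc ?a)) = (x / fact ?a :: complex)" for x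
    by (simp add: field_simps del: of_nat_Suc of_nat_add)
  ultimately show "mcoeff (mps_deriv m (flow D (Suc m) f)) \<mu> = mcoeff (flow D (Suc m) (D m f)) \<mu>"
    by (simp only: mcoeff_deriv mcoeff_flow_Suc funpow_Suc_right o_apply)
qed

lemma flow_invariant: "m \<le> k \<Longrightarrow> (\<And>i. m \<le> i \<Longrightarrow> i < k \<Longrightarrow> D i f = 0) \<Longrightarrow> flow D k f = flow D m f"
proof (induction k)
  case (Suc k)
  show ?case
  proof (cases "m = Suc k")
    case False
    then have mk: "m \<le> k" using Suc.prems by simp
    have "flow D (Suc k) f = flow D k f"
    proof (rule mps_eqI)
      fix \<mu>
      show "mcoeff (flow D (Suc k) f) \<mu> = mcoeff (flow D k f) \<mu>"
      proof (cases "lookup \<mu> k = 0")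
        case True then show ?thesis by (simp add: mcoeff_flow_Suc pm_drop_id)
      next
        case nz: False
        then have "(D k ^^ lookup \<mu> k) f = 0" using Suc.prems(2)[of k] mk by (intro power_eq_0) auto
        moreover have "k \<in> keys \<mu>" using nz by (simp add: in_keys_iff)
        then have "\<not> keys \<mu> \<subseteq> {..<k}" by auto
        ultimately show ?thesis using mps_in_coeff[OF flow_in] by (simp add: mcoeff_flow_Suc flow_0)
      qed
    qed
    then show ?thesis using Suc mk by simp
  qed simp
qed simp

text \<open>The column of the Jacobian of the flow that belongs to time i.\<close>

definition col :: "nat \<Rightarrow> nat \<Rightarrow> 'v \<Rightarrow> nat mps" where
  "col m i v = mps_deriv i (flow D m (mps_var v))"

lemma flow_chain:
  assumes "finite V" "f \<in> mps_in V"
  shows "mps_deriv i (flow D m f) = (\<Sum>v\<in>V. flow D m (mps_deriv v f) * col m i v)"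
  unfolding col_def by (rule hom_chain[OF flow_hom[OF assms(1)] derivation_deriv assms(2)])

lemma col_restrict: "i < m \<Longrightarrow> m \<le> k \<Longrightarrow> mps_restrict {..<m} (col k i v) = col m i v"
  unfolding col_def by (subst mps_restrict_deriv) (auto simp: flow_restrict)

text \<open>With all times from m on set to 0 the exponentials behind time i disappear, and the
  column becomes field number i evaluated along the shorter flow.\<close>

lemma col_restrict_new:
  assumes "m \<le> i" "i < k" shows "mps_restrict {..<m} (col k i v) = flow D m (D i (mps_var v))"
proof -
  have "mps_restrict {..<m} (col k i v) = mps_restrict {..<m} (mps_restrict {..<Suc i} (col k i v))"
    using assms by (simp add: Int_absorb2 lessThan_subset_iff)
  also have "mps_restrict {..<Suc i} (col k i v) = flow D (Suc i) (D i (mps_var v))"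
    using col_restrict[of i "Suc i" k v] assms by (simp add: col_def flow_deriv_last)
  also have "mps_restrict {..<m} \<dots> = flow D m (D i (mps_var v))"
    using assms by (intro flow_restrict) simp
  finally show ?thesis .
qed

end

section \<open>Linear independence over an integral domain\<close>

text \<open>With coefficients in a domain this is independence over the field of fractions, so it
  measures generic rank without leaving the ring.\<close>

definition lin_indep :: "'i set \<Rightarrow> 'j set \<Rightarrow> ('i \<Rightarrow> 'j \<Rightarrow> 'r::comm_ring_1) \<Rightarrow> bool" where
  "lin_indep F C w \<longleftrightarrow> (\<forall>a. (\<forall>v\<in>C. (\<Sum>i\<in>F. a i * w i v) = 0) \<longrightarrow> (\<forall>i\<in>F. a i = 0))"

lemma lin_indep_cong: "(\<And>i v. i \<in> F \<Longrightarrow> v \<in> C \<Longrightarrow> w i v = w' i v) \<Longrightarrow> lin_indep F C w \<longleftrightarrow> lin_indep F C w'"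
  by (simp add: lin_indep_def)

text \<open>Fraction-free Gaussian elimination: coordinate x is cleared by cross-multiplying with a
  pivot vector, and the relation found is multiplied back by the pivot entry.\<close>

lemma lin_dep_card:
  fixes w :: "'i \<Rightarrow> 'j \<Rightarrow> 'r::idom"
  assumes "finite C" "finite F" "card C < card F"
  shows "\<not> lin_indep F C w"
  using assms
proof (induction C arbitrary: F w rule: finite_induct)
  case empty
  then obtain i where "i \<in> F" by fastforce
  then show ?case unfolding lin_indep_def by (auto intro!: exI[of _ "\<lambda>_. 1"])
next
  case (insert x C)
  show ?case
  proof (cases "\<forall>i\<in>F. w i x = 0")
    case True
    have "\<not> lin_indep F C w" using insert by simp
    then show ?thesis using True unfolding lin_indep_def by auto
  next
    case False
    then obtain k where k: "k \<in> F" "w k x \<noteq> 0" by blast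
    define w' where "w' i v = w k x * w i v - w i x * w k v" for i v
    have "\<not> lin_indep (F - {k}) C w'" using insert k by (intro insert.IH) auto
    then obtain b where b: "\<And>v. v \<in> C \<Longrightarrow> (\<Sum>i\<in>F - {k}. b i * w' i v) = 0" "\<exists>i\<in>F - {k}. b i \<noteq> 0"
      unfolding lin_indep_def by blast
    define a where "a i = (if i = k then - (\<Sum>j\<in>F - {k}. b j * w j x) else b i * w k x)" for i
    have "(\<Sum>i\<in>F. a i * w i v) = (\<Sum>i\<in>F - {k}. b i * w' i v)" for v
    proof -
      have "(\<Sum>i\<in>F. a i * w i v) = a k * w k v + (\<Sum>i\<in>F - {k}. a i * w i v)"
        using insert.prems k by (simp add: sum.remove)
      also have "(\<Sum>i\<in>F - {k}. a i * w i v) = (\<Sum>i\<in>F - {k}. b i * w k x * w i v)"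
        by (rule sum.cong) (auto simp: a_def)
      finally show ?thesis
        by (simp add: a_def w'_def right_diff_distrib sum_subtractf sum_distrib_right sum_distrib_left mult_ac)
    qed
    moreover have "(\<Sum>i\<in>F - {k}. b i * w' i x) = 0" by (intro sum.neutral) (simp add: w'_def mult.commute)
    ultimately have "\<forall>v\<in>insert x C. (\<Sum>i\<in>F. a i * w i v) = 0" using b(1) by auto
    moreover have "\<exists>i\<in>F. a i \<noteq> 0" using b(2) k by (auto simp: a_def)
    ultimately show ?thesis unfolding lin_indep_def by blast
  qed
qed

text \<open>Take the part of a relation that has lowest order in the variables outside \<open>V\<close>.\<close>

lemma lin_indep_restrict:
  fixes w :: "'i \<Rightarrow> 'j \<Rightarrow> 'v mps"
  assumes F: "finite F" and ind: "lin_indep F C (\<lambda>i v. mps_restrict V (w i v))"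
  shows "lin_indep F C w"
  unfolding lin_indep_def
proof (intro allI impI, rule ccontr)
  fix a assume rel: "\<forall>v\<in>C. (\<Sum>i\<in>F. a i * w i v) = 0" and "\<not> (\<forall>i\<in>F. a i = 0)"
  \<comment> \<open>The outer degree of a monomial, that is, its degree in the variables that the
    restriction sets to 0.\<close>
  define t where "t m = (\<Sum>u\<in>keys m - V. lookup m u)" for m :: "'v \<Rightarrow>\<^sub>0 nat"
  have t_add: "t (x + y) = t x + t y" for x y
  proof -
    have *: "t z = (\<Sum>u\<in>keys x \<union> keys y - V. lookup z u)" if "keys z \<subseteq> keys x \<union> keys y" for z
      unfolding t_def by (rule sum.mono_neutral_left) (use that in \<open>auto simp: in_keys_iff\<close>)
    show ?thesis by (subst (1 2 3) *) (auto simp: keys_add_nat lookup_add sum.distrib)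
  qed
  have t_0: "t m = 0 \<longleftrightarrow> keys m \<subseteq> V" for m by (auto simp: t_def in_keys_iff)
  have ex: "\<exists>i\<in>F. \<exists>m. mcoeff (a i) m \<noteq> 0" using \<open>\<not> (\<forall>i\<in>F. a i = 0)\<close> by (metis mps_eqI mcoeff_zero)
  define q where "q = (LEAST q. \<exists>i\<in>F. \<exists>m. mcoeff (a i) m \<noteq> 0 \<and> t m = q)"
  have "\<exists>i\<in>F. \<exists>m. mcoeff (a i) m \<noteq> 0 \<and> t m = q" unfolding q_def by (rule LeastI_ex) (use ex in blast)
  then obtain i0 m0 where i0: "i0 \<in> F" "mcoeff (a i0) m0 \<noteq> 0" "t m0 = q" by blast
  have least: "q \<le> t m" if "i \<in> F" "mcoeff (a i) m \<noteq> 0" for i m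
    unfolding q_def by (rule Least_le) (use that in blast)
  define \<tau> where "\<tau> = Abs_poly_mapping (\<lambda>u. if u \<in> V then 0 else lookup m0 u)"
  define \<nu>0 where "\<nu>0 = Abs_poly_mapping (\<lambda>u. if u \<in> V then lookup m0 u else 0)"
  have fin: "finite {u. (if u \<in> V then 0 else lookup m0 u) \<noteq> 0}" "finite {u. (if u \<in> V then lookup m0 u else 0) \<noteq> 0}"
    by (rule finite_subset[of _ "keys m0"]; auto simp: in_keys_iff split: if_splits)+
  have lk: "lookup \<tau> u = (if u \<in> V then 0 else lookup m0 u)" "lookup \<nu>0 u = (if u \<in> V then lookup m0 u else 0)" for u
    unfolding \<tau>_def \<nu>0_def using fin by (simp_all add: Abs_poly_mapping_inverse)
  have m0: "m0 = \<nu>0 + \<tau>" by (rule pm_eqI) (simp add: lookup_add lk)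
  have \<nu>0: "keys \<nu>0 \<subseteq> V" by (auto simp: in_keys_iff lk split: if_splits)
  have t\<tau>: "t \<tau> = q" using i0(3) t_0[of \<nu>0] \<nu>0 unfolding m0 t_add by simp
  \<comment> \<open>The coefficient of the monomial \<tau> in \<open>a i\<close>, as a series in the
    variables of V, where \<tau> is the outer part of a monomial of least outer degree.\<close>
  define b where "b i = Abs_mps (\<lambda>m. if keys m \<subseteq> V then mcoeff (a i) (m + \<tau>) else 0)" for i
  have b: "mcoeff (b i) m = (if keys m \<subseteq> V then mcoeff (a i) (m + \<tau>) else 0)" for i m
    by (simp add: b_def Abs_mps_inverse)
  have "(\<Sum>i\<in>F. b i * mps_restrict V (w i v)) = 0" if v: "v \<in> C" for v
  proof (rule mps_eqI)
    fix m
    show "mcoeff (\<Sum>i\<in>F. b i * mps_restrict V (w i v)) m = mcoeff 0 m"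
    proof (cases "keys m \<subseteq> V")
      case False
      have "b i \<in> mps_in V" for i by (auto simp: mps_in_def b)
      then have "(\<Sum>i\<in>F. b i * mps_restrict V (w i v)) \<in> mps_in V" by (auto intro!: mps_in_sum mps_in_mult)
      then show ?thesis using False mps_in_coeff by fastforce
    next
      case True
      have "mcoeff (b i * mps_restrict V (w i v)) m = mcoeff (a i * w i v) (m + \<tau>)" if i: "i \<in> F" for i
      proof -
        have "mcoeff (b i * mps_restrict V (w i v)) m =
          (\<Sum>p | fst p + snd p = m. mcoeff (a i) (fst p + \<tau>) * mcoeff (w i v) (snd p))"
          unfolding mcoeff_mult using True
          by (intro sum.cong) (auto simp: b mcoeff_restrict keys_add_nat)
        also have "\<dots> = (\<Sum>p \<in> (\<lambda>p. (fst p + \<tau>, snd p)) ` {p. fst p + snd p = m}. mcoeff (a i) (fst p) * mcoeff (w i v) (snd p))"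
          by (subst sum.reindex) (auto simp: inj_on_def)
        \<comment> \<open>Other factorizations contribute nothing: a monomial of \<open>a i\<close>
          already has outer degree at least q, so that of w lies in V, and \<tau> divides the
          former.\<close>
        also have "\<dots> = (\<Sum>p | fst p + snd p = m + \<tau>. mcoeff (a i) (fst p) * mcoeff (w i v) (snd p))"
        proof (rule sum.mono_neutral_left)
          show "\<forall>p\<in>{p. fst p + snd p = m + \<tau>} - (\<lambda>p. (fst p + \<tau>, snd p)) ` {p. fst p + snd p = m}.
             mcoeff (a i) (fst p) * mcoeff (w i v) (snd p) = 0"
          proof (rule ballI, rule ccontr)
            fix p assume p: "p \<in> {p. fst p + snd p = m + \<tau>} - (\<lambda>p. (fst p + \<tau>, snd p)) ` {p. fst p + snd p = m}"
              and nz: "mcoeff (a i) (fst p) * mcoeff (w i v) (snd p) \<noteq> 0"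
            have s: "fst p + snd p = m + \<tau>" using p by simp
            have "t (fst p) + t (snd p) = t m + t \<tau>" unfolding t_add[symmetric] s ..
            then have "t (fst p) + t (snd p) = q" using t\<tau> t_0[of m] True by simp
            moreover have "q \<le> t (fst p)" using least[OF i] nz by auto
            ultimately have "t (snd p) = 0" by simp
            then have sV: "keys (snd p) \<subseteq> V" by (simp add: t_0)
            have le: "lookup \<tau> u \<le> lookup (fst p) u" for u
            proof (cases "u \<in> V")
              case False
              then have "lookup (snd p) u = 0" using sV by (auto simp: in_keys_iff)
              moreover have "lookup (fst p) u + lookup (snd p) u = lookup m u + lookup \<tau> u"
                using s by (metis lookup_add)
              ultimately show ?thesis by simp
            qed (simp add: lk)
            then have f: "fst p = (fst p - \<tau>) + \<tau>" by (intro pm_eqI) (simp add: lookup_add lookup_minus)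
            then have "(fst p - \<tau> + snd p) + \<tau> = m + \<tau>" using s by (metis add.assoc add.commute)
            then have "fst p - \<tau> + snd p = m" by simp
            then have "p \<in> (\<lambda>p. (fst p + \<tau>, snd p)) ` {p. fst p + snd p = m}"
              using f by (intro image_eqI[of _ _ "(fst p - \<tau>, snd p)"]) (auto simp: prod_eq_iff)
            then show False using p by blast
          qed
        qed (auto simp: add_ac)
        finally show ?thesis by (simp add: mcoeff_mult)
      qed
      then have "mcoeff (\<Sum>i\<in>F. b i * mps_restrict V (w i v)) m = mcoeff (\<Sum>i\<in>F. a i * w i v) (m + \<tau>)"
        by (simp add: mcoeff_sum)
      then show ?thesis using rel v by simp
    qed
  qed
  then have "b i0 = 0" using ind i0(1) unfolding lin_indep_def by blast
  then have "mcoeff (b i0) \<nu>0 = 0" by simp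
  then show False using i0(2) \<nu>0 m0 by (simp add: b)
qed

section \<open>Rank of the flow along the CR fields\<close>

text \<open>In the relation that witnesses dependence the coefficient of the new vector is nonzero,
  because F is independent, and a domain allows cancelling it. The functional will be the
  differential, along the flow, of a series that vanishes there.\<close>

lemma dep_functional:
  fixes w :: "'i \<Rightarrow> 'j \<Rightarrow> 'r::idom"
  assumes F: "finite F" "j \<notin> F" and ind: "lin_indep F C w" and dep: "\<not> lin_indep (insert j F) C w"
    and l: "\<And>i. i \<in> F \<Longrightarrow> (\<Sum>v\<in>C. l v * w i v) = 0"
  shows "(\<Sum>v\<in>C. l v * w j v) = 0"
proof -
  obtain a where a: "\<forall>v\<in>C. (\<Sum>i\<in>insert j F. a i * w i v) = 0" "\<exists>i\<in>insert j F. a i \<noteq> 0"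
    using dep unfolding lin_indep_def by blast
  have aj: "a j \<noteq> 0"
  proof
    assume 0: "a j = 0"
    then have "\<forall>v\<in>C. (\<Sum>i\<in>F. a i * w i v) = 0" using a(1) F by simp
    then have "\<forall>i\<in>F. a i = 0" using ind unfolding lin_indep_def by blast
    then show False using a(2) 0 by auto
  qed
  have "0 = (\<Sum>v\<in>C. l v * (\<Sum>i\<in>insert j F. a i * w i v))" using a(1) by simp
  also have "\<dots> = (\<Sum>i\<in>insert j F. a i * (\<Sum>v\<in>C. l v * w i v))"
    unfolding sum_distrib_left by (subst sum.swap) (simp add: mult_ac)
  also have "\<dots> = a j * (\<Sum>v\<in>C. l v * w j v)" using F l by simp
  finally show ?thesis using aj by simp
qed

text \<open>Vectors in the kernel of d\<rho> are determined by their free components. This bounds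
  ranks from above by the number of free components that may be nonzero.\<close>

lemma (in pivot) lin_indep_free:
  fixes w :: "'i \<Rightarrow> nat + nat \<Rightarrow> 'w mps"
  assumes \<phi>: "mps_hom (vars N) \<phi>" and F: "finite F"
    and w: "\<And>i j. i \<in> F \<Longrightarrow> j < d \<Longrightarrow> (\<Sum>v\<in>vars N. \<phi> (mps_deriv v (\<rho> j)) * w i v) = 0"
    and ind: "lin_indep F (vars N) w"
    and z: "\<And>i v. i \<in> F \<Longrightarrow> v \<in> free - C \<Longrightarrow> w i v = 0"
  shows "lin_indep F C w"
  unfolding lin_indep_def
proof (intro allI impI)
  fix a assume a: "\<forall>v\<in>C. (\<Sum>i\<in>F. a i * w i v) = 0"
  define u where "u v = (\<Sum>i\<in>F. a i * w i v)" for v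
  have u_free: "u v = 0" if "v \<in> free" for v
  proof (cases "v \<in> C")
    case True then show ?thesis using a by (simp add: u_def)
  next
    case False then show ?thesis unfolding u_def using z that by (intro sum.neutral) auto
  qed
  have ker: "(\<Sum>v\<in>vars N. \<phi> (mps_deriv v (\<rho> j)) * u v) = 0" if j: "j < d" for j
  proof -
    have "(\<Sum>v\<in>vars N. \<phi> (mps_deriv v (\<rho> j)) * u v) = (\<Sum>i\<in>F. a i * (\<Sum>v\<in>vars N. \<phi> (mps_deriv v (\<rho> j)) * w i v))"
      unfolding u_def sum_distrib_left by (subst sum.swap) (simp add: mult_ac)
    then show ?thesis using w[OF _ j] by simp
  qed
  have "u v = 0" if v: "v \<in> vars N" for v
  proof -
    have "u v - (\<Sum>x\<in>free. u x * \<phi> (T x v)) = 0"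
      unfolding kernel_identity[OF \<phi> v, of u] using ker by (intro sum.neutral) auto
    then show ?thesis using u_free by simp
  qed
  then show "\<forall>i\<in>F. a i = 0" using ind unfolding lin_indep_def u_def by blast
qed

lemma free_Inl:
  assumes "pivot N d \<rho> (\<lambda>k. Inl (I k)) B"
  shows "pivot.free N d (\<lambda>k. Inl (I k)) = Inl ` free_idx N d I \<union> Inr ` {..<N}"
proof -
  have "pivot.free N d (\<lambda>k. Inl (I k)) = vars N - (\<lambda>k. Inl (I k)) ` {..<d}"
    by (rule pivot.free_def[OF assms])
  then show ?thesis by (auto simp: vars_def free_idx_def)
qed

lemma sum_free_Inl:
  assumes "pivot N d \<rho> (\<lambda>k. Inl (I k)) B"
  shows "(\<Sum>v\<in>pivot.free N d (\<lambda>k. Inl (I k)). h v) =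
    (\<Sum>i\<in>free_idx N d I. h (Inl i)) + (\<Sum>k<N. h (Inr k) :: 'x::comm_monoid_add)"
proof -
  have "(\<Sum>v\<in>Inl ` free_idx N d I \<union> Inr ` {..<N}. h v) =
    (\<Sum>v\<in>Inl ` free_idx N d I. h v) + (\<Sum>v\<in>Inr ` {..<N}. h v)"
    by (rule sum.union_disjoint) auto
  then show ?thesis unfolding free_Inl[OF assms] by (simp add: sum.reindex)
qed

section \<open>Alternating blocks of flows and their rank\<close>

context generic_series
begin

lemma card_free_idx: "card (free_idx N d I) = N - d" and d_le_N: "d \<le> N"
proof -
  have sub: "I ` {..<d} \<subseteq> {..<N}" using zeta.p_in by auto
  have inj: "inj_on I {..<d}" using zeta.p_inj by (auto simp: inj_on_def)
  have "card (I ` {..<d}) \<le> card {..<N}" by (rule card_mono) (use sub in auto)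
  then show "d \<le> N" by (simp add: card_image[OF inj])
  show "card (free_idx N d I) = N - d"
    unfolding free_idx_def by (subst card_Diff_subset) (use sub inj in \<open>auto simp: card_image\<close>)
qed

definition Lz :: "nat \<Rightarrow> vfield" where "Lz i = z.T (Inl i)"
definition Lw :: "nat \<Rightarrow> vfield" where "Lw i = zeta.T (Inr i)"

lemma Lz_Inr: "Lz i (Inr k) = 0" and Lw_Inl: "Lw i (Inl k) = 0"
  by (auto simp: Lz_def Lw_def z.T_def zeta.T_def intro!: sum.neutral)

lemma Lz_free: "j \<in> free_idx N d I \<Longrightarrow> Lz i (Inl j) = (if i = j then 1 else 0)"
  unfolding Lz_def by (subst z.T_free) (auto simp: free_Inl[OF z.pivot_axioms])

lemma Lw_free: "j \<in> free_idx N d I \<Longrightarrow> Lw i (Inr j) = (if i = j then 1 else 0)"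
  unfolding Lw_def by (subst zeta.T_free) (auto simp: free_Inr[OF zeta.pivot_axioms])

lemma L_in: "Lz i v \<in> series N" "Lw i v \<in> series N"
  by (simp_all add: Lz_def Lw_def z.T_in zeta.T_in)

lemma L_rho: "i \<in> free_idx N d I \<Longrightarrow> j < d \<Longrightarrow> vf_apply N (Lz i) (\<rho> j) = 0"
  "i \<in> free_idx N d I \<Longrightarrow> j < d \<Longrightarrow> vf_apply N (Lw i) (\<rho> j) = 0"
  unfolding Lz_def Lw_def
  by (auto intro!: z.T_rho zeta.T_rho simp: free_Inl[OF z.pivot_axioms] free_Inr[OF zeta.pivot_axioms])

definition n where "n = N - d"
definition enum :: "nat \<Rightarrow> nat" where
  "enum = (SOME e. bij_betw e {..<n} (free_idx N d I))"

lemma enum: "bij_betw enum {..<n} (free_idx N d I)"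
proof -
  have "\<exists>e. bij_betw e {..<n} (free_idx N d I)"
    by (rule finite_same_card_bij) (simp_all add: card_free_idx n_def)
  then show ?thesis unfolding enum_def by (rule someI_ex)
qed

lemma enum_in: "i < n \<Longrightarrow> enum i \<in> free_idx N d I"
  using enum by (auto simp: bij_betw_def)

lemma enum_surj: "j \<in> free_idx N d I \<Longrightarrow> \<exists>i<n. j = enum i"
  using enum by (auto simp: bij_betw_def)

lemma enum_inj: "i < n \<Longrightarrow> j < n \<Longrightarrow> enum i = enum j \<Longrightarrow> i = j"
  using enum by (auto simp: bij_betw_def inj_on_def)

text \<open>The parity is chosen such that block number \<open>d + 1\<close>, the last one needed, fixes \<open>Z\<close>
  (blocks have length \<open>n\<close> and are counted from \<open>0\<close>).\<close>

definition X :: "nat \<Rightarrow> vfield" where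
  "X i = (if n = 0 then 0 else if even (i div n + d) then Lz (enum (i mod n)) else Lw (enum (i mod n)))"
definition D :: "nat \<Rightarrow> (nat + nat) mps \<Rightarrow> (nat + nat) mps" where "D i = vf_apply N (X i)"

abbreviation "fl \<equiv> flow D"
abbreviation "cl \<equiv> col D"

lemma D_der: "mps_derivation (D i)" unfolding D_def by (rule derivation_vf)

lemma vf_zero: "vf_apply N 0 f = 0" by (simp add: vf_apply_def)

lemma X_Inr: "even (i div n + d) \<Longrightarrow> X i (Inr k) = 0" and X_Inl: "odd (i div n + d) \<Longrightarrow> X i (Inl k) = 0"
  by (auto simp: X_def Lz_Inr Lw_Inl)

lemma D_rho: "j < d \<Longrightarrow> D i (\<rho> j) = 0"
  unfolding D_def X_def by (auto simp: vf_zero L_rho enum_in)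

lemma flow_rho: "j < d \<Longrightarrow> fl m (\<rho> j) = 0"
  using flow_invariant[where D = D, OF D_der, of 0 m "\<rho> j"] D_rho rho_0 by simp

lemma fl_hom: "mps_hom (vars N) (fl m)" by (rule flow_hom[where D = D, OF D_der finite_vars])

lemma flow_ideal: "x \<in> ideal_of N d \<rho> \<Longrightarrow> fl m x = 0"
  unfolding ideal_of_def
  by (erule gen_ideal_hom_zero[OF _ fl_hom]) (use zeta.rho_in flow_rho in auto)

lemma flow_vf: "fl m (vf_apply N Y f) = (\<Sum>v\<in>vars N. fl m (mps_deriv v f) * fl m (Y v))"
  unfolding vf_apply_def by (simp add: flow_sum[where D = D, OF D_der] flow_mult[where D = D, OF D_der] mult.commute)

lemma col_kernel: "j < d \<Longrightarrow> (\<Sum>v\<in>vars N. fl m (mps_deriv v (\<rho> j)) * cl m i v) = 0"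
  using flow_chain[where D = D, OF D_der finite_vars zeta.rho_in, of j i m] by (simp add: flow_rho)

lemma field_kernel: 
  assumes "vf_apply N Y (\<rho> j) \<in> ideal_of N d \<rho>"
  shows "(\<Sum>v\<in>vars N. fl m (mps_deriv v (\<rho> j)) * fl m (Y v)) = 0"
  using flow_ideal[OF assms] by (simp add: flow_vf)

text \<open>The free coordinate in which field number i has entry 1.\<close>

definition coord :: "nat \<Rightarrow> nat + nat" where
  "coord i = (if even (i div n + d) then Inl (enum (i mod n)) else Inr (enum (i mod n)))"

lemma block_div: "b * n \<le> i \<Longrightarrow> i < Suc b * n \<Longrightarrow> i div n = b"
  by (metis div_nat_eqI mult.commute)

lemma coord_in: "n > 0 \<Longrightarrow> coord i \<in> vars N"
  using enum_in[of "i mod n"] by (auto simp: coord_def free_idx_def)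

text \<open>Blocks of the same type repeat the same fields, so the matrix is the identity on index
  sets where equal type forces equal block.\<close>

lemma X_coord:
  assumes n: "n > 0" and ij: "even (i div n + d) = even (j div n + d) \<Longrightarrow> i div n = j div n"
  shows "X i (coord j) = (if i = j then 1 else 0)"
proof -
  have e: "enum (i mod n) = enum (j mod n) \<longleftrightarrow> i mod n = j mod n"
    using enum_inj[of "i mod n" "j mod n"] n by auto
  have "i div n = j div n \<Longrightarrow> i mod n = j mod n \<Longrightarrow> i = j" by (metis div_mult_mod_eq)
  then show ?thesis
    using ij n e enum_in[of "j mod n"] by (auto simp: X_def coord_def Lz_Inr Lw_Inl Lz_free Lw_free)
qed

text \<open>The rank is tested with all times set to 0, where the columns are the values of the
  fields at the origin and form an identity matrix in the coordinates
  \<open>coord j\<close>.\<close>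

lemma col_indep:
  assumes F: "F \<subseteq> {..<m}"
    and c: "\<And>i j. i \<in> F \<Longrightarrow> j \<in> F \<Longrightarrow> X i (coord j) = (if i = j then 1 else 0)" and n: "n > 0"
  shows "lin_indep F (vars N) (cl m)"
proof (rule lin_indep_restrict[where V = "{..<0}"])
  show fin: "finite F" using F finite_subset by blast
  have r: "mps_restrict {..<0} (cl m i (coord j)) = (if i = j then 1 else 0)" if "i \<in> F" "j \<in> F" for i j
    using col_restrict_new[where D = D, OF D_der, of 0 i m "coord j"] F c[OF that] that coord_in[OF n, of j]
    by (auto simp: D_def vf_apply_var mps_const_simps)
  show "lin_indep F (vars N) (\<lambda>i v. mps_restrict {..<0} (cl m i v))"
    unfolding lin_indep_def
  proof (intro allI impI ballI)
    fix a j assume a: "\<forall>v\<in>vars N. (\<Sum>i\<in>F. a i * mps_restrict {..<0} (cl m i v)) = 0" and j: "j \<in> F"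
    have "0 = (\<Sum>i\<in>F. a i * mps_restrict {..<0} (cl m i (coord j)))" using a coord_in[OF n] by simp
    also have "\<dots> = (\<Sum>i\<in>F. a i * (if i = j then 1 else 0))" using r j by (intro sum.cong) auto
    also have "\<dots> = a j" by (rule sum_delta_matrix(2)[OF fin j])
    finally show "a j = 0" by simp
  qed
qed

text \<open>The algebraic form of tangency to the image of the flow: the kernel, which is the ideal
  of series vanishing on the image, is closed under the basis of (1,0) and (0,1) fields.\<close>

definition stable :: "nat \<Rightarrow> bool" where
  "stable m \<longleftrightarrow> (\<forall>f\<in>series N. fl m f = 0 \<longrightarrow> (\<forall>j\<in>free_idx N d I.
     fl m (vf_apply N (Lz j) f) = 0 \<and> fl m (vf_apply N (Lw j) f) = 0))"

lemma col_functional: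
  assumes "f \<in> series N" "fl m f = 0"
  shows "(\<Sum>v\<in>vars N. fl m (mps_deriv v f) * cl m i v) = 0"
  using flow_chain[where D = D, OF D_der finite_vars assms(1), of i m] assms(2) by simp

text \<open>The \<open>n\<close> columns of the last block are independent and lie in a space of dimension \<open>n\<close> that
  also contains the fields of this type.\<close>

lemma last_block:
  assumes f: "f \<in> series N" "fl (Suc b * n) f = 0" and j: "j \<in> free_idx N d I"
  shows "fl (Suc b * n) (vf_apply N (if even (b + d) then Lz j else Lw j) f) = 0"
proof -
  have n: "n > 0" using enum_surj[OF j] by auto
  define m where "m = Suc b * n"
  define F where "F = {b * n..<m}"
  define Y where "Y = (if even (b + d) then Lz j else Lw j)"
  \<comment> \<open>The field to be tested joins the columns under the fresh index m.\<close>
  define w where "w i = (if i = m then \<lambda>v. fl m (Y v) else cl m i)" for i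
  have Fd: "i \<in> F \<Longrightarrow> i div n = b" for i using block_div[of b i] by (simp add: F_def m_def)
  have fin: "finite F" "m \<notin> F" and cF: "card F = n" and Fm: "F \<subseteq> {..<m}" by (auto simp: F_def m_def)
  have ind: "lin_indep F (vars N) (cl m)"
    by (rule col_indep[OF Fm _ n], rule X_coord[OF n]) (simp add: Fd)
  then have indw: "lin_indep F (vars N) w"
  proof -
    have "lin_indep F (vars N) w \<longleftrightarrow> lin_indep F (vars N) (cl m)"
      by (rule lin_indep_cong) (use fin(2) in \<open>auto simp: w_def\<close>)
    then show ?thesis using ind by simp
  qed
  \<comment> \<open>The last block leaves the variables of the other type unchanged, so its columns
    vanish in those components. As all vectors lie in the kernel of d\<rho>, only n free components
    remain for n + 1 vectors.\<close>
  have inv: "cl m i v = 0" if i: "i \<in> F" and v: "\<And>i. i \<in> F \<Longrightarrow> D i (mps_var v) = 0" for i v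
  proof -
    have "fl m (mps_var v) = fl (b * n) (mps_var v)"
      by (rule flow_invariant[where D = D, OF D_der]) (use v in \<open>auto simp: F_def m_def\<close>)
    moreover have "mps_deriv i (fl (b * n) (mps_var v)) = 0"
      by (rule mps_deriv_outside[OF flow_in[where D = D, OF D_der]]) (use i in \<open>auto simp: F_def\<close>)
    ultimately show ?thesis by (simp add: col_def[where D = D, OF D_der])
  qed
  have Yk: "vf_apply N Y (\<rho> k) = 0" if "k < d" for k using L_rho[OF j that] by (simp add: Y_def)
  have ker: "(\<Sum>v\<in>vars N. fl m (mps_deriv v (\<rho> k)) * w i v) = 0" if "i \<in> insert m F" "k < d" for i k
    using col_kernel[OF that(2), of m i] field_kernel[of Y k m] Yk[OF that(2)]
    by (auto simp: w_def ideal_of_def gen_ideal.zero)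
  have "\<not> lin_indep (insert m F) (vars N) w"
  proof
    assume indm: "lin_indep (insert m F) (vars N) w"
    show False
    proof (cases "even (b + d)")
      case True
      have "w i (Inr k) = 0" if "i \<in> insert m F" "k < N" for i k
        using that inv[of i "Inr k"] True Fd X_Inr Lz_Inr fin(2)
        by (auto simp: w_def D_def vf_apply_var Y_def flow_0[where D = D, OF D_der])
      then have "lin_indep (insert m F) (Inl ` free_idx N d I) w"
        by (intro z.lin_indep_free[OF fl_hom _ ker indm])
          (use fin in \<open>auto simp: free_Inl[OF z.pivot_axioms]\<close>)
      moreover have "card (Inl ` free_idx N d I) < card (insert m F)"
        using fin cF by (simp add: card_image card_free_idx n_def)
      ultimately show False using lin_dep_card[of "Inl ` free_idx N d I" "insert m F" w] fin by simp
    next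
      case False
      have "w i (Inl k) = 0" if "i \<in> insert m F" "k < N" for i k
        using that inv[of i "Inl k"] False Fd X_Inl Lw_Inl fin(2)
        by (auto simp: w_def D_def vf_apply_var Y_def flow_0[where D = D, OF D_der])
      then have "lin_indep (insert m F) (Inr ` free_idx N d I) w"
        by (intro zeta.lin_indep_free[OF fl_hom _ ker indm])
          (use fin in \<open>auto simp: free_Inr[OF zeta.pivot_axioms]\<close>)
      moreover have "card (Inr ` free_idx N d I) < card (insert m F)"
        using fin cF by (simp add: card_image card_free_idx n_def)
      ultimately show False using lin_dep_card[of "Inr ` free_idx N d I" "insert m F" w] fin by simp
    qed
  qed
  then have "(\<Sum>v\<in>vars N. fl m (mps_deriv v f) * w m v) = 0"
    by (rule dep_functional[OF fin indw])
      (use col_functional[OF f(1), of m] f(2) fin(2) in \<open>auto simp: w_def m_def\<close>)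
  then show ?thesis by (simp add: w_def flow_vf m_def Y_def)
qed

text \<open>A column of the next block becomes, at the old times, one of its fields along the old
  flow. If none of them is independent of F, the fields of that type preserve the kernel by
  \<open>dep_functional\<close>; those of the other type do so by \<open>last_block\<close>, and the
  flow is stable.\<close>

lemma rank_grows_or_stable:
  assumes F: "F \<subseteq> {..<Suc b * n}" "lin_indep F (vars N) (cl (Suc b * n))" and st: "\<not> stable (Suc b * n)"
  shows "\<exists>i. i \<notin> F \<and> insert i F \<subseteq> {..<Suc (Suc b) * n} \<and> lin_indep (insert i F) (vars N) (cl (Suc (Suc b) * n))"
proof -
  define m where "m = Suc b * n"
  define w where "w i v = (if i < m then cl m i v else fl m (X i v))" for i v
  have fin: "finite F" using F(1) finite_subset by blast
  have indw: "lin_indep F (vars N) w"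
  proof -
    have "lin_indep F (vars N) w \<longleftrightarrow> lin_indep F (vars N) (cl m)"
      by (rule lin_indep_cong) (use F(1) in \<open>auto simp: w_def m_def\<close>)
    then show ?thesis using F(2) by (simp add: m_def)
  qed
  obtain i where i: "m \<le> i" "i < Suc (Suc b) * n" "lin_indep (insert i F) (vars N) w"
  proof (rule ccontr)
    assume "\<not> thesis"
    then have dep: "\<not> lin_indep (insert i F) (vars N) w" if "m \<le> i" "i < Suc (Suc b) * n" for i
      using that \<open>\<And>i. \<lbrakk>m \<le> i; i < Suc (Suc b) * n; lin_indep (insert i F) (vars N) w\<rbrakk> \<Longrightarrow> thesis\<close> by blast
    have "stable m" unfolding stable_def
    proof (intro ballI impI)
      fix f j assume f: "f \<in> series N" "fl m f = 0" and j: "j \<in> free_idx N d I"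
      obtain k where k: "k < n" "j = enum k" using enum_surj[OF j] by blast
      have i: "m \<le> m + k" "m + k < Suc (Suc b) * n" using k by (auto simp: m_def)
      have e: "m + k = k + Suc b * n" by (simp add: m_def)
      have "(m + k) div n = Suc b" "(m + k) mod n = k" unfolding e using k(1) by (simp_all del: mult_Suc)
      then have Xi: "X (m + k) = (if even (b + d) then Lw j else Lz j)"
        using k by (auto simp: X_def)
      have "m + k \<notin> F" using F(1) by (auto simp: m_def)
      then have "(\<Sum>v\<in>vars N. fl m (mps_deriv v f) * w (m + k) v) = 0"
        by (rule dep_functional[OF fin _ indw dep[OF i]])
          (use col_functional[OF f] F(1) in \<open>auto simp: w_def m_def\<close>)
      then have "fl m (vf_apply N (if even (b + d) then Lw j else Lz j) f) = 0"
        by (simp add: w_def flow_vf Xi)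
      moreover have "fl m (vf_apply N (if even (b + d) then Lz j else Lw j) f) = 0"
        using last_block[of f b j] f j by (simp add: m_def)
      ultimately show "fl m (vf_apply N (Lz j) f) = 0 \<and> fl m (vf_apply N (Lw j) f) = 0"
        by (cases "even (b + d)") auto
    qed
    then show False using st by (simp add: m_def)
  qed
  have "lin_indep (insert i F) (vars N) (cl (Suc (Suc b) * n))"
  proof (rule lin_indep_restrict[where V = "{..<m}"])
    have r: "mps_restrict {..<m} (cl (Suc (Suc b) * n) k v) = w k v" if "k \<in> insert i F" "v \<in> vars N" for k v
    proof (cases "k < m")
      case True
      then show ?thesis using col_restrict[where D = D, OF D_der, of k m "Suc (Suc b) * n" v] by (simp add: w_def m_def)
    next
      case False
      then have "k = i" using that F(1) by (auto simp: m_def)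
      then show ?thesis using col_restrict_new[where D = D, OF D_der i(1,2), of v] False that
        by (simp add: w_def D_def vf_apply_var)
    qed
    show "lin_indep (insert i F) (vars N) (\<lambda>k v. mps_restrict {..<m} (cl (Suc (Suc b) * n) k v))"
    proof -
      have "lin_indep (insert i F) (vars N) (\<lambda>k v. mps_restrict {..<m} (cl (Suc (Suc b) * n) k v))
          \<longleftrightarrow> lin_indep (insert i F) (vars N) w" by (rule lin_indep_cong) (rule r)
      then show ?thesis using i(3) by simp
    qed
  qed (use fin in simp)
  moreover have "i \<notin> F" using F(1) i(1) by (auto simp: m_def)
  moreover have "insert i F \<subseteq> {..<Suc (Suc b) * n}" using F(1) i(2) by auto
  ultimately show ?thesis by blast
qed

text \<open>The induction starts with two blocks: they have opposite types and hence 2n columns that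
  are independent at 0. From there each block without stability adds at least one to the
  rank.\<close>

lemma rank_or_stable:
  "(\<exists>j. 2 \<le> j \<and> j \<le> k + 2 \<and> stable (j * n)) \<or>
   (\<exists>F. F \<subseteq> {..<(k + 2) * n} \<and> card F = 2 * n + k \<and> lin_indep F (vars N) (cl ((k + 2) * n)))"
proof (induction k)
  case 0
  have "lin_indep {..<2 * n} (vars N) (cl (2 * n))"
  proof (cases "n = 0")
    case True then show ?thesis by (simp add: lin_indep_def)
  next
    case False
    have *: "i div n = 0 \<or> i div n = 1" if "i < 2 * n" for i
    proof -
      have "i div n < 2" using that by (simp add: less_mult_imp_div_less)
      then show ?thesis by auto
    qed
    show ?thesis
    proof (rule col_indep)
      fix i j assume "i \<in> {..<2 * n}" "j \<in> {..<2 * n}"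
      then have "i div n = 0 \<or> i div n = 1" "j div n = 0 \<or> j div n = 1" using * by auto
      then show "X i (coord j) = (if i = j then 1 else 0)"
        using False by (intro X_coord) auto
    qed (use False in auto)
  qed
  then have "lin_indep {..<2 * n} (vars N) (cl ((0 + 2) * n))" by (simp only: add_0)
  then show ?case by (intro disjI2 exI[of _ "{..<2 * n}"] conjI) simp_all
next
  case (Suc k)
  show ?case
  proof (cases "\<exists>j. 2 \<le> j \<and> j \<le> k + 2 \<and> stable (j * n)")
    case True
    then obtain j where "2 \<le> j" "j \<le> k + 2" "stable (j * n)" by blast
    then show ?thesis by (intro disjI1 exI[of _ j]) simp
  next
    case False
    then obtain F where F: "F \<subseteq> {..<Suc (Suc k) * n}" "card F = 2 * n + k" "lin_indep F (vars N) (cl (Suc (Suc k) * n))"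
      using Suc by auto
    have "\<not> stable (Suc (Suc k) * n)" using False by (metis add_2_eq_Suc' le_add2 order_refl)
    then obtain i where i: "i \<notin> F" "insert i F \<subseteq> {..<Suc (Suc (Suc k)) * n}"
      "lin_indep (insert i F) (vars N) (cl (Suc (Suc (Suc k)) * n))"
      using rank_grows_or_stable[OF F(1,3)] by blast
    have "finite F" using F(1) finite_subset by blast
    then have "card (insert i F) = 2 * n + Suc k" using i(1) F(2) by simp
    then show ?thesis using i by (intro disjI2 exI[of _ "insert i F"]) simp
  qed
qed

text \<open>Without stability the rank after d + 2 blocks is 2n + d = 2N - d, the number of free
  components. Every field that annihilates \<rho> then depends on the columns, so this flow is
  stable after all.\<close>

lemma stable_exists: "\<exists>k. 2 \<le> k \<and> k \<le> d + 2 \<and> stable (k * n)"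
proof (rule ccontr)
  assume no: "\<not> ?thesis"
  then obtain F where F: "F \<subseteq> {..<(d + 2) * n}" "card F = 2 * n + d" "lin_indep F (vars N) (cl ((d + 2) * n))"
    using rank_or_stable[of d] by auto
  define m where "m = (d + 2) * n"
  have fin: "finite F" "m \<notin> F" using F(1) finite_subset by (auto simp: m_def)
  have cF: "card F = card zeta.free" using F(2) zeta.card_free d_le_N by (simp add: n_def)
  have all: "fl m (vf_apply N Y f) = 0" if f: "f \<in> series N" "fl m f = 0" and Y: "\<And>k. k < d \<Longrightarrow> vf_apply N Y (\<rho> k) = 0" for f Y
  proof -
    define w where "w i = (if i = m then \<lambda>v. fl m (Y v) else cl m i)" for i
    have ind: "lin_indep F (vars N) w"
    proof -
      have "lin_indep F (vars N) w \<longleftrightarrow> lin_indep F (vars N) (cl m)"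
        by (rule lin_indep_cong) (use fin(2) in \<open>auto simp: w_def\<close>)
      then show ?thesis using F(3) by (simp add: m_def)
    qed
    have ker: "(\<Sum>v\<in>vars N. fl m (mps_deriv v (\<rho> k)) * w i v) = 0" if "k < d" for i k
      using col_kernel[OF that, of m i] field_kernel[of Y k m] Y[OF that]
      by (auto simp: w_def ideal_of_def gen_ideal.zero)
    have "\<not> lin_indep (insert m F) (vars N) w"
    proof
      assume "lin_indep (insert m F) (vars N) w"
      from zeta.lin_indep_free[OF fl_hom _ ker this, of zeta.free]
      have "lin_indep (insert m F) zeta.free w" using fin by simp
      then show False using lin_dep_card[of zeta.free "insert m F" w] fin cF by simp
    qed
    then have "(\<Sum>v\<in>vars N. fl m (mps_deriv v f) * w m v) = 0"
      by (rule dep_functional[OF fin ind])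
        (use col_functional[OF f] fin(2) in \<open>auto simp: w_def\<close>)
    then show ?thesis by (simp add: w_def flow_vf)
  qed
  have "stable m" unfolding stable_def
  proof (intro ballI impI conjI)
    fix f j assume "f \<in> series N" "fl m f = 0" "j \<in> free_idx N d I"
    then show "fl m (vf_apply N (Lz j) f) = 0" "fl m (vf_apply N (Lw j) f) = 0"
      using all[of f] L_rho[of j] by auto
  qed
  then have "2 \<le> d + 2 \<and> d + 2 \<le> d + 2 \<and> stable ((d + 2) * n)" by (simp add: m_def)
  then have "\<exists>k. 2 \<le> k \<and> k \<le> d + 2 \<and> stable (k * n)" by (rule exI[of _ "d + 2"])
  with no show False by (rule notE)
qed

end

section \<open>Finite type and determination by jets\<close>

lemma vf_apply_bracket: "vf_apply N (vf_bracket N X Y) f = vf_apply N X (vf_apply N Y f) - vf_apply N Y (vf_apply N X f)"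
proof -
  have comp: "vf_apply N X (vf_apply N Y f) = (\<Sum>v\<in>vars N. vf_apply N X (Y v) * mps_deriv v f) +
     (\<Sum>v\<in>vars N. \<Sum>u\<in>vars N. X u * Y v * mps_deriv u (mps_deriv v f))" for X Y
  proof -
    have "vf_apply N X (vf_apply N Y f) = (\<Sum>v\<in>vars N. vf_apply N X (Y v) * mps_deriv v f + Y v * vf_apply N X (mps_deriv v f))"
      unfolding vf_apply_def[of N Y] by (simp add: derivation_sum[OF derivation_vf] derivation_mult[OF derivation_vf])
    then show ?thesis by (simp add: sum.distrib vf_apply_def[of N X "mps_deriv _ f"] sum_distrib_left mult_ac)
  qed
  have "(\<Sum>v\<in>vars N. \<Sum>u\<in>vars N. X u * Y v * mps_deriv u (mps_deriv v f)) =
      (\<Sum>v\<in>vars N. \<Sum>u\<in>vars N. Y u * X v * mps_deriv u (mps_deriv v f))"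
    by (subst sum.swap) (simp add: mps_deriv_commute mult.commute)
  moreover have "vf_apply N (vf_bracket N X Y) f = (\<Sum>v\<in>vars N. (vf_apply N X (Y v) - vf_apply N Y (X v)) * mps_deriv v f)"
    unfolding vf_apply_def[of N "vf_bracket N X Y"] by (simp add: vf_bracket_def)
  ultimately show ?thesis unfolding comp by (simp add: left_diff_distrib sum_subtractf)
qed

lemma sum_fun_apply: "(\<Sum>i\<in>A. f i) x = (\<Sum>i\<in>A. f i x :: 'a::comm_monoid_add)"
  by (induction A rule: infinite_finite_induct) auto

text \<open>A vector of S outside G would extend a basis of G to an independent set that is larger
  than S but contained in its span. Finite type enters in this form: a dimension count becomes
  membership.\<close>

lemma span_eq_of_card:
  assumes S: "finite S" "G \<subseteq> cvec.span S" "card S \<le> cvec.dim G" and G: "cvec.subspace G"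
  shows "S \<subseteq> G"
proof -
  obtain B where B: "B \<subseteq> G" "cvec.independent B" "G \<subseteq> cvec.span B" "card B = cvec.dim G"
    by (rule cvec.basis_exists)
  have BS: "B \<subseteq> cvec.span S" using B(1) S(2) by blast
  have fB: "finite B" using cvec.independent_span_bound[OF S(1) B(2) BS] by simp
  have "S \<subseteq> cvec.span B"
  proof (rule subsetI, rule ccontr)
    fix x assume x: "x \<in> S" "x \<notin> cvec.span B"
    have "cvec.independent (insert x B)" using B(2) x(2) by (rule cvec.independent_insertI[rotated])
    moreover have "insert x B \<subseteq> cvec.span S" using BS x(1) by (auto intro: cvec.span_base)
    ultimately have "card (insert x B) \<le> card S" using cvec.independent_span_bound[OF S(1)] by blast
    moreover have "x \<notin> B" using x(2) by (auto intro: cvec.span_base)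
    ultimately show False using fB S(3) B(4) by simp
  qed
  also have "\<dots> \<subseteq> G" using B(1) G by (rule cvec.span_minimal)
  finally show ?thesis .
qed

lemma mps_zero_if_words:
  assumes "\<And>w. set w \<subseteq> V \<Longrightarrow> mcoeff (foldr mps_deriv w f) 0 = 0" "f \<in> mps_in V"
  shows "f = 0"
proof -
  have "mcoeff f m = 0" if "\<And>w. set w \<subseteq> V \<Longrightarrow> mcoeff (foldr mps_deriv w f) 0 = 0" "f \<in> mps_in V" for f m
    using that
  proof (induction "pm_deg m" arbitrary: f m)
    case 0
    then show ?case using "0.prems"(1)[of "[]"] by simp
  next
    case (Suc k)
    show ?case
    proof (rule ccontr)
      assume nz: "mcoeff f m \<noteq> 0"
      then have mV: "keys m \<subseteq> V" using Suc.prems(2) mps_in_coeff by blast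
      have "m \<noteq> 0" using Suc.hyps(2) by auto
      then obtain v where v: "lookup m v > 0" by (metis gr0I lookup_zero pm_eqI)
      then have vV: "v \<in> V" using mV by (auto simp: in_keys_iff)
      have m: "Poly_Mapping.single v 1 + (m - Poly_Mapping.single v 1) = m" by (rule pm_add_diff_single[OF v])
      have "pm_deg m = 1 + pm_deg (m - Poly_Mapping.single v 1)"
        by (subst m[symmetric]) (simp only: pm_deg_add pm_deg_single)
      then have "k = pm_deg (m - Poly_Mapping.single v 1)" using Suc.hyps(2) by simp
      then have "mcoeff (mps_deriv v f) (m - Poly_Mapping.single v 1) = 0"
      proof (rule Suc.hyps(1))
        fix w assume "set w \<subseteq> V"
        then have "set (w @ [v]) \<subseteq> V" using vV by simp
        from Suc.prems(1)[OF this] show "mcoeff (foldr mps_deriv w (mps_deriv v f)) 0 = 0" by simp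
      qed (use Suc.prems(2) in auto)
      moreover have "mcoeff (mps_deriv v f) (m - Poly_Mapping.single v 1) =
          of_nat (lookup (m - Poly_Mapping.single v 1) v + 1) * mcoeff f m"
        using m by (simp only: mcoeff_deriv add.commute)
      ultimately have "of_nat (lookup (m - Poly_Mapping.single v 1) v + 1) = (0 :: complex)" using nz by simp
      then show False by (simp only: of_nat_eq_0_iff)
    qed
  qed
  then show ?thesis using assms by (intro mps_eqI) auto
qed

section \<open>The Lie algebra of the CR fields along a stable flow\<close>

context generic_series
begin

context
  fixes M m
  assumes M: "formal_submanifold N d M" "\<rho> \<in> M" and st: "stable m"
begin

text \<open>Along the flow the ideal of M becomes zero, so a (1,0) or (0,1) field equals there the
  combination of the basis fields of its type given by its free components.\<close>

lemma stable_tangent: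
  assumes Y: "Y \<in> tangent_10 N d M \<union> tangent_01 N d M" and f: "f \<in> series N" "fl m f = 0"
  shows "fl m (vf_apply N Y f) = 0"
proof -
  have Yt: "tangential N (ideal_of N d \<rho>) Y"
    using Y tangent_fields_tangential[OF M] by (auto simp: tangent_10_def tangent_01_def)
  have "\<rho> j \<in> ideal_of N d \<rho>" if "j < d" for j using that by (auto simp: ideal_of_def intro: gen_ideal.gen)
  then have r: "(\<Sum>v\<in>vars N. fl m (mps_deriv v (\<rho> j)) * fl m (Y v)) = 0" if "j < d" for j
    using Yt that by (intro field_kernel) (auto simp: tangential_def)
  show ?thesis
  proof (cases "Y \<in> tangent_01 N d M")
    case True
    then have Y0: "Y (Inl k) = 0" if "k < N" for k using that by (simp add: tangent_01_def)
    have "fl m (Y u) = (\<Sum>i\<in>free_idx N d I. fl m (Y (Inr i)) * fl m (Lw i u))" if u: "u \<in> vars N" for u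
    proof -
      have "fl m (Y u) - (\<Sum>v\<in>zeta.free. fl m (Y v) * fl m (zeta.T v u)) = 0"
        unfolding zeta.kernel_identity[OF fl_hom u, where w = "\<lambda>v. fl m (Y v)"] using r by (auto intro!: sum.neutral)
      then show ?thesis by (simp add: sum_free_Inr[OF zeta.pivot_axioms] Y0 hom_0[OF fl_hom] Lw_def)
    qed
    then have "fl m (vf_apply N Y f) = (\<Sum>u\<in>vars N. fl m (mps_deriv u f) * (\<Sum>i\<in>free_idx N d I. fl m (Y (Inr i)) * fl m (Lw i u)))"
      unfolding flow_vf by (intro sum.cong) auto
    also have "\<dots> = (\<Sum>i\<in>free_idx N d I. fl m (Y (Inr i)) * fl m (vf_apply N (Lw i) f))"
      unfolding flow_vf sum_distrib_left by (subst sum.swap) (simp add: mult_ac)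
    also have "\<dots> = 0" using st f by (auto simp: stable_def intro!: sum.neutral)
    finally show ?thesis .
  next
    case False
    then have Y0: "Y (Inr k) = 0" if "k < N" for k using Y that by (simp add: tangent_10_def)
    have "fl m (Y u) = (\<Sum>i\<in>free_idx N d I. fl m (Y (Inl i)) * fl m (Lz i u))" if u: "u \<in> vars N" for u
    proof -
      have "fl m (Y u) - (\<Sum>v\<in>z.free. fl m (Y v) * fl m (z.T v u)) = 0"
        unfolding z.kernel_identity[OF fl_hom u, where w = "\<lambda>v. fl m (Y v)"] using r by (auto intro!: sum.neutral)
      then show ?thesis by (simp add: sum_free_Inl[OF z.pivot_axioms] Y0 hom_0[OF fl_hom] Lz_def)
    qed
    then have "fl m (vf_apply N Y f) = (\<Sum>u\<in>vars N. fl m (mps_deriv u f) * (\<Sum>i\<in>free_idx N d I. fl m (Y (Inl i)) * fl m (Lz i u)))"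
      unfolding flow_vf by (intro sum.cong) auto
    also have "\<dots> = (\<Sum>i\<in>free_idx N d I. fl m (Y (Inl i)) * fl m (vf_apply N (Lz i) f))"
      unfolding flow_vf sum_distrib_left by (subst sum.swap) (simp add: mult_ac)
    also have "\<dots> = 0" using st f by (auto simp: stable_def intro!: sum.neutral)
    finally show ?thesis .
  qed
qed

text \<open>An invariant of the generated Lie algebra. The last clause is the aim and passes to
  brackets because it says that a subspace is preserved. The first confines the values at 0 to the
  kernel of d\<rho>, and the second makes them vanish outside \<open>vars N\<close>, as the
  dimension count requires.\<close>

definition good :: "vfield \<Rightarrow> bool" where
  "good Y \<longleftrightarrow> tangential N (ideal_of N d \<rho>) Y \<and> (\<forall>v. v \<notin> vars N \<longrightarrow> Y v = 0) \<and>
     (\<forall>f\<in>series N. fl m f = 0 \<longrightarrow> fl m (vf_apply N Y f) = 0)"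

lemma good_lie_algebra: "Y \<in> CR_lie_algebra N d M \<Longrightarrow> good Y"
  unfolding CR_lie_algebra_def
proof (induction rule: lie_algebra_generated.induct)
  case (gen Y)
  obtain k c Z where Z: "Y = (\<lambda>v. \<Sum>i<k. c i * Z i v)" "\<And>i. i < (k::nat) \<Longrightarrow> c i \<in> series N"
    "\<And>i. i < k \<Longrightarrow> Z i \<in> tangent_10 N d M \<union> tangent_01 N d M"
    by (rule CR_fields_cases[OF gen], rule that)
  have Zt: "i < k \<Longrightarrow> Z i \<in> tangent_fields N d M" for i using Z(3)[of i] by (auto simp: tangent_10_def tangent_01_def)
  have "tangential N (ideal_of N d \<rho>) Y" unfolding Z(1) ideal_of_def
    by (rule tangential_sum) (use Z(2) tangent_fields_tangential[OF M Zt] in \<open>auto simp: ideal_of_def\<close>)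
  moreover have "Y v = 0" if "v \<notin> vars N" for v
    using Zt that unfolding Z(1) by (auto simp: tangent_fields_def tuples_def intro!: sum.neutral)
  moreover have "fl m (vf_apply N Y f) = 0" if "f \<in> series N" "fl m f = 0" for f
    unfolding Z(1) vf_apply_sum using stable_tangent[OF Z(3) that]
    by (simp add: flow_sum[where D = D, OF D_der] flow_mult[where D = D, OF D_der])
  ultimately show ?case by (auto simp: good_def)
next
  case zero
  have "vf_apply N (\<lambda>_. 0) f = 0" for f by (simp add: vf_apply_def)
  then show ?case by (auto simp: zero_fun_def good_def tangential_def ideal_of_def gen_ideal.zero hom_0[OF fl_hom])
next
  case (add X Y)
  have "vf_apply N (\<lambda>v. X v + Y v) f = vf_apply N X f + vf_apply N Y f" for f
    by (simp add: vf_apply_def distrib_right sum.distrib)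
  then show ?case using add.IH
    by (auto simp: plus_fun_def good_def tangential_def ideal_of_def flow_add[where D = D, OF D_der] intro: gen_ideal.add)
next
  case (scale X c)
  have "vf_apply N (\<lambda>v. mps_const c * X v) f = mps_const c * vf_apply N X f" for f by (rule vf_apply_linear)
  then show ?case using scale.IH
    by (auto simp: good_def tangential_def ideal_of_def flow_mult[where D = D, OF D_der] intro!: gen_ideal.mult mps_in_mult)
next
  case (bracket X Y)
  have ser: "X v \<in> series N" "Y v \<in> series N" for v using bracket.IH by (auto simp: good_def tangential_def)
  have ap: "f \<in> series N \<Longrightarrow> vf_apply N X f \<in> series N" "f \<in> series N \<Longrightarrow> vf_apply N Y f \<in> series N" for f
    using ser by (auto intro: vf_apply_in)
  have "vf_bracket N X Y v \<in> series N" for v unfolding vf_bracket_def using ser ap by auto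
  moreover have "vf_apply N (vf_bracket N X Y) f \<in> ideal_of N d \<rho>" if "f \<in> ideal_of N d \<rho>" for f
    unfolding vf_apply_bracket using that bracket.IH
    by (auto simp: good_def tangential_def ideal_of_def intro!: gen_ideal_diff)
  moreover have "vf_bracket N X Y v = 0" if "v \<notin> vars N" for v
    using that bracket.IH by (simp add: vf_bracket_def good_def derivation_0[OF derivation_vf])
  moreover have "fl m (vf_apply N (vf_bracket N X Y) f) = 0" if "f \<in> series N" "fl m f = 0" for f
    unfolding vf_apply_bracket using that bracket.IH ap
    by (simp add: hom_diff[OF fl_hom] good_def)
  ultimately show ?case by (auto simp: good_def tangential_def)
qed

text \<open>The values at 0 of the Lie algebra lie in the span of the 2N - d vectors
  \<open>zeta.T v\<close> at 0. Finite type says that they have this dimension, so each of these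
  vectors is attained.\<close>

lemma at0_lie_algebra:
  assumes ft: "finite_type N d M" and v: "v \<in> zeta.free"
  shows "\<exists>Y\<in>CR_lie_algebra N d M. \<forall>u. mcoeff (Y u) 0 = mcoeff (zeta.T v u) 0"
proof -
  define t where "t v = (\<lambda>u. mcoeff (zeta.T v u) 0)" for v
  define G where "G = fields_at0 (CR_lie_algebra N d M)"
  have G_iff: "x \<in> G \<longleftrightarrow> (\<exists>Y\<in>CR_lie_algebra N d M. x = (\<lambda>u. mcoeff (Y u) 0))" for x
    unfolding G_def fields_at0_def mps_at0_def by auto
  have sub: "cvec.subspace G"
  proof (rule cvec.subspaceI)
    have "0 = (\<lambda>u. mcoeff ((0 :: vfield) u) 0)" by auto
    then show "0 \<in> G" unfolding G_iff CR_lie_algebra_def using lie_algebra_generated.zero by blast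
  next
    fix x y assume "x \<in> G" "y \<in> G"
    then obtain X Y where XY: "X \<in> CR_lie_algebra N d M" "x = (\<lambda>u. mcoeff (X u) 0)"
      "Y \<in> CR_lie_algebra N d M" "y = (\<lambda>u. mcoeff (Y u) 0)" unfolding G_iff by blast
    then have "x + y = (\<lambda>u. mcoeff ((X + Y) u) 0)" by auto
    moreover have "X + Y \<in> CR_lie_algebra N d M"
      using XY unfolding CR_lie_algebra_def by (intro lie_algebra_generated.add)
    ultimately show "x + y \<in> G" unfolding G_iff by blast
  next
    fix c x assume "x \<in> G"
    then obtain X where X: "X \<in> CR_lie_algebra N d M" "x = (\<lambda>u. mcoeff (X u) 0)" unfolding G_iff by blast
    then have "cvec_scale c x = (\<lambda>u. mcoeff (mps_const c * X u) 0)" by (auto simp: cvec_scale_def)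
    moreover have "(\<lambda>v. mps_const c * X v) \<in> CR_lie_algebra N d M"
      using X(1) unfolding CR_lie_algebra_def by (rule lie_algebra_generated.scale)
    ultimately show "cvec_scale c x \<in> G" unfolding G_iff
      by (intro bexI[of _ "\<lambda>v. mps_const c * X v"])
  qed
  have span: "G \<subseteq> cvec.span (t ` zeta.free)"
  proof
    fix x assume "x \<in> G"
    then obtain Y where Y: "Y \<in> CR_lie_algebra N d M" "x = (\<lambda>u. mcoeff (Y u) 0)" unfolding G_iff by blast
    have gY: "good Y" by (rule good_lie_algebra[OF Y(1)])
    have "x u = (\<Sum>v\<in>zeta.free. cvec_scale (x v) (t v)) u" for u
    proof (cases "u \<in> vars N")
      case False
      then have "(\<Sum>v\<in>zeta.free. x v * t v u) = 0"
        by (intro sum.neutral) (auto simp: t_def zeta.T_outside zeta.free_vars)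
      then show ?thesis using False gY Y(2)
        by (simp add: good_def sum_fun_apply cvec_scale_def)
    next
      case True
      have "\<rho> j \<in> ideal_of N d \<rho>" if "j < d" for j using that by (auto simp: ideal_of_def intro: gen_ideal.gen)
      then have "vf_apply N Y (\<rho> j) \<in> ideal_of N d \<rho>" if "j < d" for j
        using gY that by (auto simp: good_def tangential_def)
      then have r0: "mcoeff (\<Sum>v\<in>vars N. mps_deriv v (\<rho> j) * Y v) 0 = 0" if "j < d" for j
        using ideal_of_0[of d \<rho> "vf_apply N Y (\<rho> j)" N] rho_0 that by (simp add: vf_apply_def mult.commute)
      have "mcoeff (Y u - (\<Sum>v\<in>zeta.free. Y v * zeta.T v u)) 0 = 0"
        unfolding zeta.kernel_identity[OF id_hom[OF finite_vars] True, of Y] mcoeff_sum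
        using r0 by (intro sum.neutral) (auto simp: mcoeff_sum[of _ "{..<d}"])
      then show ?thesis using Y(2) by (simp add: mcoeff_sum sum_fun_apply cvec_scale_def t_def)
    qed
    then have "x = (\<Sum>v\<in>zeta.free. cvec_scale (x v) (t v))" by (rule ext)
    also have "\<dots> \<in> cvec.span (t ` zeta.free)"
      by (intro cvec.span_sum cvec.span_scale cvec.span_base) auto
    finally show "x \<in> cvec.span (t ` zeta.free)" .
  qed
  have "card (t ` zeta.free) \<le> card zeta.free" by (rule card_image_le) simp
  also have "\<dots> = cvec.dim G" using ft zeta.card_free by (simp add: finite_type_def G_def)
  finally have "t ` zeta.free \<subseteq> G" by (intro span_eq_of_card[OF _ span _ sub]) auto
  then have "t v \<in> G" using v by blast
  then show ?thesis unfolding G_iff t_def fun_eq_iff by metis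
qed

text \<open>The chosen members of the Lie algebra match the \<open>zeta.T v\<close> at the origin
  only. Along the flow they are combinations of them with a coefficient matrix W that is the
  identity at 0; inverting it transfers the stability of the kernel to the
  \<open>zeta.T v\<close>.\<close>

lemma stable_T:
  assumes ft: "finite_type N d M" and f: "f \<in> series N" "fl m f = 0" and x: "x \<in> zeta.free"
  shows "fl m (vf_apply N (zeta.T x) f) = 0"
proof -
  have "\<forall>v\<in>zeta.free. \<exists>Y. Y \<in> CR_lie_algebra N d M \<and> (\<forall>u. mcoeff (Y u) 0 = mcoeff (zeta.T v u) 0)"
    using at0_lie_algebra[OF ft] by blast
  from bchoice[OF this] obtain Y where Y: "\<And>v. v \<in> zeta.free \<Longrightarrow> Y v \<in> CR_lie_algebra N d M"
    "\<And>v u. v \<in> zeta.free \<Longrightarrow> mcoeff (Y v u) 0 = mcoeff (zeta.T v u) 0" by blast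
  define A where "A v = fl m (vf_apply N (zeta.T v) f)" for v
  define W where "W v u = fl m (Y v u)" for v u
  have gY: "v \<in> zeta.free \<Longrightarrow> good (Y v)" for v using good_lie_algebra[OF Y(1)] .
  have WA: "(\<Sum>u\<in>zeta.free. W v u * A u) = 0" if v: "v \<in> zeta.free" for v
  proof -
    have "\<rho> j \<in> ideal_of N d \<rho>" if "j < d" for j using that by (auto simp: ideal_of_def intro: gen_ideal.gen)
    then have r: "(\<Sum>u\<in>vars N. fl m (mps_deriv u (\<rho> j)) * W v u) = 0" if "j < d" for j
      using gY[OF v] that unfolding W_def by (intro field_kernel) (auto simp: good_def tangential_def)
    have "W v u = (\<Sum>x\<in>zeta.free. W v x * fl m (zeta.T x u))" if u: "u \<in> vars N" for u
    proof -
      have "W v u - (\<Sum>x\<in>zeta.free. W v x * fl m (zeta.T x u)) = 0"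
        unfolding zeta.kernel_identity[OF fl_hom u, where w = "W v"] using r by (auto intro!: sum.neutral)
      then show ?thesis by simp
    qed
    then have "fl m (vf_apply N (Y v) f) =
        (\<Sum>u\<in>vars N. fl m (mps_deriv u f) * (\<Sum>x\<in>zeta.free. W v x * fl m (zeta.T x u)))"
      unfolding flow_vf W_def by (intro sum.cong) auto
    also have "\<dots> = (\<Sum>x\<in>zeta.free. W v x * A x)"
      unfolding A_def flow_vf sum_distrib_left by (subst sum.swap) (simp add: mult_ac)
    finally show ?thesis using gY[OF v] f by (simp add: good_def)
  qed
  have W0: "mcoeff (W j k) 0 = (if j = k then 1 else 0)" if "j \<in> zeta.free" "k \<in> zeta.free" for j k
    unfolding W_def flow_coeff_0[where D = D, OF D_der] Y(2)[OF that(1)] using zeta.T_free[OF that(2), of j] by auto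
  obtain B where B: "\<And>i j. i \<in> zeta.free \<Longrightarrow> j \<in> zeta.free \<Longrightarrow> B i j \<in> mps_in UNIV"
    "\<And>i k. i \<in> zeta.free \<Longrightarrow> k \<in> zeta.free \<Longrightarrow> (\<Sum>j\<in>zeta.free. B i j * W j k) = (if i = k then 1 else 0)"
    by (rule matrix_left_inverse[of zeta.free W UNIV]) (use W0 in auto)
  have "0 = (\<Sum>v\<in>zeta.free. B x v * (\<Sum>u\<in>zeta.free. W v u * A u))" using WA by simp
  also have "\<dots> = (\<Sum>u\<in>zeta.free. (\<Sum>v\<in>zeta.free. B x v * W v u) * A u)"
    unfolding sum_distrib_left sum_distrib_right by (subst sum.swap) (simp add: mult.assoc)
  also have "\<dots> = (\<Sum>u\<in>zeta.free. (if x = u then 1 else 0) * A u)"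
    using B(2)[OF x] by (intro sum.cong) auto
  also have "\<dots> = A x" using sum_delta_matrix(1)[OF _ x, of A] by simp
  finally show ?thesis by (simp add: A_def)
qed

text \<open>The fields \<open>zeta.T (Inl j)\<close> act on series in Z as ordinary derivatives, so
  all Z-derivatives stay in the kernel, and elements of the kernel vanish at 0.\<close>

lemma stable_zero:
  assumes ft: "finite_type N d M" and f: "f \<in> mps_in (Inl ` {..<N})" "fl m f = 0"
  shows "f = 0"
proof (rule mps_zero_if_words[OF _ f(1)])
  have w: "fl m (foldr mps_deriv w f) = 0" if "set w \<subseteq> Inl ` {..<N}" for w
    using that
  proof (induction w)
    case (Cons v w)
    then obtain j where j: "v = Inl j" "j < N" by auto
    have in1: "foldr mps_deriv w f \<in> mps_in (Inl ` {..<N})" by (rule foldr_deriv_in[OF f(1)])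
    have "fl m (vf_apply N (zeta.T (Inl j)) (foldr mps_deriv w f)) = 0"
      by (rule stable_T[OF ft Inl_series[OF in1]])
        (use Cons j in \<open>auto simp: free_Inr[OF zeta.pivot_axioms]\<close>)
    then show ?case using zeta_T_Inl[OF j(2) in1] j by simp
  qed (use f in simp)
  fix w :: "(nat + nat) list" assume "set w \<subseteq> Inl ` {..<N}"
  from w[OF this] show "mcoeff (foldr mps_deriv w f) 0 = 0"
    using flow_coeff_0[where D = D, OF D_der, of m "foldr mps_deriv w f"] by simp
qed

end

section \<open>Propagation of vanishing jets through the blocks\<close>

context
  fixes N' l :: nat and \<delta> :: "nat + nat \<Rightarrow> (nat + nat) mps"
  assumes dInl: "\<And>k. \<delta> (Inl k) \<in> mps_in (Inl ` {..<N})" and dInr: "\<And>k. \<delta> (Inr k) \<in> mps_in (Inr ` {..<N})"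
    and dbar: "\<And>k. mps_bar (\<delta> (Inl k)) = \<delta> (Inr k)" "\<And>k. mps_bar (\<delta> (Inr k)) = \<delta> (Inl k)"
    and refl: "\<And>k. k < N' \<Longrightarrow> \<delta> (Inl k) \<in> jet_ideal N d \<rho> Inr N' \<delta> l"
    and jet: "\<And>w k. length w \<le> (d + 1) * l \<Longrightarrow> k < N' \<Longrightarrow> mcoeff (foldr mps_deriv (map Inl w) (\<delta> (Inl k))) 0 = 0"
      "\<And>w k. length w \<le> (d + 1) * l \<Longrightarrow> k < N' \<Longrightarrow> mcoeff (foldr mps_deriv (map Inr w) (\<delta> (Inr k))) 0 = 0"
begin

lemma kill_gens:
  assumes \<iota>: "\<iota> = Inl \<or> \<iota> = Inr" and k: "\<And>g. g \<in> jets \<iota> N' \<delta> r \<Longrightarrow> fl m g = 0" and x: "x \<in> jet_ideal N d \<rho> \<iota> N' \<delta> r"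
  shows "fl m x = 0"
  using x unfolding jet_ideal_def
proof (rule gen_ideal_hom_zero[OF _ fl_hom])
  show "\<rho> ` {..<d} \<union> jets \<iota> N' \<delta> r \<subseteq> series N"
    using \<iota> zeta.rho_in Inl_series[OF dInl] Inr_series[OF dInr] by (auto simp: jets_def intro!: foldr_deriv_in)
qed (use k flow_rho in auto)

lemma block_fixes:
  shows "even (b + d) \<Longrightarrow> f \<in> mps_in (Inr ` {..<N}) \<Longrightarrow> fl (Suc b * n) f = fl (b * n) f"
    and "odd (b + d) \<Longrightarrow> f \<in> mps_in (Inl ` {..<N}) \<Longrightarrow> fl (Suc b * n) f = fl (b * n) f"
proof -
  have b: "i div n = b" if "b * n \<le> i" "i < Suc b * n" for i using block_div[OF that] .
  show "fl (Suc b * n) f = fl (b * n) f" if "even (b + d)" "f \<in> mps_in (Inr ` {..<N})"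
  proof (rule flow_invariant[where D = D, OF D_der])
    fix i assume i: "b * n \<le> i" "i < Suc b * n"
    have "mps_deriv (Inl k) f = 0" for k by (rule mps_deriv_outside[OF that(2)]) auto
    then show "D i f = 0" using X_Inr[of i] b[OF i] that(1) by (simp add: D_def vf_apply_def sum_vars)
  qed simp
  show "fl (Suc b * n) f = fl (b * n) f" if "odd (b + d)" "f \<in> mps_in (Inl ` {..<N})"
  proof (rule flow_invariant[where D = D, OF D_der])
    fix i assume i: "b * n \<le> i" "i < Suc b * n"
    have "mps_deriv (Inr k) f = 0" for k by (rule mps_deriv_outside[OF that(2)]) auto
    then show "D i f = 0" using X_Inl[of i] b[OF i] that(1) by (simp add: D_def vf_apply_def sum_vars)
  qed simp
qed

lemma jets_in: "g \<in> jets Inl N' \<delta> r \<Longrightarrow> g \<in> mps_in (Inl ` {..<N})" "g \<in> jets Inr N' \<delta> r \<Longrightarrow> g \<in> mps_in (Inr ` {..<N})"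
  using dInl dInr by (auto simp: jets_def intro!: foldr_deriv_in)

lemma jets_sub: "g \<in> jets \<iota> N' \<delta> r \<Longrightarrow> g \<in> jet_ideal N d \<rho> \<iota> N' \<delta> r"
  unfolding jet_ideal_def by (intro gen_ideal.gen UnI2)

text \<open>A block that moves Z leaves the jets of the conjugate in \<zeta> unchanged, so these
  still vanish up to the old order r + l; the exchange of jets then gives the jets of h up to order
  r. Blocks that move \<zeta> are symmetric, so each block costs l.\<close>

lemma kill_blocks:
  assumes "k \<le> d + 1"
  shows "(\<forall>x\<in>jet_ideal N d \<rho> Inl N' \<delta> ((d + 1 - k) * l). fl (k * n) x = 0) \<and>
         (\<forall>x\<in>jet_ideal N d \<rho> Inr N' \<delta> ((d + 1 - k) * l). fl (k * n) x = 0)"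
  using assms
proof (induction k)
  case 0
  show ?case
    by (intro conjI ballI; rule kill_gens) (use jet in \<open>auto simp: jets_def\<close>)
next
  case (Suc b)
  define r where "r = (d + 1 - Suc b) * l"
  have rl: "(d + 1 - b) * l = r + l"
  proof -
    have "d + 1 - b = Suc (d + 1 - Suc b)" using Suc.prems by simp
    then show ?thesis by (simp add: r_def)
  qed
  have IH: "x \<in> jet_ideal N d \<rho> Inl N' \<delta> (r + l) \<Longrightarrow> fl (b * n) x = 0"
    "x \<in> jet_ideal N d \<rho> Inr N' \<delta> (r + l) \<Longrightarrow> fl (b * n) x = 0" for x
    using Suc unfolding rl by auto
  show ?case
  proof (cases "even (b + d)")
    case True
    have k: "fl (Suc b * n) x = 0" if "x \<in> jet_ideal N d \<rho> Inr N' \<delta> (r + l)" for x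
      by (rule kill_gens[OF _ _ that])
        (use block_fixes(1)[OF True jets_in(2)] IH(2)[OF jets_sub] in auto)
    moreover have "x \<in> jet_ideal N d \<rho> Inr N' \<delta> (r + l)" if "x \<in> jet_ideal N d \<rho> Inl N' \<delta> r" for x
      by (rule jet_ideal_Inl_Inr[OF dInl dInr dbar refl that])
    moreover have "x \<in> jet_ideal N d \<rho> Inr N' \<delta> (r + l)" if "x \<in> jet_ideal N d \<rho> Inr N' \<delta> r" for x
      by (rule jet_ideal_mono[OF _ that]) simp
    ultimately show ?thesis unfolding r_def[symmetric] by blast
  next
    case False
    have k: "fl (Suc b * n) x = 0" if "x \<in> jet_ideal N d \<rho> Inl N' \<delta> (r + l)" for x
      by (rule kill_gens[OF _ _ that])
        (use block_fixes(2)[OF False jets_in(1)] IH(1)[OF jets_sub] in auto)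
    moreover have "x \<in> jet_ideal N d \<rho> Inl N' \<delta> (r + l)" if "x \<in> jet_ideal N d \<rho> Inr N' \<delta> r" for x
      by (rule jet_ideal_Inr_Inl[OF dInl dInr dbar refl that])
    moreover have "x \<in> jet_ideal N d \<rho> Inl N' \<delta> (r + l)" if "x \<in> jet_ideal N d \<rho> Inl N' \<delta> r" for x
      by (rule jet_ideal_mono[OF _ that]) simp
    ultimately show ?thesis unfolding r_def[symmetric] by blast
  qed
qed

lemma kill_delta:
  assumes k: "k \<le> d + 2" and j: "j < N'" shows "fl (k * n) (\<delta> (Inl j)) = 0"
proof -
  have d0: "\<delta> (Inl j) \<in> jet_ideal N d \<rho> Inl N' \<delta> 0"
    by (rule jets_sub) (use j in \<open>auto simp: jets_def intro!: exI[of _ "[]"] exI[of _ j]\<close>)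
  have le: "fl (k * n) (\<delta> (Inl j)) = 0" if "k \<le> d + 1" for k
    using kill_blocks[OF that] jet_ideal_mono[OF _ d0] by blast
  show ?thesis
  proof (cases "k \<le> d + 1")
    case False
    \<comment> \<open>Block d + 1 has odd parity (d + 1) + d, so it moves \<zeta> only and costs
      nothing for a series in Z.\<close>
    then have "k = Suc (d + 1)" using k by simp
    then show ?thesis using block_fixes(2)[of "d + 1" "\<delta> (Inl j)"] dInl le[of "d + 1"] by simp
  qed (rule le)
qed

end

end

section \<open>From equal jets to vanishing coefficients\<close>

lemma multi_pow_deriv:
  "\<exists>c. c \<noteq> 0 \<and> (\<forall>f. mps_at0 (multi_pow N mps_deriv \<alpha> f) = c * mcoeff f (\<Sum>i<N. Poly_Mapping.single i (\<alpha> i)))"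
proof -
  have pow: "\<exists>c. c \<noteq> 0 \<and> (\<forall>f. mcoeff ((mps_deriv i ^^ k) f) m = c * mcoeff f (m + Poly_Mapping.single i k))" for i k and m :: "nat \<Rightarrow>\<^sub>0 nat"
  proof (induction k arbitrary: m)
    case 0 then show ?case by (intro exI[of _ 1]) simp
  next
    case (Suc k)
    obtain c where c: "c \<noteq> 0" "\<forall>f. mcoeff ((mps_deriv i ^^ k) f) (m + Poly_Mapping.single i 1) =
        c * mcoeff f (m + Poly_Mapping.single i 1 + Poly_Mapping.single i k)" using Suc by blast
    have e: "m + Poly_Mapping.single i 1 + Poly_Mapping.single i k = m + Poly_Mapping.single i (Suc k)"
      by (simp add: add.assoc single_add[symmetric])
    have nz: "of_nat (lookup m i + 1) \<noteq> (0 :: complex)" by (simp only: of_nat_eq_0_iff)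
    have "mcoeff ((mps_deriv i ^^ Suc k) f) m = (of_nat (lookup m i + 1) * c) * mcoeff f (m + Poly_Mapping.single i (Suc k))" for f
      using c(2) unfolding e by (simp add: mcoeff_deriv mult.assoc del: of_nat_add)
    moreover have "of_nat (lookup m i + 1) * c \<noteq> 0" using nz c(1) by simp
    ultimately show ?case by blast
  qed
  have "\<exists>c. c \<noteq> 0 \<and> (\<forall>f. mcoeff (foldr (\<lambda>i F. (mps_deriv i ^^ \<alpha> i) \<circ> F) xs id f) m =
      c * mcoeff f (m + (\<Sum>i\<leftarrow>xs. Poly_Mapping.single i (\<alpha> i))))" for xs and m :: "nat \<Rightarrow>\<^sub>0 nat"
  proof (induction xs arbitrary: m)
    case Nil then show ?case by (intro exI[of _ 1]) simp
  next
    case (Cons x xs)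
    obtain c1 where c1: "c1 \<noteq> 0" "\<forall>f. mcoeff ((mps_deriv x ^^ \<alpha> x) f) m = c1 * mcoeff f (m + Poly_Mapping.single x (\<alpha> x))"
      using pow by blast
    obtain c2 where c2: "c2 \<noteq> 0" "\<forall>f. mcoeff (foldr (\<lambda>i F. (mps_deriv i ^^ \<alpha> i) \<circ> F) xs id f) (m + Poly_Mapping.single x (\<alpha> x)) =
      c2 * mcoeff f (m + Poly_Mapping.single x (\<alpha> x) + (\<Sum>i\<leftarrow>xs. Poly_Mapping.single i (\<alpha> i)))" using Cons by blast
    have "mcoeff (foldr (\<lambda>i F. (mps_deriv i ^^ \<alpha> i) \<circ> F) (x # xs) id f) m =
        (c1 * c2) * mcoeff f (m + (\<Sum>i\<leftarrow>x # xs. Poly_Mapping.single i (\<alpha> i)))" for f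
      using c1(2) c2(2) by (simp only: foldr.simps o_apply sum_list.Cons list.map add.assoc mult.assoc)
    moreover have "c1 * c2 \<noteq> 0" using c1(1) c2(1) by simp
    ultimately show ?case by blast
  qed
  from this[of "[0..<N]" 0] show ?thesis
    unfolding multi_pow_def mps_at0_def by (simp add: interv_sum_list_conv_sum_set_nat lessThan_atLeast0)
qed

lemma foldr_deriv_low_order:
  assumes "\<And>m. pm_deg m \<le> length w + r \<Longrightarrow> mcoeff f m = 0" "pm_deg m \<le> r"
  shows "mcoeff (foldr mps_deriv w f) m = 0"
  using assms
proof (induction w arbitrary: r m)
  case (Cons v w)
  have "mcoeff (foldr mps_deriv w f) (m + Poly_Mapping.single v 1) = 0"
    by (rule Cons.IH[of "Suc r"]) (use Cons.prems in \<open>simp_all add: pm_deg_add\<close>)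
  then show ?case by (simp add: mcoeff_deriv)
qed simp

lemma same_jet_low_order:
  assumes H: "formal_mapping N N' H1" "formal_mapping N N' H2" and jet: "same_jet N N' r H1 H2"
    and k: "k < N'" and m: "pm_deg m \<le> r"
  shows "mcoeff (H1 k - H2 k) m = 0"
proof (cases "keys m \<subseteq> {..<N}")
  case True
  obtain c where c: "c \<noteq> 0" "\<And>f. mps_at0 (multi_pow N mps_deriv (lookup m) f) = c * mcoeff f (\<Sum>i<N. Poly_Mapping.single i (lookup m i))"
    using multi_pow_deriv by blast
  have "(\<Sum>i<N. Poly_Mapping.single i (lookup m i)) = m"
    using True by (intro pm_eqI) (auto simp: lookup_sum lookup_single when_def in_keys_iff)
  then have e: "mps_at0 (multi_pow N mps_deriv (lookup m) f) = c * mcoeff f m" for f using c(2) by simp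
  have "(\<Sum>i<N. lookup m i) \<le> r" using m pm_deg_superset[OF _ True] by simp
  then have "mps_at0 (multi_pow N mps_deriv (lookup m) (H1 k)) = mps_at0 (multi_pow N mps_deriv (lookup m) (H2 k))"
    using jet k unfolding same_jet_def by blast
  then show ?thesis using c(1) by (simp add: e)
next
  case False
  then show ?thesis using mps_in_coeff[OF formal_mapping_in[OF H(1)]] mps_in_coeff[OF formal_mapping_in[OF H(2)]] by simp
qed

lemma Inl_subst_inj:
  assumes f: "f \<in> mps_in {..<N :: nat}" and 0: "mps_subst f (mps_var \<circ> Inl) = (0 :: (nat + nat) mps)"
  shows "f = 0"
proof -
  \<comment> \<open>Setting \<zeta> to 0 and renaming Z gives a left inverse of the
    substitution.\<close>
  define \<psi> where "\<psi> g = mps_subst g (case_sum mps_var (\<lambda>_. 0))" for g :: "(nat + nat) mps"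
  have h0: "v \<in> vars N \<Longrightarrow> mcoeff (case_sum mps_var (\<lambda>_. 0) v :: nat mps) 0 = 0" for v by (cases v) auto
  have \<psi>: "mps_hom (vars N) \<psi>" unfolding \<psi>_def by (rule subst_hom[OF finite_vars h0])
  have "\<psi> (mps_subst f (mps_var \<circ> Inl)) = f"
  proof (rule hom_unique[OF hom_comp[OF Inl_hom \<psi>] id_hom _ f])
    show "mps_subst g (mps_var \<circ> Inl) \<in> series N" if "g \<in> mps_in {..<N}" for g
      by (rule Inl_series[OF Inl_subst_in[OF that]])
    show "\<psi> (mps_subst (mps_var v) (mps_var \<circ> Inl)) = mps_var v" if "v \<in> {..<N}" for v
    proof -
      have "mps_subst (mps_var v) (mps_var \<circ> Inl) = (mps_var (Inl v) :: (nat + nat) mps)"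
        using that subst_var[of "{..<N}" "mps_var \<circ> Inl" v] by simp
      moreover have "\<psi> (mps_var (Inl v)) = mps_var v"
        using that subst_var[of "vars N" "case_sum mps_var (\<lambda>_. 0)" "Inl v", OF finite_vars h0] by (simp add: \<psi>_def)
      ultimately show ?thesis by simp
    qed
  qed simp
  then show ?thesis using 0 hom_0[OF \<psi>] by simp
qed

theorem theorem2p1p1:
  fixes N d :: nat and M :: manifold
  assumes "formal_submanifold N d M" "generic d M" "d \<ge> 1" "finite_type N d M"
  shows "\<exists>k0::nat. 1 < k0 \<and> k0 \<le> d + 1 \<and>
    (\<forall>(N'::nat) (d'::nat) (M'::manifold) (l0::nat) (H1 :: nat \<Rightarrow> nat mps) (H2 :: nat \<Rightarrow> nat mps).
       formal_submanifold N' d' M' \<longrightarrow> generic d' M' \<longrightarrow> nondegenerate N' d' M' l0 \<longrightarrow>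
       maps_into N d M N' d' M' H1 \<longrightarrow> CR_submersive N d M N' d' M' H1 \<longrightarrow>
       maps_into N d M N' d' M' H2 \<longrightarrow> CR_submersive N d M N' d' M' H2 \<longrightarrow>
       same_jet N N' (k0 * l0) H1 H2 \<longrightarrow>
       H1 = H2)"
\<comment> \<open>The witness depends on M through its codimension alone.\<close>
proof (intro exI[of _ "d + 1"] conjI allI impI)
  show "1 < d + 1" "d + 1 \<le> d + 1" using assms(3) by auto
  fix N' d' M' l0 and H1 H2 :: "nat \<Rightarrow> nat mps"
  assume M': "formal_submanifold N' d' M'" "generic d' M'" "nondegenerate N' d' M' l0"
    and H1: "maps_into N d M N' d' M' H1" "CR_submersive N d M N' d' M' H1"
    and H2: "maps_into N d M N' d' M' H2"
    and jet: "same_jet N N' ((d + 1) * l0) H1 H2"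
  obtain \<rho> I B B' where \<rho>: "\<rho> \<in> M" "generic_series N d \<rho> I B B'"
    using generic_series_exists[OF assms(1,2)] by blast
  interpret generic_series N d \<rho> I B B' by (rule \<rho>(2))
  have Hf: "formal_mapping N N' H1" "formal_mapping N N' H2" using H1 H2 by (auto simp: maps_into_def)
  define \<delta> where "\<delta> v = complexification H1 v - complexification H2 v" for v
  have dInl: "\<delta> (Inl k) \<in> mps_in (Inl ` {..<N})" and dInr: "\<delta> (Inr k) \<in> mps_in (Inr ` {..<N})" for k
    unfolding \<delta>_def using cpl_Inl[OF Hf(1)] cpl_Inl[OF Hf(2)] cpl_Inr[OF Hf(1)] cpl_Inr[OF Hf(2)] by auto
  have dbar: "mps_bar (\<delta> (Inl k)) = \<delta> (Inr k)" "mps_bar (\<delta> (Inr k)) = \<delta> (Inl k)" for k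
    unfolding \<delta>_def using bar_diff[OF cpl_in[OF Hf(1)] cpl_in[OF Hf(2)]]
    by (simp_all add: bar_cpl[OF Hf(1)] bar_cpl[OF Hf(2)])
  have refl: "\<delta> (Inl k) \<in> jet_ideal N d \<rho> Inr N' \<delta> l0" if "k < N'" for k
    using reflection_submersive[OF assms(1) \<rho>(1) M' H1 H2 that] unfolding \<delta>_def .
  have h_in: "H1 k - H2 k \<in> mps_in {..<N}" for k
    using formal_mapping_in[OF Hf(1)] formal_mapping_in[OF Hf(2)] by auto
  have \<delta>_sub: "\<delta> (Inl k) = mps_subst (H1 k - H2 k) (mps_var \<circ> Inl)"
    "\<delta> (Inr k) = mps_subst (mps_cnj (H1 k - H2 k)) (mps_var \<circ> Inr)" for k
    using formal_mapping_in[OF Hf(1), of k] formal_mapping_in[OF Hf(2), of k]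
    by (simp_all add: \<delta>_def complexification_def hom_diff[OF Inl_hom[of N]] hom_diff[OF Inr_hom[of N]] mps_in_cnj)
  have low: "mcoeff (\<delta> v) m = 0" if "v \<in> vars N'" "pm_deg m \<le> (d + 1) * l0" for v m
  proof (cases v)
    case (Inl k)
    then have k: "k < N'" using that by simp
    show ?thesis unfolding Inl \<delta>_sub
      by (rule subst_low_order[OF _ _ h_in same_jet_low_order[OF Hf jet k] that(2)]) auto
  next
    case (Inr k)
    then have k: "k < N'" using that by simp
    show ?thesis unfolding Inr \<delta>_sub
      by (rule subst_low_order[OF _ _ mps_in_cnj[OF h_in] _ that(2)])
        (use same_jet_low_order[OF Hf jet k] in auto)
  qed
  have jets0: "mcoeff (foldr mps_deriv w (\<delta> v)) 0 = 0" if "length w \<le> (d + 1) * l0" "v \<in> vars N'" for w v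
    by (rule foldr_deriv_low_order[of w 0]) (use low[OF that(2)] that(1) in auto)
  \<comment> \<open>The stable flow may have fewer than d + 2 blocks; \<open>kill_delta\<close>
    covers every k up to d + 2, so the difference vanishes along whichever flow is stable.\<close>
  obtain k where k: "2 \<le> k" "k \<le> d + 2" "stable (k * n)" using stable_exists by blast
  have "\<delta> (Inl j) = 0" if j: "j < N'" for j
  proof (rule stable_zero[OF assms(1) \<rho>(1) k(3) assms(4) dInl])
    show "fl (k * n) (\<delta> (Inl j)) = 0"
      by (rule kill_delta[OF dInl dInr dbar refl _ _ k(2) j]) (auto intro!: jets0)
  qed
  then have "H1 j = H2 j" if "j < N'" for j
    using Inl_subst_inj[OF h_in, of j] that \<delta>_sub(1) by simp
  moreover have "H1 j = H2 j" if "\<not> j < N'" for j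
    using Hf that by (simp add: formal_mapping_def tuples_def)
  ultimately show "H1 = H2" by blast
qed

end
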